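(* Let $\Omega\subset\mathbb{R}^d$, $d\in\{2,3\}$. There is a constant $C_{stab}>0$, independent of $h$, $\Delta t_n$, $\omega_n$, $\nu$ and of the discrete solution, such that if $N>1$, $u_h^0,u_h^1\in X_h$, $(u_h^{n+1},p^{n+1})$ are given by the VSS BE-AB2 scheme for $n=1,\dots,N-1$, and for every $n=1,\dots,N-1$ either $$1-\frac{C_{stab}\,\Delta t_n(1+\omega_n^2)}{\nu h^2}\,\|E^{n+1}(u_h)\|_{L^3}^2\geq 0$$ or $$1-\frac{C_{stab}\,\Delta t_n(1+\omega_n^2)}{\nu h}\Big(\|E^{n+1}(u_h)\|_{L^6}^2+\|\nabla\cdot E^{n+1}(u_h)\|^2\Big)\geq 0,$$ then $$\frac12\|u_h^N\|^2+\frac14\|u_h^N-u_h^{N-1}\|^2+\frac{\nu}{4}\sum_{n=1}^{N-1}\Delta t_n\|\nabla u_h^{n+1}\|^2+\sum_{n=1}^{N-1}\frac{1}{8(1+\omega_n^2)}\big\|u_h^{n+1}-u_h^n+\omega_n(u_h^n-u_h^{n-1})\big\|^2$$ $$\leq\sum_{n=1}^{N-1}\frac{\Delta t_n}{\nu}\|f^{n+1}\|_{-1}^2+\frac12\|u_h^1\|^2+\frac14\|u_h^1-u_h^0\|^2 .$$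
   Context: $\Omega\subset\mathbb{R}^d$ is a bounded regular (polygonal/polyhedral) domain; $\|\cdot\|,(\cdot,\cdot)$ are the $L^2(\Omega)$ norm and inner product. $X=[H^1_0(\Omega)]^d$, $Q=L^2_0(\Omega)$. $X_h\subset X$, $Q_h\subset Q$ are conforming finite element spaces on a regular (quasi-uniform) triangulation of maximal diameter $h$, satisfying the discrete inf-sup condition and the inverse inequality $\|v_h\|\le Ch^{-1}\|\nabla v_h\|$ for all $v_h\in X_h$ (together with the standard local inverse estimates between $L^p$ norms on quasi-uniform meshes). $\|f\|_{-1}=\sup_{0\ne v\in X}(f,v)/\|\nabla v\|$. $b^{\ast}(u,v,w)=\tfrac12(u\cdot\nabla v,w)-\tfrac12(u\cdot\nabla w,v)$. $\nu>0$. Time grid $0=t^0<\dots<t^N$, $\Delta t_n=t^{n+1}-t^n$, $\omega_n=\Delta t_n/\Delta t_{n-1}$, $E^{n+1}(v)=(1+\omega_n)v^n-\omega_n v^{n-1}$. The VSS BE-AB2 scheme: for $n=1,\dots,N-1$ find $(u_h^{n+1},p^{n+1})\in X_h\times Q_h$ with $\big(\tfrac{u_h^{n+1}-u_h^n}{\Delta t_n},v_h\big)+\nu(\nabla u_h^{n+1},\nabla v_h)+b^{\ast}(E^{n+1}(u_h),E^{n+1}(u_h),v_h)-(p^{n+1},\nabla\cdot v_h)=(f^{n+1},v_h)$ for all $v_h\in X_h$, and $(\nabla\cdot u_h^{n+1},q_h)=0$ for all $q_h\in Q_h$. *)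

theory Defs
  imports "HOL-Analysis.Analysis"
begin

type_synonym 'd vfield = "real^'d \<Rightarrow> real^'d"
type_synonym 'd sfield = "real^'d \<Rightarrow> real"

definition pd :: "'d sfield \<Rightarrow> 'd::finite \<Rightarrow> 'd sfield" where
  "pd \<phi> j = (\<lambda>x. frechet_derivative \<phi> (at x) (axis j 1))"

fun pds :: "'d::finite list \<Rightarrow> 'd sfield \<Rightarrow> 'd sfield" where
  "pds [] \<phi> = \<phi>"
| "pds (j # js) \<phi> = pd (pds js \<phi>) j"

definition smooth_fun :: "('d::finite) sfield \<Rightarrow> bool" where
  "smooth_fun \<phi> \<longleftrightarrow> (\<forall>js x. pds js \<phi> differentiable (at x))"

definition test_fun :: "(real^'d::finite) set \<Rightarrow> 'd sfield \<Rightarrow> bool" where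
  "test_fun \<Omega> \<phi> \<longleftrightarrow> smooth_fun \<phi> \<and> compact (closure {x. \<phi> x \<noteq> 0})
      \<and> closure {x. \<phi> x \<noteq> 0} \<subseteq> \<Omega>"

definition L2 :: "(real^'d::finite) set \<Rightarrow> 'd sfield \<Rightarrow> bool" where
  "L2 \<Omega> w \<longleftrightarrow> w \<in> borel_measurable (lebesgue_on \<Omega>)
      \<and> integrable (lebesgue_on \<Omega>) (\<lambda>x. (w x)\<^sup>2)"

definition integ :: "(real^'d::finite) set \<Rightarrow> 'd sfield \<Rightarrow> real" where
  "integ \<Omega> g = integral\<^sup>L (lebesgue_on \<Omega>) g"

definition is_wgrad :: "(real^'d::finite) set \<Rightarrow> 'd sfield \<Rightarrow> 'd vfield \<Rightarrow> bool" where
  "is_wgrad \<Omega> w G \<longleftrightarrow> (\<forall>j. L2 \<Omega> (\<lambda>x. G x $ j)) \<and>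
     (\<forall>\<phi>. test_fun \<Omega> \<phi> \<longrightarrow> (\<forall>j. integ \<Omega> (\<lambda>x. w x * pd \<phi> j x)
                                  = - integ \<Omega> (\<lambda>x. G x $ j * \<phi> x)))"

definition wgrad :: "(real^'d::finite) set \<Rightarrow> 'd sfield \<Rightarrow> 'd vfield" where
  "wgrad \<Omega> w = (SOME G. is_wgrad \<Omega> w G)"

definition H10s :: "(real^'d::finite) set \<Rightarrow> 'd sfield \<Rightarrow> bool" where
  "H10s \<Omega> w \<longleftrightarrow> L2 \<Omega> w \<and> (\<exists>\<phi> G. (\<forall>k. test_fun \<Omega> (\<phi> k)) \<and> is_wgrad \<Omega> w G
      \<and> (\<lambda>k. integ \<Omega> (\<lambda>x. (w x - \<phi> k x)\<^sup>2)) \<longlonglongrightarrow> 0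
      \<and> (\<forall>j. (\<lambda>k. integ \<Omega> (\<lambda>x. (G x $ j - pd (\<phi> k) j x)\<^sup>2)) \<longlonglongrightarrow> 0))"

definition H10 :: "(real^'d::finite) set \<Rightarrow> 'd vfield set" where
  "H10 \<Omega> = {v. \<forall>i. H10s \<Omega> (\<lambda>x. v x $ i)}"

definition L20 :: "(real^'d::finite) set \<Rightarrow> 'd sfield set" where
  "L20 \<Omega> = {q. L2 \<Omega> q \<and> integ \<Omega> q = 0}"

definition vgrad :: "(real^'d::finite) set \<Rightarrow> 'd vfield \<Rightarrow> real^'d \<Rightarrow> real^'d^'d" where
  "vgrad \<Omega> v x = (\<chi> i j. wgrad \<Omega> (\<lambda>y. v y $ i) x $ j)"

definition vdiv :: "(real^'d::finite) set \<Rightarrow> 'd vfield \<Rightarrow> 'd sfield" where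
  "vdiv \<Omega> v = (\<lambda>x. \<Sum>i\<in>UNIV. vgrad \<Omega> v x $ i $ i)"

definition ipv :: "(real^'d::finite) set \<Rightarrow> 'd vfield \<Rightarrow> 'd vfield \<Rightarrow> real" where
  "ipv \<Omega> u v = integ \<Omega> (\<lambda>x. u x \<bullet> v x)"

definition ips :: "(real^'d::finite) set \<Rightarrow> 'd sfield \<Rightarrow> 'd sfield \<Rightarrow> real" where
  "ips \<Omega> p q = integ \<Omega> (\<lambda>x. p x * q x)"

definition nv :: "(real^'d::finite) set \<Rightarrow> 'd vfield \<Rightarrow> real" where
  "nv \<Omega> u = sqrt (ipv \<Omega> u u)"

definition ns :: "(real^'d::finite) set \<Rightarrow> 'd sfield \<Rightarrow> real" where
  "ns \<Omega> q = sqrt (ips \<Omega> q q)"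

definition lpn :: "(real^'d::finite) set \<Rightarrow> real \<Rightarrow> 'd vfield \<Rightarrow> real" where
  "lpn \<Omega> p u = (integ \<Omega> (\<lambda>x. norm (u x) powr p)) powr (1 / p)"

definition gip :: "(real^'d::finite) set \<Rightarrow> 'd vfield \<Rightarrow> 'd vfield \<Rightarrow> real" where
  "gip \<Omega> u v = integ \<Omega> (\<lambda>x. \<Sum>i\<in>UNIV. \<Sum>j\<in>UNIV. vgrad \<Omega> u x $ i $ j * vgrad \<Omega> v x $ i $ j)"

definition gnorm :: "(real^'d::finite) set \<Rightarrow> 'd vfield \<Rightarrow> real" where
  "gnorm \<Omega> v = sqrt (gip \<Omega> v v)"

definition trilin :: "(real^'d::finite) set \<Rightarrow> 'd vfield \<Rightarrow> 'd vfield \<Rightarrow> 'd vfield \<Rightarrow> real" where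
  "trilin \<Omega> u v w = integ \<Omega> (\<lambda>x. \<Sum>i\<in>UNIV. \<Sum>j\<in>UNIV. u x $ j * vgrad \<Omega> v x $ i $ j * w x $ i)"

definition bstar :: "(real^'d::finite) set \<Rightarrow> 'd vfield \<Rightarrow> 'd vfield \<Rightarrow> 'd vfield \<Rightarrow> real" where
  "bstar \<Omega> u v w = trilin \<Omega> u v w / 2 - trilin \<Omega> u w v / 2"

definition hm1 :: "(real^'d::finite) set \<Rightarrow> 'd vfield \<Rightarrow> real" where
  "hm1 \<Omega> f = Sup {ipv \<Omega> f v / gnorm \<Omega> v | v. v \<in> H10 \<Omega> \<and> gnorm \<Omega> v \<noteq> 0}"

definition poly_domain :: "(real^'d::finite) set \<Rightarrow> bool" where
  "poly_domain \<Omega> \<longleftrightarrow> open \<Omega> \<and> bounded \<Omega> \<and> connected \<Omega> \<and> \<Omega> \<noteq> {}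
     \<and> interior (closure \<Omega>) = \<Omega>
     \<and> (\<exists>P. finite P \<and> (\<forall>K\<in>P. polytope K) \<and> closure \<Omega> = \<Union>P)"

definition triangulation :: "(real^'d::finite) set \<Rightarrow> (real^'d) set set \<Rightarrow> bool" where
  "triangulation \<Omega> T \<longleftrightarrow> finite T \<and> T \<noteq> {}
     \<and> (\<forall>K\<in>T. int CARD('d) simplex K)
     \<and> \<Union>T = closure \<Omega>
     \<and> (\<forall>K\<in>T. \<forall>K'\<in>T. (K \<inter> K') face_of K \<and> (K \<inter> K') face_of K')"

definition mesh_size :: "(real^'d::finite) set set \<Rightarrow> real" where
  "mesh_size T = Max (diameter ` T)"

definition quasi_uniform :: "real \<Rightarrow> (real^'d::finite) set set \<Rightarrow> bool" where
  "quasi_uniform \<sigma> T \<longleftrightarrow> (\<forall>K\<in>T. \<exists>z r. r > 0 \<and> ball z r \<subseteq> K \<and> mesh_size T \<le> \<sigma> * r)"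

definition polyfun :: "nat \<Rightarrow> ('d::finite) sfield \<Rightarrow> bool" where
  "polyfun k P \<longleftrightarrow> (\<exists>c. \<forall>x. P x = (\<Sum>\<alpha>\<in>{\<alpha>::'d \<Rightarrow> nat. sum \<alpha> UNIV \<le> k}.
                                        c \<alpha> * (\<Prod>i\<in>UNIV. (x $ i) ^ \<alpha> i)))"

definition vsubspace :: "('a \<Rightarrow> 'b::real_vector) set \<Rightarrow> bool" where
  "vsubspace S \<longleftrightarrow> (\<lambda>x. 0) \<in> S \<and>
     (\<forall>a v w. v \<in> S \<longrightarrow> w \<in> S \<longrightarrow> (\<lambda>x. a *\<^sub>R v x + w x) \<in> S)"

definition fe_velocity :: "(real^'d::finite) set \<Rightarrow> (real^'d) set set \<Rightarrow> 'd vfield set \<Rightarrow> bool" where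
  "fe_velocity \<Omega> T Xh \<longleftrightarrow> vsubspace Xh \<and> Xh \<subseteq> H10 \<Omega> \<and>
     (\<exists>k. \<forall>v\<in>Xh. \<forall>K\<in>T. \<forall>i. \<exists>P. polyfun k P \<and> (\<forall>x\<in>K. v x $ i = P x))"

definition fe_pressure :: "(real^'d::finite) set \<Rightarrow> (real^'d) set set \<Rightarrow> 'd sfield set \<Rightarrow> bool" where
  "fe_pressure \<Omega> T Qh \<longleftrightarrow> vsubspace Qh \<and> Qh \<subseteq> L20 \<Omega> \<and>
     (\<exists>k. \<forall>q\<in>Qh. \<forall>K\<in>T. \<exists>P. polyfun k P \<and> (\<forall>x\<in>interior K. q x = P x))"

definition inf_sup :: "(real^'d::finite) set \<Rightarrow> 'd vfield set \<Rightarrow> 'd sfield set \<Rightarrow> real \<Rightarrow> bool" where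
  "inf_sup \<Omega> Xh Qh \<beta> \<longleftrightarrow> \<beta> > 0 \<and> (\<forall>q\<in>Qh. \<beta> * ns \<Omega> q \<le>
      Sup {ips \<Omega> q (vdiv \<Omega> v) / gnorm \<Omega> v | v. v \<in> Xh \<and> gnorm \<Omega> v \<noteq> 0})"

definition inverse_ineqs :: "(real^'d::finite) set \<Rightarrow> 'd vfield set \<Rightarrow> real \<Rightarrow> real \<Rightarrow> bool" where
  "inverse_ineqs \<Omega> Xh h C \<longleftrightarrow> (\<forall>v\<in>Xh.
      nv \<Omega> v \<le> C / h * gnorm \<Omega> v
    \<and> gnorm \<Omega> v \<le> C / h * nv \<Omega> v
    \<and> (\<forall>p q. 1 \<le> q \<and> q \<le> p \<and> p \<le> 6 \<longrightarrow>
          lpn \<Omega> p v \<le> C * h powr (real CARD('d) / p - real CARD('d) / q) * lpn \<Omega> q v))"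

definition dt :: "(nat \<Rightarrow> real) \<Rightarrow> nat \<Rightarrow> real" where
  "dt t n = t (Suc n) - t n"

definition om :: "(nat \<Rightarrow> real) \<Rightarrow> nat \<Rightarrow> real" where
  "om t n = dt t n / dt t (n - 1)"

text \<open>E^{n+1}(v) = (1 + omega_n) v^n - omega_n v^{n-1}\<close>
definition Ext :: "(nat \<Rightarrow> real) \<Rightarrow> (nat \<Rightarrow> ('d::finite) vfield) \<Rightarrow> nat \<Rightarrow> 'd vfield" where
  "Ext t u n = (\<lambda>x. (1 + om t n) *\<^sub>R u n x - om t n *\<^sub>R u (n - 1) x)"

definition vss_be_ab2 :: "(real^'d::finite) set \<Rightarrow> 'd vfield set \<Rightarrow> 'd sfield set \<Rightarrow> real
   \<Rightarrow> (nat \<Rightarrow> real) \<Rightarrow> nat \<Rightarrow> (nat \<Rightarrow> 'd vfield) \<Rightarrow> (nat \<Rightarrow> 'd sfield) \<Rightarrow> (nat \<Rightarrow> 'd vfield) \<Rightarrow> bool" where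
  "vss_be_ab2 \<Omega> Xh Qh \<nu> t N u p f \<longleftrightarrow>
     (\<forall>n. 1 \<le> n \<and> n \<le> N - 1 \<longrightarrow>
        u (Suc n) \<in> Xh \<and> p (Suc n) \<in> Qh
      \<and> (\<forall>v\<in>Xh. ipv \<Omega> (\<lambda>x. (1 / dt t n) *\<^sub>R (u (Suc n) x - u n x)) v
                 + \<nu> * gip \<Omega> (u (Suc n)) v
                 + bstar \<Omega> (Ext t u n) (Ext t u n) v
                 - ips \<Omega> (p (Suc n)) (vdiv \<Omega> v)
                 = ipv \<Omega> (f (Suc n)) v)
      \<and> (\<forall>q\<in>Qh. ips \<Omega> (vdiv \<Omega> (u (Suc n))) q = 0))"

end

theory Submission
  imports Defs
begin

text \<open>
  Testing the scheme with the new iterate \<open>u'\<close> removes the pressure. With \<open>a = u' - u\<close> and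
  \<open>b = u - v\<close> the last two increments, the numerical dissipation \<open>\<parallel>a\<parallel>\<^sup>2/2\<close> splits into a
  telescoping part and a part dominating \<open>(\<parallel>a - \<omega>b\<parallel>\<^sup>2 + \<parallel>a + \<omega>b\<parallel>\<^sup>2) / (8(1 + \<omega>\<^sup>2))\<close>. By skew
  symmetry the convective term \<open>b\<^sup>*(E, E, u')\<close> equals \<open>b\<^sup>*(E, u', w)\<close> with
  \<open>w = u' - E = a - \<omega>b\<close>, so under either time step condition it is absorbed by \<open>\<parallel>w\<parallel>\<^sup>2\<close> and
  the viscous term. This uses Hoelder's inequality with exponents 2, 3, 6, inverse estimates for
  \<open>w\<close>, and Sobolev's inequality \<open>\<parallel>u\<parallel>\<^sub>6 \<le> K \<parallel>\<nabla>u\<parallel>\<close>; for the second condition the derivative is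
  first moved off \<open>w\<close> by parts.

  Sobolev's inequality for test functions \<open>\<phi>\<close> is the Gagliardo--Nirenberg argument applied to
  \<open>\<phi>\<^sup>4\<close> (\<open>d = 3\<close>, Loomis--Whitney) or \<open>\<phi>\<^sup>3\<close> (\<open>d = 2\<close>), and it passes to \<open>H\<^sup>1\<^sub>0\<close> by Fatou's
  lemma. Uniqueness of weak gradients, i.e. density of test functions in \<open>L\<^sup>2\<close>, is never needed:
  weak gradients occur either paired with products of two \<open>H\<^sup>1\<^sub>0\<close> functions, which are limits of
  test functions, or in norms, for which the limit of gradients of test functions is minimal.
\<close>

text \<open>The exponents 2, 3, 6 are forced: a gradient lies only in L^2, Sobolev puts one
  undifferentiated factor into L^6, and 1/2 + 1/3 + 1/6 = 1 leaves L^3 for the other. The power of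
  \<open>\<phi>\<close> in the Gagliardo-Nirenberg argument is picked so that sixth powers appear:
  for d = 3, Cauchy-Schwarz on the derivative of \<open>\<phi>^4\<close> returns the integral of
  \<open>\<phi>^6\<close> itself, powers of which cancel; for d = 2, the cube returns the integral
  of \<open>\<phi>^4\<close>, and the finite measure of the domain pays for the interpolation.

  The obstacle is that \<open>wgrad\<close> is a \<open>SOME\<close> choice made separately for each
  function, so \<open>vgrad\<close> of a difference is not visibly the difference of the
  \<open>vgrad\<close>s. Linearity and the product rule are therefore proved only under the
  integral, against two H^1_0 factors.

  The final constant is 16 C^2: the share of the dissipation reserved for w is 1/(8 (1 + omega^2)),
  and a factor 2 pays for the square of a sum in the second condition. C collects the inverse
  constant, the Sobolev constant and the size of the domain, which absorbs surplus positive powers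
  of h when d = 2.\<close>

subsection \<open>Hoelder's inequality with exponents 2, 3, 6\<close>

text \<open>Two nested Young inequalities: exponents 2 and 2 split \<open>x\<close> from
  \<open>y * z\<close>, then 3/2 and 3 split \<open>y^2\<close> from \<open>z^2\<close>. The weights
  1/2, 1/3, 1/6 sum to 1, as Hoelder requires.\<close>

lemma Young_236:
  fixes x y z :: real
  assumes "0 \<le> x" "0 \<le> y" "0 \<le> z"
  shows "x * y * z \<le> x^2 / 2 + y^3 / 3 + z^6 / 6"
proof -
  have "y^2 * z^2 \<le> (y^2) powr (3/2) / (3/2) + (z^2) powr 3 / 3"
    by (rule Youngs_inequality) auto
  moreover have "(y^2) powr (3/2) = y^3"
  proof (cases "y = 0")
    case False
    with assms have "y > 0" by simp
    then have "(y^2) powr (3/2) = (y powr 2) powr (3/2)"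
      by (simp add: powr_numeral)
    also have "\<dots> = y powr 3" by (simp add: powr_powr)
    finally show ?thesis using \<open>y > 0\<close> by (simp add: powr_numeral)
  qed simp
  moreover have "(z^2) powr 3 = z^6" by (cases "z = 0") (auto simp: powr_numeral)
  ultimately have "(y * z)^2 \<le> 2/3 * y^3 + z^6 / 3" by (simp add: power_mult_distrib)
  moreover have "2 * (x * (y * z)) \<le> x^2 + (y*z)^2"
    using sum_squares_bound[of x "y*z"] by (simp add: algebra_simps)
  ultimately show ?thesis by (simp add: algebra_simps)
qed

lemma integrable_Holder_236:
  fixes f g h :: "'a \<Rightarrow> real"
  assumes [measurable]: "f \<in> borel_measurable M" "g \<in> borel_measurable M" "h \<in> borel_measurable M"
    and "integrable M (\<lambda>x. (f x)^2)" "integrable M (\<lambda>x. \<bar>g x\<bar>^3)" "integrable M (\<lambda>x. (h x)^6)"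
  shows "integrable M (\<lambda>x. f x * g x * h x)"
proof (rule Bochner_Integration.integrable_bound)
  show "integrable M (\<lambda>x. (f x)^2 / 2 + \<bar>g x\<bar>^3 / 3 + (h x)^6 / 6)"
    using assms by auto
  show "AE x in M. norm (f x * g x * h x) \<le> norm ((f x)^2 / 2 + \<bar>g x\<bar>^3 / 3 + (h x)^6 / 6)"
  proof (rule AE_I2)
    fix x
    have "\<bar>f x\<bar> * \<bar>g x\<bar> * \<bar>h x\<bar> \<le> (f x)^2 / 2 + \<bar>g x\<bar>^3 / 3 + (h x)^6 / 6"
      using Young_236[of "\<bar>f x\<bar>" "\<bar>g x\<bar>" "\<bar>h x\<bar>"] by (simp add: power_even_abs)
    then show "norm (f x * g x * h x) \<le> norm ((f x)^2 / 2 + \<bar>g x\<bar>^3 / 3 + (h x)^6 / 6)"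
      by (simp add: abs_mult)
  qed
qed simp

text \<open>The norms enter through arbitrary upper bounds of the integrals of powers, so no roots
  have to be handled here.\<close>

lemma Holder_236:
  fixes f g h :: "'a \<Rightarrow> real"
  assumes meas: "f \<in> borel_measurable M" "g \<in> borel_measurable M" "h \<in> borel_measurable M"
    and int: "integrable M (\<lambda>x. (f x)^2)" "integrable M (\<lambda>x. \<bar>g x\<bar>^3)" "integrable M (\<lambda>x. (h x)^6)"
    and le: "(\<integral>x. (f x)^2 \<partial>M) \<le> a^2" "(\<integral>x. \<bar>g x\<bar>^3 \<partial>M) \<le> b^3" "(\<integral>x. (h x)^6 \<partial>M) \<le> c^6"
    and nn: "0 \<le> a" "0 \<le> b" "0 \<le> c"
  shows "(\<integral>x. \<bar>f x * g x * h x\<bar> \<partial>M) \<le> a * b * c"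
proof -
  \<comment> \<open>Strictly larger bounds are positive, so the functions can be normalised by them
    even when a norm vanishes. Young's inequality then integrates to at most 1/2 + 1/3 + 1/6 = 1;
    letting the bounds decrease to \<open>a\<close>, \<open>b\<close>, \<open>c\<close> gives the
    claim.\<close>
  have pos: "(\<integral>x. \<bar>f x * g x * h x\<bar> \<partial>M) \<le> A * B * C" if "a < A" "b < B" "c < C" for A B C
  proof -
    have p: "0 < A" "0 < B" "0 < C" using that nn by auto
    have "(\<integral>x. \<bar>f x * g x * h x\<bar> \<partial>M)
        \<le> (\<integral>x. A*B*C * ((f x)^2 / (2*A^2) + \<bar>g x\<bar>^3 / (3*B^3) + (h x)^6 / (6*C^6)) \<partial>M)"
    proof (rule integral_mono)
      show "integrable M (\<lambda>x. \<bar>f x * g x * h x\<bar>)"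
        using integrable_Holder_236[OF meas int] by (rule integrable_abs)
      show "integrable M (\<lambda>x. A*B*C * ((f x)^2 / (2*A^2) + \<bar>g x\<bar>^3 / (3*B^3) + (h x)^6 / (6*C^6)))"
        using int by (intro integrable_mult_right Bochner_Integration.integrable_add) auto
      fix x
      have "\<bar>f x\<bar>/A * (\<bar>g x\<bar>/B) * (\<bar>h x\<bar>/C)
          \<le> (f x)^2 / (2*A^2) + \<bar>g x\<bar>^3 / (3*B^3) + (h x)^6 / (6*C^6)"
        using Young_236[of "\<bar>f x\<bar>/A" "\<bar>g x\<bar>/B" "\<bar>h x\<bar>/C"] p
        by (simp add: power_divide power_even_abs mult.commute)
      then have "A*B*C*(\<bar>f x\<bar>/A * (\<bar>g x\<bar>/B) * (\<bar>h x\<bar>/C))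
          \<le> A*B*C*((f x)^2 / (2*A^2) + \<bar>g x\<bar>^3 / (3*B^3) + (h x)^6 / (6*C^6))"
        using p by (intro mult_left_mono) auto
      then show "\<bar>f x * g x * h x\<bar> \<le> A*B*C*((f x)^2 / (2*A^2) + \<bar>g x\<bar>^3 / (3*B^3) + (h x)^6 / (6*C^6))"
        using p by (simp add: abs_mult)
    qed
    also have "\<dots> = A*B*C * ((\<integral>x. (f x)^2 \<partial>M) / (2*A^2) + (\<integral>x. \<bar>g x\<bar>^3 \<partial>M) / (3*B^3) + (\<integral>x. (h x)^6 \<partial>M) / (6*C^6))"
      using int by simp
    also have "\<dots> \<le> A*B*C * (1/2 + 1/3 + 1/6)"
    proof (rule mult_left_mono)
      have "(\<integral>x. (f x)^2 \<partial>M) \<le> A^2"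
        using le(1) power_mono[of a A 2] that nn by linarith
      moreover have "(\<integral>x. \<bar>g x\<bar>^3 \<partial>M) \<le> B^3"
        using le(2) power_mono[of b B 3] that nn by linarith
      moreover have "(\<integral>x. (h x)^6 \<partial>M) \<le> C^6"
        using le(3) power_mono[of c C 6] that nn by linarith
      ultimately show "(\<integral>x. (f x)^2 \<partial>M) / (2*A^2) + (\<integral>x. \<bar>g x\<bar>^3 \<partial>M) / (3*B^3) + (\<integral>x. (h x)^6 \<partial>M) / (6*C^6) \<le> 1/2 + 1/3 + 1/6"
        using p by (intro add_mono) (auto simp: divide_simps)
    qed (use p in auto)
    finally show ?thesis by simp
  qed
  have "((\<lambda>e. (a+e)*(b+e)*(c+e)) \<longlongrightarrow> (a+0)*(b+0)*(c+0)) (at_right 0)"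
    by (intro tendsto_intros)
  moreover have "eventually (\<lambda>e. (\<integral>x. \<bar>f x * g x * h x\<bar> \<partial>M) \<le> (a+e)*(b+e)*(c+e)) (at_right 0)"
    unfolding eventually_at_right_field by (intro exI[of _ 1]) (auto intro!: pos)
  ultimately show ?thesis
    using tendsto_lowerbound[of _ _ "at_right (0::real)"] by fastforce
qed

subsection \<open>Test functions\<close>

lemma pd_eqI: "(\<phi> has_derivative D) (at x) \<Longrightarrow> pd \<phi> j x = D (axis j 1)"
  unfolding pd_def by (metis frechet_derivative_at)

lemma smooth_fun_pds: "smooth_fun \<phi> \<Longrightarrow> pds js \<phi> differentiable (at x)"
  by (auto simp: smooth_fun_def)

lemma smooth_fun_differentiable: "smooth_fun \<phi> \<Longrightarrow> \<phi> differentiable (at x)"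
  using smooth_fun_pds[of \<phi> "[]"] by simp

lemma pds_pd: "pds js (pd \<phi> j) = pds (js @ [j]) \<phi>"
  by (induction js) auto

lemma smooth_fun_pd: "smooth_fun \<phi> \<Longrightarrow> smooth_fun (pd \<phi> j)"
  unfolding smooth_fun_def pds_pd by blast

lemma smooth_fun_continuous: "smooth_fun \<phi> \<Longrightarrow> continuous_on S \<phi>"
  by (meson continuous_at_imp_continuous_on differentiable_imp_continuous_within smooth_fun_differentiable)

lemma pd_lincomb:
  assumes "\<phi> differentiable (at x)" "\<psi> differentiable (at x)"
  shows "pd (\<lambda>x. a * \<phi> x + b * \<psi> x) j x = a * pd \<phi> j x + b * pd \<psi> j x"
proof -
  have "((\<lambda>x. a * \<phi> x + b * \<psi> x) has_derivative
      (\<lambda>h. a * frechet_derivative \<phi> (at x) h + b * frechet_derivative \<psi> (at x) h)) (at x)"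
    using assms by (intro derivative_intros) (auto simp: frechet_derivative_works)
  from pd_eqI[OF this] show ?thesis by (simp add: pd_def)
qed

lemma pd_mult:
  assumes "\<phi> differentiable (at x)" "\<psi> differentiable (at x)"
  shows "pd (\<lambda>x. \<phi> x * \<psi> x) j x = pd \<phi> j x * \<psi> x + \<phi> x * pd \<psi> j x"
proof -
  have "((\<lambda>x. \<phi> x * \<psi> x) has_derivative
      (\<lambda>h. \<phi> x * frechet_derivative \<psi> (at x) h + frechet_derivative \<phi> (at x) h * \<psi> x)) (at x)"
    using assms by (intro derivative_intros) (auto simp: frechet_derivative_works)
  from pd_eqI[OF this] show ?thesis by (simp add: pd_def)
qed

lemma pds_lincomb:
  assumes "smooth_fun \<phi>" "smooth_fun \<psi>"
  shows "pds js (\<lambda>x. a * \<phi> x + b * \<psi> x) = (\<lambda>x. a * pds js \<phi> x + b * pds js \<psi> x)"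
proof (induction js)
  case (Cons j js)
  show ?case
    unfolding pds.simps Cons.IH
    by (simp add: fun_eq_iff pd_lincomb smooth_fun_pds[OF assms(1)] smooth_fun_pds[OF assms(2)])
qed simp

lemma smooth_fun_lincomb:
  assumes "smooth_fun \<phi>" "smooth_fun \<psi>"
  shows "smooth_fun (\<lambda>x. a * \<phi> x + b * \<psi> x)"
  unfolding smooth_fun_def pds_lincomb[OF assms]
  using smooth_fun_pds[OF assms(1)] smooth_fun_pds[OF assms(2)] by (intro allI derivative_intros)

text \<open>Unlike the products themselves, their sums are closed under \<^const>\<open>pd\<close>.\<close>

inductive leibniz_sum :: "('d::finite) sfield \<Rightarrow> 'd sfield \<Rightarrow> 'd sfield \<Rightarrow> bool" for \<phi> \<psi> where
  prod: "leibniz_sum \<phi> \<psi> (\<lambda>x. pds js \<phi> x * pds ks \<psi> x)"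
| add: "leibniz_sum \<phi> \<psi> f \<Longrightarrow> leibniz_sum \<phi> \<psi> g \<Longrightarrow> leibniz_sum \<phi> \<psi> (\<lambda>x. f x + g x)"

lemma leibniz_sum_differentiable_pd:
  assumes "smooth_fun \<phi>" "smooth_fun \<psi>" "leibniz_sum \<phi> \<psi> f"
  shows "(\<forall>x. f differentiable (at x)) \<and> leibniz_sum \<phi> \<psi> (pd f j)"
  using assms(3)
proof (induction rule: leibniz_sum.induct)
  case (prod js ks)
  have "pd (\<lambda>x. pds js \<phi> x * pds ks \<psi> x) j
      = (\<lambda>x. pds (j # js) \<phi> x * pds ks \<psi> x + pds js \<phi> x * pds (j # ks) \<psi> x)"
    by (simp add: fun_eq_iff pd_mult smooth_fun_pds[OF assms(1)] smooth_fun_pds[OF assms(2)])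
  then have "leibniz_sum \<phi> \<psi> (pd (\<lambda>x. pds js \<phi> x * pds ks \<psi> x) j)"
    by (simp only: leibniz_sum.prod leibniz_sum.add)
  then show ?case
    using smooth_fun_pds[OF assms(1)] smooth_fun_pds[OF assms(2)] by (auto intro!: derivative_intros)
next
  case (add f g)
  then have "pd (\<lambda>x. f x + g x) j = (\<lambda>x. pd f j x + pd g j x)"
    using pd_lincomb[of f _ g 1 1] by (simp add: fun_eq_iff)
  with add show ?case by (auto intro!: derivative_intros leibniz_sum.add)
qed

lemma smooth_fun_mult:
  assumes "smooth_fun \<phi>" "smooth_fun \<psi>"
  shows "smooth_fun (\<lambda>x. \<phi> x * \<psi> x)"
proof -
  have "leibniz_sum \<phi> \<psi> (pds js (\<lambda>x. \<phi> x * \<psi> x))" for js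
  proof (induction js)
    case Nil
    show ?case using leibniz_sum.prod[of \<phi> \<psi> "[]" "[]"] by simp
  next
    case (Cons j js)
    then show ?case using leibniz_sum_differentiable_pd[OF assms] by simp
  qed
  then show ?thesis
    unfolding smooth_fun_def using leibniz_sum_differentiable_pd[OF assms] by blast
qed

lemma test_funI:
  assumes "smooth_fun \<phi>" "compact K" "K \<subseteq> \<Omega>" "\<And>x. \<phi> x \<noteq> 0 \<Longrightarrow> x \<in> K"
  shows "test_fun \<Omega> \<phi>"
proof -
  have "closure {x. \<phi> x \<noteq> 0} \<subseteq> K"
    using assms by (intro closure_minimal) (auto simp: compact_imp_closed)
  with assms show ?thesis
    unfolding test_fun_def by (meson compact_closure bounded_subset closure_subset compact_imp_bounded order_trans)
qed

lemma test_fun_smooth: "test_fun \<Omega> \<phi> \<Longrightarrow> smooth_fun \<phi>"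
  by (simp add: test_fun_def)

lemma test_fun_pd:
  assumes "test_fun \<Omega> \<phi>"
  shows "test_fun \<Omega> (pd \<phi> j)"
proof (rule test_funI)
  let ?K = "closure {x. \<phi> x \<noteq> 0}"
  show "smooth_fun (pd \<phi> j)" "compact ?K" "?K \<subseteq> \<Omega>"
    using assms by (auto simp: test_fun_def smooth_fun_pd)
  fix x assume "pd \<phi> j x \<noteq> 0"
  show "x \<in> ?K"
  proof (rule ccontr)
    assume "x \<notin> ?K"
    have "(\<phi> has_derivative (\<lambda>_. 0)) (at x)"
    proof (rule has_derivative_transform_within_open)
      show "((\<lambda>_. 0) has_derivative (\<lambda>_. 0)) (at x)" by simp
      show "open (- ?K)" by (intro open_Compl closed_closure)
      show "x \<in> - ?K" using \<open>x \<notin> ?K\<close> by simp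
      show "0 = \<phi> y" if "y \<in> - ?K" for y
        using that closure_subset[of "{x. \<phi> x \<noteq> 0}"] by auto
    qed
    then have "pd \<phi> j x = 0" by (rule pd_eqI)
    with \<open>pd \<phi> j x \<noteq> 0\<close> show False by simp
  qed
qed

lemma test_fun_lincomb:
  assumes "test_fun \<Omega> \<phi>" "test_fun \<Omega> \<psi>"
  shows "test_fun \<Omega> (\<lambda>x. a * \<phi> x + b * \<psi> x)"
proof (rule test_funI)
  let ?K = "closure {x. \<phi> x \<noteq> 0} \<union> closure {x. \<psi> x \<noteq> 0}"
  show "smooth_fun (\<lambda>x. a * \<phi> x + b * \<psi> x)" "?K \<subseteq> \<Omega>"
    using assms by (auto simp: test_fun_def smooth_fun_lincomb)
  show "compact ?K" using assms by (intro compact_Un) (simp_all add: test_fun_def)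
  fix x assume "a * \<phi> x + b * \<psi> x \<noteq> 0"
  then have "\<phi> x \<noteq> 0 \<or> \<psi> x \<noteq> 0" by auto
  then show "x \<in> ?K"
    using closure_subset[of "{x. \<phi> x \<noteq> 0}"] closure_subset[of "{x. \<psi> x \<noteq> 0}"] by blast
qed

lemma test_fun_mult:
  assumes "test_fun \<Omega> \<phi>" "test_fun \<Omega> \<psi>"
  shows "test_fun \<Omega> (\<lambda>x. \<phi> x * \<psi> x)"
  using assms closure_subset[of "{x. \<phi> x \<noteq> 0}"]
  by (intro test_funI[where K="closure {x. \<phi> x \<noteq> 0}"])
     (auto simp: test_fun_def smooth_fun_mult)

lemma test_fun_zero: "test_fun \<Omega> (\<lambda>x. 0)"
proof -
  have "pds js (\<lambda>x. 0 :: real) = (\<lambda>x. 0)" for js :: "'a list"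
  proof (induction js)
    case (Cons j js)
    show ?case unfolding pds.simps Cons.IH by (auto simp: fun_eq_iff pd_def)
  qed simp
  then have "smooth_fun (\<lambda>x::real^'a. 0)" by (simp add: smooth_fun_def)
  then show ?thesis by (auto simp: test_fun_def)
qed

lemma test_fun_measurable: "test_fun \<Omega> \<phi> \<Longrightarrow> \<phi> \<in> borel_measurable borel"
  using smooth_fun_continuous[OF test_fun_smooth] by (rule borel_measurable_continuous_onI)

lemma test_fun_outside: "test_fun \<Omega> \<phi> \<Longrightarrow> x \<notin> \<Omega> \<Longrightarrow> \<phi> x = 0"
  using closure_subset[of "{x. \<phi> x \<noteq> 0}"] by (auto simp: test_fun_def)

text \<open>Reduces \<open>pd\<close> to calculus in one variable, so that the fundamental theorem
  applies along lines parallel to an axis.\<close>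

lemma test_fun_line_derivative:
  assumes "smooth_fun \<phi>"
  shows "((\<lambda>s. \<phi> (y + s *\<^sub>R axis j 1)) has_real_derivative pd \<phi> j (y + s *\<^sub>R axis j 1)) (at s)"
proof -
  let ?D = "frechet_derivative \<phi> (at (y + s *\<^sub>R axis j 1))"
  have D: "(\<phi> has_derivative ?D) (at (y + s *\<^sub>R axis j 1))"
    using smooth_fun_differentiable[OF assms] by (simp add: frechet_derivative_works)
  have "((\<lambda>s. y + s *\<^sub>R axis j 1) has_derivative (\<lambda>h. h *\<^sub>R axis j 1)) (at s)"
    by (auto intro!: derivative_eq_intros)
  from has_derivative_compose[OF this D]
  have "((\<lambda>s. \<phi> (y + s *\<^sub>R axis j 1)) has_derivative (\<lambda>h. ?D (h *\<^sub>R axis j 1))) (at s)" .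
  moreover have "?D (h *\<^sub>R axis j 1) = h * pd \<phi> j (y + s *\<^sub>R axis j 1)" for h
    using linear_scale[OF has_derivative_linear[OF D]] by (simp add: pd_def)
  ultimately show ?thesis by (simp add: has_field_derivative_def mult.commute[of _ "pd _ _ _"])
qed

subsection \<open>The Gagliardo--Nirenberg--Sobolev inequality for test functions\<close>

text \<open>The factors fed to \<open>Loomis_Whitney_3\<close> are square roots of nonnegative
  integrals over coordinate lines, so a square root on \<open>ennreal\<close> is needed, including
  at \<open>top\<close>.\<close>

definition esqrt :: "ennreal \<Rightarrow> ennreal" where
  "esqrt a = (if a = top then top else ennreal (sqrt (enn2real a)))"

lemma esqrt_power2: "(esqrt a)\<^sup>2 = a"
  unfolding esqrt_def by (cases a) (auto simp: ennreal_power power2_eq_square ennreal_mult[symmetric])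

lemma le_esqrt: "ennreal (r\<^sup>2) \<le> a \<Longrightarrow> 0 \<le> r \<Longrightarrow> ennreal r \<le> esqrt a"
  unfolding esqrt_def by (cases a) (auto simp: real_le_rsqrt)

lemma measurable_esqrt [measurable]: "esqrt \<in> borel_measurable borel"
  unfolding esqrt_def by measurable

lemma abs_le_nn_integral_derivative:
  fixes g g' :: "real \<Rightarrow> real"
  assumes der: "\<And>s. (g has_real_derivative g' s) (at s)"
    and cont: "continuous_on UNIV g'"
    and supp: "\<And>s. s < R \<Longrightarrow> g s = 0"
  shows "ennreal \<bar>g r\<bar> \<le> (\<integral>\<^sup>+ s. ennreal \<bar>g' s\<bar> \<partial>lborel)"
proof -
  \<comment> \<open>A starting point that is both at most \<open>r\<close> and strictly left of
    \<open>R\<close>, where \<open>g\<close> vanishes.\<close>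
  define a where "a = min r (R - 1)"
  have a: "a \<le> r" "g a = 0" using supp[of a] by (auto simp: a_def)
  have "continuous_on {a..r} g'" using cont continuous_on_subset by blast
  then have int: "set_integrable lborel {a..r} g'"
    by (rule borel_integrable_atLeastAtMost')
  have "(\<integral>s. indicator {a..r} s *\<^sub>R g' s \<partial>lborel) = g r - g a"
    using \<open>a \<le> r\<close> der \<open>continuous_on {a..r} g'\<close>
    by (intro integral_FTC_atLeastAtMost)
       (auto intro: has_field_derivative_at_within simp: has_real_derivative_iff_has_vector_derivative[symmetric])
  then have "ennreal \<bar>g r\<bar> = ennreal (norm (\<integral>s. indicator {a..r} s *\<^sub>R g' s \<partial>lborel))"
    using a by simp
  also have "\<dots> \<le> (\<integral>\<^sup>+ s. ennreal (norm (indicator {a..r} s *\<^sub>R g' s)) \<partial>lborel)"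
    using int by (intro integral_norm_bound_ennreal) (simp add: set_integrable_def)
  also have "\<dots> \<le> (\<integral>\<^sup>+ s. ennreal \<bar>g' s\<bar> \<partial>lborel)"
    by (intro nn_integral_mono) (auto simp: indicator_def)
  finally show ?thesis .
qed

text \<open>Cauchy-Schwarz twice: in x with y and z fixed, which bounds the inner integral by a
  function of z times a function of y, and then in the pair (y, z) against \<open>p1\<close>. The
  separated bound factors under the remaining double integral.\<close>

lemma Loomis_Whitney_3:
  fixes p1 p2 p3 :: "real \<Rightarrow> real \<Rightarrow> ennreal"
  assumes [measurable]: "case_prod p1 \<in> borel_measurable (borel \<Otimes>\<^sub>M borel)"
    "case_prod p2 \<in> borel_measurable (borel \<Otimes>\<^sub>M borel)"
    "case_prod p3 \<in> borel_measurable (borel \<Otimes>\<^sub>M borel)"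
  shows "(\<integral>\<^sup>+z. \<integral>\<^sup>+y. \<integral>\<^sup>+x. p1 y z * (p2 x z * p3 x y) \<partial>lborel \<partial>lborel \<partial>lborel)\<^sup>2
    \<le> (\<integral>\<^sup>+z. \<integral>\<^sup>+y. (p1 y z)\<^sup>2 \<partial>lborel \<partial>lborel) * (\<integral>\<^sup>+z. \<integral>\<^sup>+x. (p2 x z)\<^sup>2 \<partial>lborel \<partial>lborel)
      * (\<integral>\<^sup>+y. \<integral>\<^sup>+x. (p3 x y)\<^sup>2 \<partial>lborel \<partial>lborel)"
proof -
  define I where "I y z = (\<integral>\<^sup>+x. p2 x z * p3 x y \<partial>lborel)" for y z
  define P2 where "P2 z = (\<integral>\<^sup>+x. (p2 x z)\<^sup>2 \<partial>lborel)" for z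
  define P3 where "P3 y = (\<integral>\<^sup>+x. (p3 x y)\<^sup>2 \<partial>lborel)" for y
  have [measurable]: "(\<lambda>(x, y). p1 x y) \<in> borel_measurable (lborel \<Otimes>\<^sub>M lborel)"
    "(\<lambda>(x, y). p2 x y) \<in> borel_measurable (lborel \<Otimes>\<^sub>M lborel)"
    "(\<lambda>(x, y). p3 x y) \<in> borel_measurable (lborel \<Otimes>\<^sub>M lborel)"
    using assms by (simp_all cong: measurable_cong_sets sets_pair_measure_cong add: sets_lborel)
  have Im[measurable]: "(\<lambda>(y, z). I y z) \<in> borel_measurable (lborel \<Otimes>\<^sub>M lborel)"
    unfolding I_def by measurable
  have Pm[measurable]: "P2 \<in> borel_measurable lborel" "P3 \<in> borel_measurable lborel"
    unfolding P2_def P3_def by measurable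
  have I2: "(I y z)\<^sup>2 \<le> P2 z * P3 y" for y z
    unfolding I_def P2_def P3_def by (intro Cauchy_Schwarz_nn_integral) measurable
  have "(\<integral>\<^sup>+z. \<integral>\<^sup>+y. \<integral>\<^sup>+x. p1 y z * (p2 x z * p3 x y) \<partial>lborel \<partial>lborel \<partial>lborel)
      = (\<integral>\<^sup>+z. \<integral>\<^sup>+y. p1 y z * I y z \<partial>lborel \<partial>lborel)"
    unfolding I_def by (simp add: nn_integral_cmult)
  also have "\<dots> = (\<integral>\<^sup>+p. (case p of (y, z) \<Rightarrow> p1 y z) * (case p of (y, z) \<Rightarrow> I y z) \<partial>(lborel \<Otimes>\<^sub>M lborel))"
    by (subst lborel_pair.nn_integral_snd[symmetric]) simp_all
  finally have "(\<integral>\<^sup>+z. \<integral>\<^sup>+y. \<integral>\<^sup>+x. p1 y z * (p2 x z * p3 x y) \<partial>lborel \<partial>lborel \<partial>lborel)\<^sup>2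
      \<le> (\<integral>\<^sup>+p. (case p of (y, z) \<Rightarrow> p1 y z)\<^sup>2 \<partial>(lborel \<Otimes>\<^sub>M lborel))
        * (\<integral>\<^sup>+p. (case p of (y, z) \<Rightarrow> I y z)\<^sup>2 \<partial>(lborel \<Otimes>\<^sub>M lborel))"
    using Cauchy_Schwarz_nn_integral[of "\<lambda>(y, z). p1 y z" "lborel \<Otimes>\<^sub>M lborel" "\<lambda>(y, z). I y z"] by simp
  also have "(\<integral>\<^sup>+p. (case p of (y, z) \<Rightarrow> p1 y z)\<^sup>2 \<partial>(lborel \<Otimes>\<^sub>M lborel))
      = (\<integral>\<^sup>+z. \<integral>\<^sup>+y. (p1 y z)\<^sup>2 \<partial>lborel \<partial>lborel)"
    by (subst lborel_pair.nn_integral_snd[symmetric]) simp_all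
  also have "(\<integral>\<^sup>+p. (case p of (y, z) \<Rightarrow> I y z)\<^sup>2 \<partial>(lborel \<Otimes>\<^sub>M lborel))
      = (\<integral>\<^sup>+z. \<integral>\<^sup>+y. (I y z)\<^sup>2 \<partial>lborel \<partial>lborel)"
    by (subst lborel_pair.nn_integral_snd[symmetric]) simp_all
  also have "\<dots> \<le> (\<integral>\<^sup>+z. \<integral>\<^sup>+y. P2 z * P3 y \<partial>lborel \<partial>lborel)"
    by (intro nn_integral_mono I2)
  also have "\<dots> = (\<integral>\<^sup>+z. P2 z \<partial>lborel) * (\<integral>\<^sup>+y. P3 y \<partial>lborel)"
    by (simp add: nn_integral_cmult nn_integral_multc)
  finally show ?thesis
    unfolding P2_def P3_def by (simp add: mult_left_mono mult.assoc)
qed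

section \<open>Iterated integrals over \<open>real^'d\<close> in dimensions two and three\<close>

lemma lborel_vec_eqI:
  fixes P :: "'b::euclidean_space \<Rightarrow> real^'d::finite"
  assumes [measurable]: "P \<in> borel_measurable borel"
    and box: "\<And>l u. (\<And>k. l $ k \<le> u $ k) \<Longrightarrow>
      emeasure lborel (P -` box l u) = ennreal (\<Prod>k\<in>UNIV. u $ k - l $ k)"
  shows "lborel = distr lborel borel P"
proof (rule lborel_eqI)
  fix l u :: "real^'d"
  assume "\<And>b. b \<in> Basis \<Longrightarrow> l \<bullet> b \<le> u \<bullet> b"
  then have "l $ k \<le> u $ k" for k by (simp add: cart_eq_inner_axis axis_in_Basis_iff)
  moreover have B: "(Basis :: (real^'d) set) = (\<lambda>k. axis k 1) ` UNIV"
    by (auto simp: Basis_vec_def)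
  have "(\<Prod>b\<in>Basis. (u - l) \<bullet> b) = (\<Prod>k\<in>UNIV. u $ k - l $ k)"
    unfolding B by (simp add: prod.reindex inj_on_def axis_eq_axis inner_axis)
  ultimately show "emeasure (distr lborel borel P) (box l u) = ennreal (\<Prod>b\<in>Basis. (u - l) \<bullet> b)"
    by (simp add: emeasure_distr box)
qed simp

text \<open>The index type is abstract, so Tonelli is transported from pairs of reals: the
  parametrisation \<open>P\<close> pulls boxes back to boxes of the same volume, which determines
  Lebesgue measure.\<close>

lemma nn_integral_vec_2:
  fixes f :: "real^'d::finite \<Rightarrow> ennreal"
  assumes [measurable]: "f \<in> borel_measurable borel"
    and ij: "UNIV = {i, j}" "i \<noteq> j"
  shows "(\<integral>\<^sup>+v. f v \<partial>lborel) = (\<integral>\<^sup>+y. \<integral>\<^sup>+x. f (x *\<^sub>R axis i 1 + y *\<^sub>R axis j 1) \<partial>lborel \<partial>lborel)"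
proof -
  define P where "P = (\<lambda>(x, y). x *\<^sub>R axis i 1 + y *\<^sub>R axis j 1 :: real^'d)"
  have "continuous_on UNIV P"
    unfolding P_def case_prod_unfold by (intro continuous_intros)
  then have Pm[measurable]: "P \<in> borel_measurable borel"
    by (rule borel_measurable_continuous_onI)
  have all: "(\<forall>k::'d. Q k) \<longleftrightarrow> Q i \<and> Q j" for Q
    using ij(1) by (metis UNIV_I empty_iff insertE)
  have "lborel = distr lborel borel P"
  proof (rule lborel_vec_eqI)
    fix l u :: "real^'d"
    assume le: "\<And>k. l $ k \<le> u $ k"
    have "P -` box l u = box (l $ i, l $ j) (u $ i, u $ j)"
      using ij(2) by (auto simp: P_def mem_box_cart all box_prod axis_def)
    also have "emeasure lborel \<dots> = ennreal ((u $ i - l $ i) * (u $ j - l $ j))"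
      using le by (subst emeasure_lborel_box) (auto simp: Basis_prod_def prod.union_disjoint prod.reindex inj_on_def)
    finally show "emeasure lborel (P -` box l u) = ennreal (\<Prod>k\<in>UNIV. u $ k - l $ k)"
      unfolding ij(1) using ij(2) by simp
  qed simp
  then have "(\<integral>\<^sup>+v. f v \<partial>lborel) = (\<integral>\<^sup>+v. f v \<partial>distr lborel borel P)"
    by (rule arg_cong)
  also have "\<dots> = (\<integral>\<^sup>+p. f (P p) \<partial>lborel)"
    by (simp add: nn_integral_distr)
  also have "\<dots> = (\<integral>\<^sup>+p. f (P p) \<partial>(lborel \<Otimes>\<^sub>M lborel))"
    by (simp add: lborel_prod)
  also have "\<dots> = (\<integral>\<^sup>+y. \<integral>\<^sup>+x. f (P (x, y)) \<partial>lborel \<partial>lborel)"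
    by (rule lborel_pair.nn_integral_snd[symmetric]) (simp add: lborel_prod)
  finally show ?thesis by (simp add: P_def)
qed

text \<open>The enumeration of the indices is arbitrary; applying the lemma to a permuted one
  changes the order of integration.\<close>

lemma nn_integral_vec_3:
  fixes f :: "real^'d::finite \<Rightarrow> ennreal"
  assumes [measurable]: "f \<in> borel_measurable borel"
    and ijk: "UNIV = {i, j, k}" "i \<noteq> j" "i \<noteq> k" "j \<noteq> k"
  shows "(\<integral>\<^sup>+v. f v \<partial>lborel)
    = (\<integral>\<^sup>+z. \<integral>\<^sup>+y. \<integral>\<^sup>+x. f (x *\<^sub>R axis i 1 + y *\<^sub>R axis j 1 + z *\<^sub>R axis k 1) \<partial>lborel \<partial>lborel \<partial>lborel)"
proof -
  define P where "P = (\<lambda>((x, y), z). x *\<^sub>R axis i 1 + y *\<^sub>R axis j 1 + z *\<^sub>R axis k 1 :: real^'d)"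
  have "continuous_on UNIV P"
    unfolding P_def case_prod_unfold by (intro continuous_intros)
  then have Pm[measurable]: "P \<in> borel_measurable borel"
    by (rule borel_measurable_continuous_onI)
  then have Pm'[measurable]: "P \<in> borel_measurable ((lborel \<Otimes>\<^sub>M lborel) \<Otimes>\<^sub>M lborel)"
    by (simp add: lborel_prod)
  have all: "(\<forall>n::'d. Q n) \<longleftrightarrow> Q i \<and> Q j \<and> Q k" for Q
    using ijk(1) by (metis UNIV_I empty_iff insertE)
  have "lborel = distr lborel borel P"
  proof (rule lborel_vec_eqI)
    fix l u :: "real^'d"
    assume le: "\<And>k. l $ k \<le> u $ k"
    have "P -` box l u = box ((l $ i, l $ j), l $ k) ((u $ i, u $ j), u $ k)"
      using ijk(2-4) by (auto simp: P_def mem_box_cart all box_prod axis_def)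
    also have "emeasure lborel \<dots> = ennreal ((u $ i - l $ i) * (u $ j - l $ j) * (u $ k - l $ k))"
      using le by (subst emeasure_lborel_box) (auto simp: Basis_prod_def prod.union_disjoint prod.reindex inj_on_def)
    finally show "emeasure lborel (P -` box l u) = ennreal (\<Prod>k\<in>UNIV. u $ k - l $ k)"
      unfolding ijk(1) using ijk(2-4) by (simp add: mult.assoc)
  qed simp
  then have "(\<integral>\<^sup>+v. f v \<partial>lborel) = (\<integral>\<^sup>+v. f v \<partial>distr lborel borel P)"
    by (rule arg_cong)
  also have "\<dots> = (\<integral>\<^sup>+p. f (P p) \<partial>lborel)"
    by (simp add: nn_integral_distr)
  also have "\<dots> = (\<integral>\<^sup>+p. f (P p) \<partial>((lborel \<Otimes>\<^sub>M lborel) \<Otimes>\<^sub>M lborel))"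
    by (simp add: lborel_prod)
  also have "\<dots> = (\<integral>\<^sup>+p. f (P p) \<partial>((lborel :: (real \<times> real) measure) \<Otimes>\<^sub>M lborel))"
    by (simp add: lborel_prod)
  also have "\<dots> = (\<integral>\<^sup>+z. \<integral>\<^sup>+q. f (P (q, z)) \<partial>lborel \<partial>lborel)"
    by (rule lborel_pair.nn_integral_snd[symmetric]) (simp add: lborel_prod)
  also have "\<dots> = (\<integral>\<^sup>+z. \<integral>\<^sup>+q. f (P (q, z)) \<partial>(lborel \<Otimes>\<^sub>M lborel) \<partial>lborel)"
    by (simp add: lborel_prod)
  also have "\<dots> = (\<integral>\<^sup>+z. \<integral>\<^sup>+y. \<integral>\<^sup>+x. f (P ((x, y), z)) \<partial>lborel \<partial>lborel \<partial>lborel)"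
    by (intro nn_integral_cong lborel_pair.nn_integral_snd[symmetric]) simp
  finally show ?thesis by (simp add: P_def)
qed

section \<open>Sixth powers of test functions on the whole space\<close>

text \<open>The fundamental theorem for the power \<open>Suc n\<close> of \<open>\<phi>\<close>
  along a line in direction \<open>j\<close>. What matters is that the right side no longer depends
  on \<open>r\<close>, that is, on the coordinate \<open>j\<close>.\<close>

lemma GNS_coord_bound:
  assumes "test_fun \<Omega> \<phi>"
  shows "ennreal (\<bar>\<phi> (y + r *\<^sub>R axis j 1)\<bar> ^ Suc n)
    \<le> (\<integral>\<^sup>+s. ennreal (real (Suc n) * \<bar>\<phi> (y + s *\<^sub>R axis j 1)\<bar>^n * \<bar>pd \<phi> j (y + s *\<^sub>R axis j 1)\<bar>) \<partial>lborel)"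
proof -
  let ?g = "\<lambda>s. \<phi> (y + s *\<^sub>R axis j 1)"
  let ?d = "\<lambda>s. pd \<phi> j (y + s *\<^sub>R axis j 1)"
  have sm: "smooth_fun \<phi>" using assms by (rule test_fun_smooth)
  have "bounded (closure {x. \<phi> x \<noteq> 0})"
    using assms by (auto simp: test_fun_def compact_imp_bounded)
  then obtain B where "\<forall>x\<in>closure {x. \<phi> x \<noteq> 0}. norm x \<le> B"
    unfolding bounded_iff by blast
  then have B: "norm x \<le> B" if "\<phi> x \<noteq> 0" for x
    using that closure_subset[of "{x. \<phi> x \<noteq> 0}"] by blast
  have cont: "continuous_on UNIV (\<lambda>s. \<psi> (y + s *\<^sub>R axis j 1))" if "smooth_fun \<psi>" for \<psi> :: "real^'a \<Rightarrow> real"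
    by (rule continuous_on_compose2[OF smooth_fun_continuous[OF that, of UNIV]]) (auto intro!: continuous_intros)
  have "ennreal \<bar>?g r ^ Suc n\<bar> \<le> (\<integral>\<^sup>+s. ennreal \<bar>real (Suc n) * ?g s ^ n * ?d s\<bar> \<partial>lborel)"
  proof (rule abs_le_nn_integral_derivative[where g = "\<lambda>s. ?g s ^ Suc n"])
    show "((\<lambda>s. ?g s ^ Suc n) has_real_derivative real (Suc n) * ?g s ^ n * ?d s) (at s)" for s
      using DERIV_power[OF test_fun_line_derivative[OF sm, of y j s], of "Suc n"] by (simp add: mult_ac)
    show "continuous_on UNIV (\<lambda>s. real (Suc n) * ?g s ^ n * ?d s)"
      by (intro continuous_intros cont sm smooth_fun_pd)
    show "?g s ^ Suc n = 0" if "s < - \<bar>B\<bar> - norm y" for s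
    proof -
      have "\<bar>s\<bar> = norm (s *\<^sub>R axis j 1 :: real^'a)" by simp
      also have "\<dots> \<le> norm (y + s *\<^sub>R axis j 1) + norm y"
        using norm_triangle_ineq4[of "y + s *\<^sub>R axis j 1" y] by simp
      finally have "\<not> norm (y + s *\<^sub>R axis j 1) \<le> B" using that by linarith
      with B show ?thesis by auto
    qed
  qed
  then show ?thesis by (simp add: abs_mult power_abs del: of_nat_Suc)
qed

text \<open>The fourth power of \<open>\<phi>\<close> is bounded by three functions, each
  independent of one coordinate. Their square roots multiply to a bound of the sixth power, which is
  exactly the shape of \<open>Loomis_Whitney_3\<close>.\<close>

lemma test_fun_Sobolev_nn_3:
  fixes \<phi> :: "real^'d::finite \<Rightarrow> real"
  assumes t: "test_fun \<Omega> \<phi>" and ijk: "UNIV = {i, j, k}" "i \<noteq> j" "i \<noteq> k" "j \<noteq> k"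
  defines "A \<equiv> \<integral>\<^sup>+v. ennreal (\<phi> v ^ 6) \<partial>lborel"
  defines "B \<equiv> \<lambda>n. \<integral>\<^sup>+v. ennreal (4 * \<bar>\<phi> v\<bar>^3 * \<bar>pd \<phi> n v\<bar>) \<partial>lborel"
  shows "A^2 \<le> B i * B j * B k"
proof -
  let ?P = "\<lambda>x y z. x *\<^sub>R axis i 1 + y *\<^sub>R axis j 1 + z *\<^sub>R axis k 1 :: real^'d"
  define b where "b = (\<lambda>n v. ennreal (4 * \<bar>\<phi> v\<bar>^3 * \<bar>pd \<phi> n v\<bar>))"
  have [measurable]: "\<phi> \<in> borel_measurable borel" "pd \<phi> n \<in> borel_measurable borel" for n
    using t by (auto intro: test_fun_measurable test_fun_pd)
  have bm[measurable]: "b n \<in> borel_measurable borel" for n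
    unfolding b_def by measurable
  have Pm: "(\<lambda>((x, y), z). ?P x y z) \<in> borel_measurable borel"
    unfolding case_prod_unfold
    by (intro borel_measurable_continuous_onI continuous_intros)
  have [measurable]: "(\<lambda>((x, y), z). ?P x y z) \<in> borel_measurable ((lborel \<Otimes>\<^sub>M lborel) \<Otimes>\<^sub>M lborel)"
    using Pm by (simp add: lborel_prod)
  define F1 where "F1 y z = (\<integral>\<^sup>+x. b i (?P x y z) \<partial>lborel)" for y z
  define F2 where "F2 x z = (\<integral>\<^sup>+y. b j (?P x y z) \<partial>lborel)" for x z
  define F3 where "F3 x y = (\<integral>\<^sup>+z. b k (?P x y z) \<partial>lborel)" for x y
  have cm: "(\<lambda>((x, y), z). b n (?P x y z)) \<in> borel_measurable ((borel \<Otimes>\<^sub>M borel) \<Otimes>\<^sub>M borel)" for n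
    using measurable_compose[OF Pm bm[of n]] by (simp add: borel_prod case_prod_unfold)
  have F1m: "(\<lambda>(y, z). F1 y z) \<in> borel_measurable (borel \<Otimes>\<^sub>M borel)"
    unfolding F1_def using cm[of i] by measurable
  have F2m: "(\<lambda>(x, z). F2 x z) \<in> borel_measurable (borel \<Otimes>\<^sub>M borel)"
    unfolding F2_def using cm[of j] by measurable
  have F3m: "(\<lambda>(x, y). F3 x y) \<in> borel_measurable (borel \<Otimes>\<^sub>M borel)"
    unfolding F3_def using cm[of k] by measurable
  note [measurable] = F1m F2m F3m
  have le: "ennreal (\<phi> v ^ 6) \<le> esqrt F * (esqrt G * esqrt H)"
    if "ennreal (\<bar>\<phi> v\<bar>^4) \<le> F" "ennreal (\<bar>\<phi> v\<bar>^4) \<le> G" "ennreal (\<bar>\<phi> v\<bar>^4) \<le> H" for v F G H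
  proof -
    have "ennreal (\<phi> v ^ 6) = ennreal (\<bar>\<phi> v\<bar>^2) * (ennreal (\<bar>\<phi> v\<bar>^2) * ennreal (\<bar>\<phi> v\<bar>^2))"
      by (simp flip: ennreal_mult power_add)
    also have "\<dots> \<le> esqrt F * (esqrt G * esqrt H)"
      using that by (intro mult_mono le_esqrt) (auto simp flip: power_mult)
    finally show ?thesis .
  qed
  have "A = (\<integral>\<^sup>+z. \<integral>\<^sup>+y. \<integral>\<^sup>+x. ennreal (\<phi> (?P x y z) ^ 6) \<partial>lborel \<partial>lborel \<partial>lborel)"
    unfolding A_def by (rule nn_integral_vec_3[OF _ ijk]) simp
  also have "\<dots> \<le> (\<integral>\<^sup>+z. \<integral>\<^sup>+y. \<integral>\<^sup>+x. esqrt (F1 y z) * (esqrt (F2 x z) * esqrt (F3 x y)) \<partial>lborel \<partial>lborel \<partial>lborel)"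
  proof (intro nn_integral_mono le)
    fix x y z
    show "ennreal (\<bar>\<phi> (?P x y z)\<bar> ^ 4) \<le> F1 y z"
      using GNS_coord_bound[OF t, of "y *\<^sub>R axis j 1 + z *\<^sub>R axis k 1" x i 3]
      by (simp add: F1_def b_def algebra_simps)
    show "ennreal (\<bar>\<phi> (?P x y z)\<bar> ^ 4) \<le> F2 x z"
      using GNS_coord_bound[OF t, of "x *\<^sub>R axis i 1 + z *\<^sub>R axis k 1" y j 3]
      by (simp add: F2_def b_def algebra_simps)
    show "ennreal (\<bar>\<phi> (?P x y z)\<bar> ^ 4) \<le> F3 x y"
      using GNS_coord_bound[OF t, of "x *\<^sub>R axis i 1 + y *\<^sub>R axis j 1" z k 3]
      by (simp add: F3_def b_def algebra_simps)
  qed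
  finally have "A^2 \<le> (\<integral>\<^sup>+z. \<integral>\<^sup>+y. \<integral>\<^sup>+x. esqrt (F1 y z) * (esqrt (F2 x z) * esqrt (F3 x y)) \<partial>lborel \<partial>lborel \<partial>lborel)^2"
    by (rule power_mono) simp
  also have "\<dots> \<le> (\<integral>\<^sup>+z. \<integral>\<^sup>+y. (esqrt (F1 y z))\<^sup>2 \<partial>lborel \<partial>lborel) * (\<integral>\<^sup>+z. \<integral>\<^sup>+x. (esqrt (F2 x z))\<^sup>2 \<partial>lborel \<partial>lborel)
      * (\<integral>\<^sup>+y. \<integral>\<^sup>+x. (esqrt (F3 x y))\<^sup>2 \<partial>lborel \<partial>lborel)"
    by (intro Loomis_Whitney_3) measurable
  also have "\<dots> = (\<integral>\<^sup>+z. \<integral>\<^sup>+y. F1 y z \<partial>lborel \<partial>lborel) * (\<integral>\<^sup>+z. \<integral>\<^sup>+x. F2 x z \<partial>lborel \<partial>lborel)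
      * (\<integral>\<^sup>+y. \<integral>\<^sup>+x. F3 x y \<partial>lborel \<partial>lborel)"
    by (simp add: esqrt_power2)
  also have "(\<integral>\<^sup>+z. \<integral>\<^sup>+y. F1 y z \<partial>lborel \<partial>lborel) = B i"
    unfolding B_def F1_def b_def by (rule nn_integral_vec_3[OF _ ijk, symmetric]) simp
  also have "(\<integral>\<^sup>+z. \<integral>\<^sup>+x. F2 x z \<partial>lborel \<partial>lborel) = B j"
  proof -
    \<comment> \<open>\<open>F2\<close> integrates over coordinate \<open>j\<close> first, so
      Tonelli is used with \<open>j\<close> as the innermost index.\<close>
    have "UNIV = {j, i, k}" using ijk by auto
    from nn_integral_vec_3[OF bm this, of j] show ?thesis
      using ijk unfolding B_def F2_def b_def by (simp add: add_ac)
  qed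
  also have "(\<integral>\<^sup>+y. \<integral>\<^sup>+x. F3 x y \<partial>lborel \<partial>lborel) = B k"
  proof -
    have "UNIV = {k, i, j}" using ijk by auto
    from nn_integral_vec_3[OF bm this, of k] show ?thesis
      using ijk unfolding B_def F3_def b_def by (simp add: add_ac)
  qed
  finally show ?thesis .
qed

text \<open>In the plane, the sixth power is the product of two cubes, one bounded by a function of
  y and the other by a function of x; the double integral of the product factors directly.\<close>

lemma test_fun_Sobolev_nn_2:
  fixes \<phi> :: "real^'d::finite \<Rightarrow> real"
  assumes t: "test_fun \<Omega> \<phi>" and ij: "UNIV = {i, j}" "i \<noteq> j"
  defines "A \<equiv> \<integral>\<^sup>+v. ennreal (\<phi> v ^ 6) \<partial>lborel"
  defines "B \<equiv> \<lambda>n. \<integral>\<^sup>+v. ennreal (3 * \<bar>\<phi> v\<bar>^2 * \<bar>pd \<phi> n v\<bar>) \<partial>lborel"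
  shows "A \<le> B i * B j"
proof -
  let ?P = "\<lambda>x y. x *\<^sub>R axis i 1 + y *\<^sub>R axis j 1 :: real^'d"
  define b where "b = (\<lambda>n v. ennreal (3 * \<bar>\<phi> v\<bar>^2 * \<bar>pd \<phi> n v\<bar>))"
  have [measurable]: "\<phi> \<in> borel_measurable borel" "pd \<phi> n \<in> borel_measurable borel" for n
    using t by (auto intro: test_fun_measurable test_fun_pd)
  have bm[measurable]: "b n \<in> borel_measurable borel" for n
    unfolding b_def by measurable
  have Pm: "(\<lambda>(x, y). ?P x y) \<in> borel_measurable borel"
    unfolding case_prod_unfold
    by (intro borel_measurable_continuous_onI continuous_intros)
  define F1 where "F1 y = (\<integral>\<^sup>+x. b i (?P x y) \<partial>lborel)" for y
  define F2 where "F2 x = (\<integral>\<^sup>+y. b j (?P x y) \<partial>lborel)" for x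
  have cm: "(\<lambda>(x, y). b n (?P x y)) \<in> borel_measurable (borel \<Otimes>\<^sub>M borel)" for n
    using measurable_compose[OF Pm bm[of n]] by (simp add: borel_prod case_prod_unfold)
  have [measurable]: "F1 \<in> borel_measurable borel"
    unfolding F1_def using cm[of i] by measurable
  have [measurable]: "F2 \<in> borel_measurable borel"
    unfolding F2_def using cm[of j] by measurable
  have "A = (\<integral>\<^sup>+y. \<integral>\<^sup>+x. ennreal (\<phi> (?P x y) ^ 6) \<partial>lborel \<partial>lborel)"
    unfolding A_def by (rule nn_integral_vec_2[OF _ ij]) simp
  also have "\<dots> \<le> (\<integral>\<^sup>+y. \<integral>\<^sup>+x. F1 y * F2 x \<partial>lborel \<partial>lborel)"
  proof (intro nn_integral_mono)
    fix x y
    have "ennreal (\<bar>\<phi> (?P x y)\<bar> ^ 3) \<le> F1 y"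
      using GNS_coord_bound[OF t, of "y *\<^sub>R axis j 1" x i 2]
      by (simp add: F1_def b_def algebra_simps)
    moreover have "ennreal (\<bar>\<phi> (?P x y)\<bar> ^ 3) \<le> F2 x"
      using GNS_coord_bound[OF t, of "x *\<^sub>R axis i 1" y j 2]
      by (simp add: F2_def b_def algebra_simps)
    moreover have "ennreal (\<phi> (?P x y) ^ 6) = ennreal (\<bar>\<phi> (?P x y)\<bar>^3) * ennreal (\<bar>\<phi> (?P x y)\<bar>^3)"
      by (simp flip: ennreal_mult power_add)
    ultimately show "ennreal (\<phi> (?P x y) ^ 6) \<le> F1 y * F2 x"
      by (simp add: mult_mono)
  qed
  also have "\<dots> = (\<integral>\<^sup>+y. F1 y \<partial>lborel) * (\<integral>\<^sup>+x. F2 x \<partial>lborel)"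
    by (simp add: nn_integral_cmult nn_integral_multc)
  also have "(\<integral>\<^sup>+y. F1 y \<partial>lborel) = B i"
    unfolding B_def F1_def b_def by (rule nn_integral_vec_2[OF _ ij, symmetric]) simp
  also have "(\<integral>\<^sup>+x. F2 x \<partial>lborel) = B j"
  proof -
    have "UNIV = {j, i}" using ij by auto
    from nn_integral_vec_2[OF bm this, of j] show ?thesis
      using ij unfolding B_def F2_def b_def by (simp add: add_ac)
  qed
  finally show ?thesis .
qed

subsection \<open>Lebesgue norms with natural exponents\<close>

text \<open>Natural exponents keep the calculations in ordinary powers and roots;
  \<open>lpn_eq_normL\<close> links them to the \<open>powr\<close> norms of the theorem.\<close>

definition memL :: "'a measure \<Rightarrow> nat \<Rightarrow> ('a \<Rightarrow> real) \<Rightarrow> bool" where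
  "memL M n f \<longleftrightarrow> f \<in> borel_measurable M \<and> integrable M (\<lambda>x. \<bar>f x\<bar>^n)"

definition normL :: "'a measure \<Rightarrow> nat \<Rightarrow> ('a \<Rightarrow> real) \<Rightarrow> real" where
  "normL M n f = root n (\<integral>x. \<bar>f x\<bar>^n \<partial>M)"

lemma memL_measurable: "memL M n f \<Longrightarrow> f \<in> borel_measurable M"
  by (simp add: memL_def)

lemma normL_nonneg: "0 \<le> normL M n f"
  unfolding normL_def by (cases "n = 0") (auto intro: real_root_ge_zero)

lemma normL_power: "0 < n \<Longrightarrow> normL M n f ^ n = (\<integral>x. \<bar>f x\<bar>^n \<partial>M)"
  unfolding normL_def by simp

lemma normL_tendsto_0:
  assumes "(\<lambda>k. \<integral>x. \<bar>f k x\<bar>^n \<partial>M) \<longlonglongrightarrow> 0"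
  shows "(\<lambda>k. normL M n (f k)) \<longlonglongrightarrow> 0"
  using tendsto_real_root[OF assms, of n] by (simp add: normL_def)

lemma memL_lincomb:
  assumes "memL M n f" "memL M n g"
  shows "memL M n (\<lambda>x. a * f x + b * g x)"
  unfolding memL_def
proof
  have [measurable]: "f \<in> borel_measurable M" "g \<in> borel_measurable M"
    using assms by (auto simp: memL_def)
  show "(\<lambda>x. a * f x + b * g x) \<in> borel_measurable M" by measurable
  show "integrable M (\<lambda>x. \<bar>a * f x + b * g x\<bar>^n)"
  proof (rule Bochner_Integration.integrable_bound)
    show "integrable M (\<lambda>x. (2*\<bar>a\<bar>)^n * \<bar>f x\<bar>^n + (2*\<bar>b\<bar>)^n * \<bar>g x\<bar>^n)"
      using assms by (auto simp: memL_def)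
    show "AE x in M. norm (\<bar>a * f x + b * g x\<bar>^n) \<le> norm ((2*\<bar>a\<bar>)^n * \<bar>f x\<bar>^n + (2*\<bar>b\<bar>)^n * \<bar>g x\<bar>^n)"
    proof (rule AE_I2)
      fix x
      \<comment> \<open>The sum is at most twice the larger summand, and the \<open>n\<close>-th
        power of that bound is one of the two terms on the right.\<close>
      define s where "s = max \<bar>a * f x\<bar> \<bar>b * g x\<bar>"
      have "\<bar>a * f x + b * g x\<bar> ^ n \<le> (2 * s) ^ n"
        by (intro power_mono) (auto simp: s_def)
      also have "\<dots> \<le> (2 * \<bar>a * f x\<bar>)^n + (2 * \<bar>b * g x\<bar>)^n"
        unfolding s_def max_def by simp
      finally show "norm (\<bar>a * f x + b * g x\<bar>^n) \<le> norm ((2*\<bar>a\<bar>)^n * \<bar>f x\<bar>^n + (2*\<bar>b\<bar>)^n * \<bar>g x\<bar>^n)"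
        by (simp add: abs_mult power_mult_distrib mult.assoc)
    qed
  qed measurable
qed

lemma memL_diff: "memL M n f \<Longrightarrow> memL M n g \<Longrightarrow> memL M n (\<lambda>x. f x - g x)"
  using memL_lincomb[of M n f g 1 "-1"] by simp

lemma memL_Holder_236:
  assumes "memL M 2 f" "memL M 3 g" "memL M 6 h"
  shows "integrable M (\<lambda>x. f x * g x * h x)"
    and "(\<integral>x. \<bar>f x * g x * h x\<bar> \<partial>M) \<le> normL M 2 f * normL M 3 g * normL M 6 h"
proof -
  have m: "f \<in> borel_measurable M" "g \<in> borel_measurable M" "h \<in> borel_measurable M"
    using assms by (auto simp: memL_def)
  have i: "integrable M (\<lambda>x. (f x)^2)" "integrable M (\<lambda>x. \<bar>g x\<bar>^3)" "integrable M (\<lambda>x. (h x)^6)"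
    using assms by (auto simp: memL_def power_even_abs)
  show "integrable M (\<lambda>x. f x * g x * h x)"
    using m i by (rule integrable_Holder_236)
  show "(\<integral>x. \<bar>f x * g x * h x\<bar> \<partial>M) \<le> normL M 2 f * normL M 3 g * normL M 6 h"
    by (rule Holder_236[OF m i]) (simp_all add: normL_power normL_nonneg power_even_abs)
qed

lemma memL_Cauchy_Schwarz:
  assumes f: "memL M 2 f" and g: "memL M 2 g"
  shows "integrable M (\<lambda>x. f x * g x)"
    and "(\<integral>x. \<bar>f x * g x\<bar> \<partial>M) \<le> normL M 2 f * normL M 2 g"
proof -
  have [measurable]: "f \<in> borel_measurable M" "g \<in> borel_measurable M"
    using assms by (auto simp: memL_def)
  have i: "integrable M (\<lambda>x. (f x)^2)" "integrable M (\<lambda>x. (g x)^2)"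
    using assms by (auto simp: memL_def)
  show int: "integrable M (\<lambda>x. f x * g x)"
  proof (rule Bochner_Integration.integrable_bound)
    show "integrable M (\<lambda>x. (f x)^2 + (g x)^2)" using i by simp
    show "AE x in M. norm (f x * g x) \<le> norm ((f x)^2 + (g x)^2)"
    proof (rule AE_I2)
      fix x
      have "2 * (\<bar>f x\<bar> * \<bar>g x\<bar>) \<le> (f x)^2 + (g x)^2"
        using sum_squares_bound[of "\<bar>f x\<bar>" "\<bar>g x\<bar>"] by simp
      then show "norm (f x * g x) \<le> norm ((f x)^2 + (g x)^2)"
        by (simp add: abs_mult) (smt (verit) mult_nonneg_nonneg)
    qed
  qed measurable
  have "(\<integral>\<^sup>+x. ennreal \<bar>f x\<bar> * ennreal \<bar>g x\<bar> \<partial>M)\<^sup>2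
      \<le> (\<integral>\<^sup>+x. (ennreal \<bar>f x\<bar>)\<^sup>2 \<partial>M) * (\<integral>\<^sup>+x. (ennreal \<bar>g x\<bar>)\<^sup>2 \<partial>M)"
    by (rule Cauchy_Schwarz_nn_integral) measurable
  also have "(\<integral>\<^sup>+x. ennreal \<bar>f x\<bar> * ennreal \<bar>g x\<bar> \<partial>M) = ennreal (\<integral>x. \<bar>f x * g x\<bar> \<partial>M)"
    using integrable_abs[OF int] by (subst nn_integral_eq_integral[symmetric]) (auto simp: abs_mult ennreal_mult)
  also have "(\<integral>\<^sup>+x. (ennreal \<bar>f x\<bar>)\<^sup>2 \<partial>M) = ennreal (\<integral>x. (f x)\<^sup>2 \<partial>M)"
    using i by (subst nn_integral_eq_integral[symmetric]) (auto simp: ennreal_power)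
  also have "(\<integral>\<^sup>+x. (ennreal \<bar>g x\<bar>)\<^sup>2 \<partial>M) = ennreal (\<integral>x. (g x)\<^sup>2 \<partial>M)"
    using i by (subst nn_integral_eq_integral[symmetric]) (auto simp: ennreal_power)
  finally have "(\<integral>x. \<bar>f x * g x\<bar> \<partial>M)\<^sup>2 \<le> (\<integral>x. (f x)\<^sup>2 \<partial>M) * (\<integral>x. (g x)\<^sup>2 \<partial>M)"
    by (simp add: ennreal_power ennreal_mult[symmetric])
  also have "\<dots> = (normL M 2 f * normL M 2 g)^2"
    by (simp add: power_mult_distrib normL_power)
  finally show "(\<integral>x. \<bar>f x * g x\<bar> \<partial>M) \<le> normL M 2 f * normL M 2 g"
    by (rule power2_le_imp_le) (simp add: normL_nonneg)
qed

text \<open>With the difference of the products expanded in \<open>?df\<close> and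
  \<open>?dg\<close>, the bound is a product of sums of norms minus its leading term. It contains
  only the fixed norms of the limits and null sequences, so it tends to 0.\<close>

lemma memL_2_tendsto:
  assumes f: "\<And>k. memL M 2 (f k)" "memL M 2 f'" "(\<lambda>k. normL M 2 (\<lambda>x. f k x - f' x)) \<longlonglongrightarrow> 0"
    and g: "\<And>k. memL M 2 (g k)" "memL M 2 g'" "(\<lambda>k. normL M 2 (\<lambda>x. g k x - g' x)) \<longlonglongrightarrow> 0"
  shows "(\<lambda>k. \<integral>x. f k x * g k x \<partial>M) \<longlonglongrightarrow> (\<integral>x. f' x * g' x \<partial>M)"
proof -
  let ?df = "\<lambda>k x. f k x - f' x" and ?dg = "\<lambda>k x. g k x - g' x"
  let ?N = "normL M 2"
  have d: "memL M 2 (?df k)" "memL M 2 (?dg k)" for k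
    using f g by (auto intro: memL_diff)
  note CS = memL_Cauchy_Schwarz
  have bound: "\<bar>(\<integral>x. f k x * g k x \<partial>M) - (\<integral>x. f' x * g' x \<partial>M)\<bar>
      \<le> (?N f' + ?N (?df k)) * (?N g' + ?N (?dg k)) - ?N f' * ?N g'" for k
  proof -
    have "(\<integral>x. f k x * g k x \<partial>M) - (\<integral>x. f' x * g' x \<partial>M) = (\<integral>x. f k x * g k x - f' x * g' x \<partial>M)"
      using CS(1) f g by (intro Bochner_Integration.integral_diff[symmetric]) auto
    also have "\<bar>\<dots>\<bar> \<le> (\<integral>x. \<bar>f k x * g k x - f' x * g' x\<bar> \<partial>M)"
      by (rule integral_abs_bound)
    also have "\<dots> \<le> (\<integral>x. \<bar>f' x * ?dg k x\<bar> + \<bar>?df k x * g' x\<bar> + \<bar>?df k x * ?dg k x\<bar> \<partial>M)"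
    proof (rule integral_mono)
      show "integrable M (\<lambda>x. \<bar>f k x * g k x - f' x * g' x\<bar>)"
        using CS(1) f g by (intro integrable_abs Bochner_Integration.integrable_diff) auto
      show "integrable M (\<lambda>x. \<bar>f' x * ?dg k x\<bar> + \<bar>?df k x * g' x\<bar> + \<bar>?df k x * ?dg k x\<bar>)"
        by (intro integrable_abs Bochner_Integration.integrable_add CS(1) d f g)
      fix x
      have "f k x * g k x - f' x * g' x = f' x * ?dg k x + ?df k x * g' x + ?df k x * ?dg k x"
        by (simp add: algebra_simps)
      then show "\<bar>f k x * g k x - f' x * g' x\<bar> \<le> \<bar>f' x * ?dg k x\<bar> + \<bar>?df k x * g' x\<bar> + \<bar>?df k x * ?dg k x\<bar>"
        by linarith
    qed
    also have "\<dots> = (\<integral>x. \<bar>f' x * ?dg k x\<bar> \<partial>M) + (\<integral>x. \<bar>?df k x * g' x\<bar> \<partial>M) + (\<integral>x. \<bar>?df k x * ?dg k x\<bar> \<partial>M)"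
      by (simp only: Bochner_Integration.integral_add integrable_abs Bochner_Integration.integrable_add CS(1) d f(1,2) g(1,2))
    also have "\<dots> \<le> ?N f' * ?N (?dg k) + ?N (?df k) * ?N g' + ?N (?df k) * ?N (?dg k)"
      by (intro add_mono CS(2) d f g)
    finally show ?thesis by (simp add: algebra_simps)
  qed
  have "(\<lambda>k. (?N f' + ?N (?df k)) * (?N g' + ?N (?dg k)) - ?N f' * ?N g')
      \<longlonglongrightarrow> (?N f' + 0) * (?N g' + 0) - ?N f' * ?N g'"
    by (intro tendsto_intros f g)
  then have "(\<lambda>k. (?N f' + ?N (?df k)) * (?N g' + ?N (?dg k)) - ?N f' * ?N g') \<longlonglongrightarrow> 0"
    by simp
  then have "(\<lambda>k. (\<integral>x. f k x * g k x \<partial>M) - (\<integral>x. f' x * g' x \<partial>M)) \<longlonglongrightarrow> 0"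
    by (rule Lim_null_comparison[rotated]) (use bound in auto)
  then show ?thesis by (simp add: LIM_zero_iff)
qed

lemma memL_236_tendsto:
  assumes f: "\<And>k. memL M 2 (f k)" "memL M 2 f'" "(\<lambda>k. normL M 2 (\<lambda>x. f k x - f' x)) \<longlonglongrightarrow> 0"
    and g: "\<And>k. memL M 3 (g k)" "memL M 3 g'" "(\<lambda>k. normL M 3 (\<lambda>x. g k x - g' x)) \<longlonglongrightarrow> 0"
    and h: "\<And>k. memL M 6 (h k)" "memL M 6 h'" "(\<lambda>k. normL M 6 (\<lambda>x. h k x - h' x)) \<longlonglongrightarrow> 0"
  shows "(\<lambda>k. \<integral>x. f k x * g k x * h k x \<partial>M) \<longlonglongrightarrow> (\<integral>x. f' x * g' x * h' x \<partial>M)"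
proof -
  let ?df = "\<lambda>k x. f k x - f' x" and ?dg = "\<lambda>k x. g k x - g' x" and ?dh = "\<lambda>k x. h k x - h' x"
  let ?A = "normL M 2" and ?B = "normL M 3" and ?C = "normL M 6"
  have d: "memL M 2 (?df k)" "memL M 3 (?dg k)" "memL M 6 (?dh k)" for k
    using f g h by (auto intro: memL_diff)
  note H = memL_Holder_236
  have bound: "\<bar>(\<integral>x. f k x * g k x * h k x \<partial>M) - (\<integral>x. f' x * g' x * h' x \<partial>M)\<bar>
      \<le> (?A f' + ?A (?df k)) * (?B g' + ?B (?dg k)) * (?C h' + ?C (?dh k)) - ?A f' * ?B g' * ?C h'" for k
  proof -
    \<comment> \<open>The seven terms of the expanded triple product that contain at least one
      difference.\<close>
    let ?T = "\<lambda>x. \<bar>f' x * g' x * ?dh k x\<bar> + \<bar>f' x * ?dg k x * h' x\<bar> + \<bar>f' x * ?dg k x * ?dh k x\<bar>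
        + \<bar>?df k x * g' x * h' x\<bar> + \<bar>?df k x * g' x * ?dh k x\<bar> + \<bar>?df k x * ?dg k x * h' x\<bar>
        + \<bar>?df k x * ?dg k x * ?dh k x\<bar>"
    have "(\<integral>x. f k x * g k x * h k x \<partial>M) - (\<integral>x. f' x * g' x * h' x \<partial>M)
        = (\<integral>x. f k x * g k x * h k x - f' x * g' x * h' x \<partial>M)"
      by (intro Bochner_Integration.integral_diff[symmetric] H(1) f g h)
    also have "\<bar>\<dots>\<bar> \<le> (\<integral>x. \<bar>f k x * g k x * h k x - f' x * g' x * h' x\<bar> \<partial>M)"
      by (rule integral_abs_bound)
    also have "\<dots> \<le> (\<integral>x. ?T x \<partial>M)"
    proof (rule integral_mono)
      show "integrable M (\<lambda>x. \<bar>f k x * g k x * h k x - f' x * g' x * h' x\<bar>)"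
        by (intro integrable_abs Bochner_Integration.integrable_diff H(1) f g h)
      show "integrable M ?T"
        by (intro integrable_abs Bochner_Integration.integrable_add H(1) d f g h)
      fix x
      have "f k x * g k x * h k x - f' x * g' x * h' x
          = f' x * g' x * ?dh k x + f' x * ?dg k x * h' x + f' x * ?dg k x * ?dh k x
          + ?df k x * g' x * h' x + ?df k x * g' x * ?dh k x + ?df k x * ?dg k x * h' x
          + ?df k x * ?dg k x * ?dh k x"
        by algebra
      then show "\<bar>f k x * g k x * h k x - f' x * g' x * h' x\<bar> \<le> ?T x"
        by (rule ssubst) (intro order_trans[OF abs_triangle_ineq add_right_mono] order_refl)
    qed
    also have "\<dots> = (\<integral>x. \<bar>f' x * g' x * ?dh k x\<bar> \<partial>M) + (\<integral>x. \<bar>f' x * ?dg k x * h' x\<bar> \<partial>M)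
        + (\<integral>x. \<bar>f' x * ?dg k x * ?dh k x\<bar> \<partial>M) + (\<integral>x. \<bar>?df k x * g' x * h' x\<bar> \<partial>M)
        + (\<integral>x. \<bar>?df k x * g' x * ?dh k x\<bar> \<partial>M) + (\<integral>x. \<bar>?df k x * ?dg k x * h' x\<bar> \<partial>M)
        + (\<integral>x. \<bar>?df k x * ?dg k x * ?dh k x\<bar> \<partial>M)"
      by (simp only: Bochner_Integration.integral_add integrable_abs Bochner_Integration.integrable_add H(1) d f(1,2) g(1,2) h(1,2))
    also have "\<dots> \<le> ?A f' * ?B g' * ?C (?dh k) + ?A f' * ?B (?dg k) * ?C h' + ?A f' * ?B (?dg k) * ?C (?dh k)
        + ?A (?df k) * ?B g' * ?C h' + ?A (?df k) * ?B g' * ?C (?dh k) + ?A (?df k) * ?B (?dg k) * ?C h'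
        + ?A (?df k) * ?B (?dg k) * ?C (?dh k)"
      by (intro add_mono H(2) d f g h)
    also have "\<dots> = (?A f' + ?A (?df k)) * (?B g' + ?B (?dg k)) * (?C h' + ?C (?dh k)) - ?A f' * ?B g' * ?C h'"
      by algebra
    finally show ?thesis .
  qed
  have "(\<lambda>k. (?A f' + ?A (?df k)) * (?B g' + ?B (?dg k)) * (?C h' + ?C (?dh k)) - ?A f' * ?B g' * ?C h')
      \<longlonglongrightarrow> (?A f' + 0) * (?B g' + 0) * (?C h' + 0) - ?A f' * ?B g' * ?C h'"
    by (intro tendsto_intros f g h)
  then have "(\<lambda>k. (?A f' + ?A (?df k)) * (?B g' + ?B (?dg k)) * (?C h' + ?C (?dh k)) - ?A f' * ?B g' * ?C h') \<longlonglongrightarrow> 0"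
    by simp
  then have "(\<lambda>k. (\<integral>x. f k x * g k x * h k x \<partial>M) - (\<integral>x. f' x * g' x * h' x \<partial>M)) \<longlonglongrightarrow> 0"
    by (rule Lim_null_comparison[rotated]) (use bound in auto)
  then show ?thesis by (simp add: LIM_zero_iff)
qed

lemma (in finite_measure) memL_const: "memL M n (\<lambda>x. c)"
  by (simp add: memL_def)

text \<open>Cauchy-Schwarz for the cube of \<open>\<bar>f x\<bar>\<close> against the constant 1.
  The bound is stated for cubes to avoid fractional powers of the measure.\<close>

lemma (in finite_measure) memL_6_imp_3:
  assumes "memL M 6 f"
  shows "memL M 3 f" and "normL M 3 f ^ 3 \<le> normL M 6 f ^ 3 * sqrt (measure M (space M))"
proof -
  have [measurable]: "f \<in> borel_measurable M" using assms by (simp add: memL_def)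
  have c: "memL M 2 (\<lambda>x. \<bar>f x\<bar>^3)"
    using assms by (simp add: memL_def flip: power_mult)
  have "integrable M (\<lambda>x. \<bar>f x\<bar>^3 * 1)"
    by (rule memL_Cauchy_Schwarz(1)[OF c memL_const])
  then show "memL M 3 f" by (simp add: memL_def)
  have "normL M 3 f ^ 3 = (\<integral>x. \<bar>\<bar>f x\<bar>^3 * 1\<bar> \<partial>M)" by (simp add: normL_power)
  also have "\<dots> \<le> normL M 2 (\<lambda>x. \<bar>f x\<bar>^3) * normL M 2 (\<lambda>x. 1)"
    by (rule memL_Cauchy_Schwarz(2)[OF c memL_const])
  also have "normL M 2 (\<lambda>x. \<bar>f x\<bar>^3) = sqrt ((normL M 6 f ^ 3)\<^sup>2)"
    unfolding normL_def[of M 2] by (simp add: normL_power sqrt_def flip: power_mult)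
  also have "\<dots> = normL M 6 f ^ 3" by (intro real_sqrt_unique) (simp_all add: normL_nonneg)
  also have "normL M 2 (\<lambda>x. 1) = sqrt (measure M (space M))"
    by (simp add: normL_def sqrt_def)
  finally show "normL M 3 f ^ 3 \<le> normL M 6 f ^ 3 * sqrt (measure M (space M))" .
qed

lemma (in finite_measure) normL_3_tendsto_0:
  assumes "\<And>k. memL M 6 (f k)" "(\<lambda>k. normL M 6 (f k)) \<longlonglongrightarrow> 0"
  shows "(\<lambda>k. normL M 3 (f k)) \<longlonglongrightarrow> 0"
proof (rule normL_tendsto_0)
  have "(\<lambda>k. normL M 6 (f k) ^ 3 * sqrt (measure M (space M))) \<longlonglongrightarrow> 0 ^ 3 * sqrt (measure M (space M))"
    by (intro tendsto_intros assms)
  then have "(\<lambda>k. normL M 6 (f k) ^ 3 * sqrt (measure M (space M))) \<longlonglongrightarrow> 0" by simp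
  then show "(\<lambda>k. \<integral>x. \<bar>f k x\<bar> ^ 3 \<partial>M) \<longlonglongrightarrow> 0"
    by (rule Lim_null_comparison[rotated])
       (use memL_6_imp_3(2)[OF assms(1)] in \<open>auto simp: normL_power\<close>)
qed

subsection \<open>Sobolev's inequality and weak gradients on a bounded domain\<close>

lemma L2_iff_memL: "L2 \<Omega> w \<longleftrightarrow> memL (lebesgue_on \<Omega>) 2 w"
  by (simp add: L2_def memL_def)

lemma borel_measurable_lebesgue_on:
  "f \<in> borel_measurable borel \<Longrightarrow> f \<in> borel_measurable (lebesgue_on S)"
  by (intro measurable_restrict_space1 measurable_completion) simp

locale bounded_domain =
  fixes \<Omega> :: "(real^'d::finite) set"
  assumes open_dom: "open \<Omega>" and bounded_dom: "bounded \<Omega>"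
    and dim: "CARD('d) = 2 \<or> CARD('d) = 3"
begin

abbreviation M :: "(real^'d) measure" where "M \<equiv> lebesgue_on \<Omega>"

sublocale M: finite_measure M
  using open_dom bounded_dom by (intro finite_measure_lebesgue_on lmeasurable_open)

lemma integrable_continuous:
  fixes f :: "real^'d \<Rightarrow> real"
  assumes "continuous_on UNIV f"
  shows "integrable M f"
proof -
  have "compact (f ` closure \<Omega>)"
    using bounded_dom by (intro compact_continuous_image continuous_on_subset[OF assms]) (auto simp: compact_closure)
  then obtain B where B: "\<forall>y\<in>f ` closure \<Omega>. norm y \<le> B"
    using compact_imp_bounded bounded_iff by blast
  have "f \<in> borel_measurable M"
    using assms by (intro borel_measurable_lebesgue_on borel_measurable_continuous_onI)
  then show ?thesis
    using B closure_subset[of \<Omega>] by (intro M.integrable_const_bound[of _ B] AE_I2) auto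
qed

lemma memL_continuous: "continuous_on UNIV f \<Longrightarrow> memL M n f"
  unfolding memL_def
  by (auto intro!: integrable_continuous continuous_intros borel_measurable_lebesgue_on borel_measurable_continuous_onI)

lemma memL_test_fun: "test_fun \<Omega> \<phi> \<Longrightarrow> memL M n \<phi>"
  by (intro memL_continuous smooth_fun_continuous test_fun_smooth)

text \<open>Connects the whole-space integrals, to which Tonelli was applied, with the integrals
  over the domain in the definitions.\<close>

lemma nn_integral_eq_integ:
  fixes g :: "real^'d \<Rightarrow> real"
  assumes "continuous_on UNIV g" "\<And>x. 0 \<le> g x" "\<And>x. x \<notin> \<Omega> \<Longrightarrow> g x = 0"
  shows "(\<integral>\<^sup>+v. ennreal (g v) \<partial>lborel) = ennreal (integ \<Omega> g)"
proof -
  have "(\<integral>\<^sup>+v. ennreal (g v) \<partial>lborel) = (\<integral>\<^sup>+v. ennreal (g v) * indicator \<Omega> v \<partial>lebesgue)"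
    using assms(3) by (auto simp: nn_integral_completion indicator_def intro!: nn_integral_cong)
  also have "\<dots> = (\<integral>\<^sup>+v. ennreal (g v) \<partial>M)"
    using open_dom by (subst nn_integral_restrict_space) auto
  also have "\<dots> = ennreal (integ \<Omega> g)"
    unfolding integ_def using assms integrable_continuous by (intro nn_integral_eq_integral) auto
  finally show ?thesis .
qed

text \<open>4096 = 16^3 is the constant for d = 3, and 729 = 9^3 times the measure of the domain the
  one for d = 2; their sum serves both cases.\<close>

definition sob :: real where
  "sob = 4096 + 729 * measure M (space M)"

lemma sob_pos: "0 < sob"
  unfolding sob_def by (simp add: add_pos_nonneg)

lemma test_fun_pd_square_le:
  assumes "test_fun \<Omega> \<phi>"
  shows "integ \<Omega> (\<lambda>x. (pd \<phi> j x)\<^sup>2) \<le> integ \<Omega> (\<lambda>x. \<Sum>j\<in>UNIV. (pd \<phi> j x)\<^sup>2)"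
  unfolding integ_def
proof (rule integral_mono)
  have c: "continuous_on UNIV (pd \<phi> j)" for j
    using assms by (intro smooth_fun_continuous test_fun_smooth test_fun_pd)
  show "integrable M (\<lambda>x. (pd \<phi> j x)\<^sup>2)" "integrable M (\<lambda>x. \<Sum>j\<in>UNIV. (pd \<phi> j x)\<^sup>2)"
    by (intro integrable_continuous continuous_intros c)+
  show "(pd \<phi> j x)\<^sup>2 \<le> (\<Sum>j\<in>UNIV. (pd \<phi> j x)\<^sup>2)" for x
    by (rule member_le_sum) auto
qed

text \<open>By Cauchy-Schwarz, \<open>\<beta> n j\<close> squared is at most (n+1)^2 times the
  integral of the power 2n of \<open>\<phi>\<close>, times \<open>D\<close>. For d = 3 and n = 3
  that integral is \<open>\<alpha>\<close> again, so \<alpha>^4 \<le> (16 \<alpha> D)^3. For d = 2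
  and n = 2 it is \<open>\<kappa>\<close>, which has to be bounded by \<open>\<alpha>\<close>
  first.\<close>

lemma test_fun_Sobolev:
  assumes t: "test_fun \<Omega> \<phi>"
  shows "integ \<Omega> (\<lambda>x. \<phi> x ^ 6) \<le> sob * (integ \<Omega> (\<lambda>x. \<Sum>j\<in>UNIV. (pd \<phi> j x)\<^sup>2)) ^ 3"
proof -
  define \<alpha> where "\<alpha> = integ \<Omega> (\<lambda>x. \<phi> x ^ 6)"
  define D where "D = integ \<Omega> (\<lambda>x. \<Sum>j\<in>UNIV. (pd \<phi> j x)\<^sup>2)"
  define m where "m = measure M (space M)"
  have c: "continuous_on UNIV \<phi>" "continuous_on UNIV (pd \<phi> j)" for j
    using t by (auto intro: smooth_fun_continuous test_fun_smooth test_fun_pd)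
  have out: "\<phi> x = 0" if "x \<notin> \<Omega>" for x using t that by (rule test_fun_outside)
  have nn: "0 \<le> \<alpha>" "0 \<le> D" "0 \<le> m"
    unfolding \<alpha>_def D_def integ_def m_def by (auto intro!: integral_nonneg_AE sum_nonneg)
  have \<alpha>: "(\<integral>\<^sup>+v. ennreal (\<phi> v ^ 6) \<partial>lborel) = ennreal \<alpha>"
    unfolding \<alpha>_def by (rule nn_integral_eq_integ) (auto intro!: continuous_intros c simp: out)
  define \<beta> where "\<beta> = (\<lambda>n j. integ \<Omega> (\<lambda>x. real (Suc n) * \<bar>\<phi> x\<bar>^n * \<bar>pd \<phi> j x\<bar>))"
  have \<beta>nn: "0 \<le> \<beta> n j" for n j
    unfolding \<beta>_def integ_def by (auto intro!: integral_nonneg_AE)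
  have \<beta>: "(\<integral>\<^sup>+v. ennreal (real (Suc n) * \<bar>\<phi> v\<bar>^n * \<bar>pd \<phi> j v\<bar>) \<partial>lborel) = ennreal (\<beta> n j)" if "n > 0" for n j
    unfolding \<beta>_def using that by (intro nn_integral_eq_integ) (auto intro!: continuous_intros c simp: out)
  have \<beta>2: "(\<beta> n j)\<^sup>2 \<le> (real (Suc n))\<^sup>2 * integ \<Omega> (\<lambda>x. \<phi> x ^ (2 * n)) * D" for n j
  proof -
    have "\<beta> n j \<le> normL M 2 (\<lambda>x. real (Suc n) * \<bar>\<phi> x\<bar>^n) * normL M 2 (pd \<phi> j)"
      using memL_Cauchy_Schwarz(2)[of M "\<lambda>x. real (Suc n) * \<bar>\<phi> x\<bar>^n" "pd \<phi> j"]
      by (simp add: memL_continuous c continuous_intros \<beta>_def integ_def abs_mult)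
    then have "(\<beta> n j)\<^sup>2 \<le> (normL M 2 (\<lambda>x. real (Suc n) * \<bar>\<phi> x\<bar>^n) * normL M 2 (pd \<phi> j))\<^sup>2"
      by (intro power_mono \<beta>nn)
    also have "\<dots> = (real (Suc n))\<^sup>2 * integ \<Omega> (\<lambda>x. \<phi> x ^ (2 * n)) * integ \<Omega> (\<lambda>x. (pd \<phi> j x)\<^sup>2)"
      by (simp add: power_mult_distrib normL_power integ_def power_even_abs mult.commute[of 2] flip: power_mult del: of_nat_Suc)
    also have "\<dots> \<le> (real (Suc n))\<^sup>2 * integ \<Omega> (\<lambda>x. \<phi> x ^ (2 * n)) * D"
      unfolding D_def
      by (intro mult_left_mono test_fun_pd_square_le t) (auto simp: integ_def intro!: mult_nonneg_nonneg integral_nonneg_AE)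
    finally show ?thesis .
  qed
  from dim show ?thesis
  proof
    assume "CARD('d) = 3"
    then obtain i j k :: 'd where ijk: "UNIV = {i, j, k}" "i \<noteq> j" "i \<noteq> k" "j \<noteq> k"
      unfolding card_3_iff by auto
    have "(ennreal \<alpha>)\<^sup>2 \<le> ennreal (\<beta> 3 i) * ennreal (\<beta> 3 j) * ennreal (\<beta> 3 k)"
      using test_fun_Sobolev_nn_3[OF t ijk] \<alpha> \<beta>[of 3] by simp
    then have "\<alpha>\<^sup>2 \<le> \<beta> 3 i * \<beta> 3 j * \<beta> 3 k"
      using nn \<beta>nn by (simp add: ennreal_power ennreal_mult[symmetric])
    then have "(\<alpha>\<^sup>2)\<^sup>2 \<le> (\<beta> 3 i)\<^sup>2 * (\<beta> 3 j)\<^sup>2 * (\<beta> 3 k)\<^sup>2"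
      using power_mono[of "\<alpha>\<^sup>2" "\<beta> 3 i * \<beta> 3 j * \<beta> 3 k" 2] by (simp add: power_mult_distrib)
    also have "\<dots> \<le> (16 * \<alpha> * D) * (16 * \<alpha> * D) * (16 * \<alpha> * D)"
      using \<beta>2[of 3] nn by (intro mult_mono) (auto simp: \<alpha>_def[symmetric])
    finally have "\<alpha>^3 * \<alpha> \<le> \<alpha>^3 * (4096 * D^3)"
      by (simp add: power2_eq_square power3_eq_cube algebra_simps)
    \<comment> \<open>Cancelling the cube is legitimate since \<open>\<alpha>\<close> is a real
      number; when it is 0 the bound is trivial.\<close>
    then have "\<alpha> \<le> 4096 * D^3"
      using nn by (cases "\<alpha> = 0") auto
    also have "\<dots> \<le> sob * D^3"
      using nn by (intro mult_right_mono) (auto simp: sob_def m_def)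
    finally show ?thesis by (simp add: \<alpha>_def D_def)
  next
    assume "CARD('d) = 2"
    then obtain i j :: 'd where ij: "UNIV = {i, j}" "i \<noteq> j"
      unfolding card_2_iff by auto
    define \<kappa> where "\<kappa> = integ \<Omega> (\<lambda>x. \<phi> x ^ 4)"
    have \<kappa>nn: "0 \<le> \<kappa>" unfolding \<kappa>_def integ_def by (auto intro!: integral_nonneg_AE)
    have "ennreal \<alpha> \<le> ennreal (\<beta> 2 i) * ennreal (\<beta> 2 j)"
      using test_fun_Sobolev_nn_2[OF t ij] \<alpha> \<beta>[of 2] by simp
    then have "\<alpha> \<le> \<beta> 2 i * \<beta> 2 j"
      using nn \<beta>nn by (simp add: ennreal_mult[symmetric])
    then have "\<alpha>\<^sup>2 \<le> (\<beta> 2 i)\<^sup>2 * (\<beta> 2 j)\<^sup>2"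
      using power_mono[of \<alpha> "\<beta> 2 i * \<beta> 2 j" 2] nn by (simp add: power_mult_distrib)
    also have "\<dots> \<le> (9 * \<kappa> * D) * (9 * \<kappa> * D)"
      using \<beta>2[of 2] nn \<kappa>nn by (intro mult_mono) (auto simp: \<kappa>_def[symmetric])
    also have "\<dots> = (9 * \<kappa> * D)\<^sup>2" by (simp add: power2_eq_square)
    finally have \<alpha>\<kappa>: "\<alpha> \<le> 9 * \<kappa> * D"
      using nn \<kappa>nn by (intro power2_le_imp_le[of \<alpha>]) auto
    \<comment> \<open>Interpolation of the fourth power: Hoelder for the factors of powers 3, 0 and
      1 gives \<kappa> \<le> \<alpha>^(1/2) m^(1/3) \<alpha>^(1/6). Raising to the sixth power
      clears the roots, and a final square root leaves \<open>\<kappa>3\<close>.\<close>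
    have "\<kappa> = (\<integral>x. \<bar>\<bar>\<phi> x\<bar>^3 * 1 * \<phi> x\<bar> \<partial>M)"
      unfolding \<kappa>_def integ_def
    proof (intro Bochner_Integration.integral_cong refl)
      fix x
      have "\<phi> x ^ 4 = \<bar>\<phi> x\<bar> ^ 4" by simp
      then show "\<phi> x ^ 4 = \<bar>\<bar>\<phi> x\<bar>^3 * 1 * \<phi> x\<bar>"
        by (simp add: abs_mult eval_nat_numeral)
    qed
    also have "\<dots> \<le> normL M 2 (\<lambda>x. \<bar>\<phi> x\<bar>^3) * normL M 3 (\<lambda>x. 1) * normL M 6 \<phi>"
      by (intro memL_Holder_236(2) memL_continuous continuous_intros c)
    finally have "\<kappa>^3 \<le> (normL M 2 (\<lambda>x. \<bar>\<phi> x\<bar>^3) * normL M 3 (\<lambda>x. 1) * normL M 6 \<phi>)^3"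
      using \<kappa>nn by (intro power_mono)
    then have "(\<kappa>^3)\<^sup>2 \<le> ((normL M 2 (\<lambda>x. \<bar>\<phi> x\<bar>^3) * normL M 3 (\<lambda>x. 1) * normL M 6 \<phi>)^3)\<^sup>2"
      by (rule power_mono) (simp add: \<kappa>nn)
    also have "\<dots> = ((normL M 2 (\<lambda>x. \<bar>\<phi> x\<bar>^3))\<^sup>2)^3 * (normL M 3 (\<lambda>x. 1) ^ 3)\<^sup>2 * normL M 6 \<phi> ^ 6"
      by (simp add: power_mult_distrib flip: power_mult)
    also have "\<dots> = \<alpha>^3 * m\<^sup>2 * \<alpha>"
      by (simp add: normL_power power_even_abs \<alpha>_def integ_def m_def flip: power_mult)
    also have "\<dots> = (\<alpha>\<^sup>2 * m)\<^sup>2" by (simp add: power2_eq_square power3_eq_cube algebra_simps)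
    finally have \<kappa>3: "\<kappa>^3 \<le> \<alpha>\<^sup>2 * m"
      using nn by (intro power2_le_imp_le[of "\<kappa>^3"]) auto
    have "\<alpha>^3 \<le> (9 * \<kappa> * D)^3" using \<alpha>\<kappa> nn by (intro power_mono)
    also have "\<dots> = 729 * D^3 * \<kappa>^3" by (simp add: power_mult_distrib)
    also have "\<dots> \<le> 729 * D^3 * (\<alpha>\<^sup>2 * m)" using nn by (intro mult_left_mono \<kappa>3) auto
    finally have "\<alpha>\<^sup>2 * \<alpha> \<le> \<alpha>\<^sup>2 * (729 * m * D^3)"
      by (simp add: power2_eq_square power3_eq_cube algebra_simps)
    then have "\<alpha> \<le> 729 * m * D^3"
      using nn by (cases "\<alpha> = 0") auto
    also have "\<dots> \<le> sob * D^3"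
      using nn by (intro mult_right_mono) (auto simp: sob_def m_def)
    finally show ?thesis by (simp add: \<alpha>_def D_def)
  qed
qed

text \<open>\<^const>\<open>wgrad\<close> may pick any weak gradient; here \<open>A\<close> is one that is an \<open>L\<^sup>2\<close>-limit of gradients of test functions.\<close>

definition approx_by :: "(nat \<Rightarrow> 'd sfield) \<Rightarrow> 'd sfield \<Rightarrow> 'd vfield \<Rightarrow> bool" where
  "approx_by \<phi> w A \<longleftrightarrow> (\<forall>k. test_fun \<Omega> (\<phi> k)) \<and> L2 \<Omega> w \<and> is_wgrad \<Omega> w A
      \<and> (\<lambda>k. integ \<Omega> (\<lambda>x. (w x - \<phi> k x)\<^sup>2)) \<longlonglongrightarrow> 0
      \<and> (\<forall>j. (\<lambda>k. integ \<Omega> (\<lambda>x. (A x $ j - pd (\<phi> k) j x)\<^sup>2)) \<longlonglongrightarrow> 0)"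

lemma H10s_iff: "H10s \<Omega> w \<longleftrightarrow> (\<exists>\<phi> A. approx_by \<phi> w A)"
  unfolding H10s_def approx_by_def by blast

lemma is_wgrad_memL: "is_wgrad \<Omega> w G \<Longrightarrow> memL M 2 (\<lambda>x. G x $ j)"
  by (simp add: is_wgrad_def L2_iff_memL)

lemma approx_by_test: "approx_by \<phi> w A \<Longrightarrow> test_fun \<Omega> (\<phi> k)"
  by (simp add: approx_by_def)

lemma approx_by_pd_tendsto:
  assumes "approx_by \<phi> w A"
  shows "(\<lambda>k. normL M 2 (\<lambda>x. pd (\<phi> k) j x - A x $ j)) \<longlonglongrightarrow> 0"
  using assms by (intro normL_tendsto_0) (simp add: approx_by_def integ_def power2_commute)

text \<open>Convergence in L^2 is L^1 convergence of the squared differences, which yields the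
  pointwise convergence that Fatou's lemma requires.\<close>

lemma approx_by_AE_subseq:
  assumes "approx_by \<phi> w A"
  obtains r :: "nat \<Rightarrow> nat" where "strict_mono r" "AE x in M. (\<lambda>k. \<phi> (r k) x) \<longlonglongrightarrow> w x"
proof -
  have "memL M 2 w" using assms by (simp add: approx_by_def L2_iff_memL)
  then have "memL M 2 (\<lambda>x. w x - \<phi> k x)" for k
    by (rule memL_diff[OF _ memL_test_fun[OF approx_by_test[OF assms]]])
  then have "integrable M (\<lambda>x. (w x - \<phi> k x)\<^sup>2)" for k by (simp add: memL_def)
  moreover have "(\<lambda>k. \<integral>x. norm ((w x - \<phi> k x)\<^sup>2) \<partial>M) \<longlonglongrightarrow> 0"
    using assms by (simp add: approx_by_def integ_def)
  ultimately obtain r where r: "strict_mono r" "AE x in M. (\<lambda>k. (w x - \<phi> (r k) x)\<^sup>2) \<longlonglongrightarrow> 0"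
    using tendsto_L1_AE_subseq[of M "\<lambda>k x. (w x - \<phi> k x)\<^sup>2"] by blast
  from r(2) have "AE x in M. (\<lambda>k. \<phi> (r k) x) \<longlonglongrightarrow> w x"
  proof (rule AE_mp, intro AE_I2 impI)
    fix x assume "(\<lambda>k. (w x - \<phi> (r k) x)\<^sup>2) \<longlonglongrightarrow> 0"
    then have "(\<lambda>k. sqrt ((w x - \<phi> (r k) x)\<^sup>2)) \<longlonglongrightarrow> sqrt 0" by (rule tendsto_real_sqrt)
    then have "(\<lambda>k. w x - \<phi> (r k) x) \<longlonglongrightarrow> 0" by (simp add: tendsto_rabs_zero_iff)
    then have "(\<lambda>k. w x - (w x - \<phi> (r k) x)) \<longlonglongrightarrow> w x - 0" by (intro tendsto_intros)
    then show "(\<lambda>k. \<phi> (r k) x) \<longlonglongrightarrow> w x" by simp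
  qed
  with r(1) that show ?thesis by blast
qed

text \<open>Fatou's lemma applied to Sobolev's inequality for the test functions \<phi>_k - \<psi>.
  Subtracting \<open>\<psi>\<close> gives two results at once: \<psi> = 0 shows that
  \<open>w\<close> is in L^6 with Sobolev's bound, and \<psi> = \<phi>_k shows that the
  approximation converges in L^6.\<close>

lemma approx_by_Sobolev:
  assumes ap: "approx_by \<phi> w A" and \<psi>: "test_fun \<Omega> \<psi>"
  shows "memL M 6 (\<lambda>x. w x - \<psi> x)"
    and "integ \<Omega> (\<lambda>x. (w x - \<psi> x)^6) \<le> sob * (integ \<Omega> (\<lambda>x. \<Sum>j\<in>UNIV. (A x $ j - pd \<psi> j x)\<^sup>2))^3"
proof -
  have [measurable]: "w \<in> borel_measurable M" using ap by (simp add: approx_by_def L2_def)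
  have [measurable]: "\<psi> \<in> borel_measurable M" "\<phi> k \<in> borel_measurable M" for k
    using \<psi> approx_by_test[OF ap] by (auto intro: memL_measurable memL_test_fun)
  define D where "D = (\<lambda>k. integ \<Omega> (\<lambda>x. \<Sum>j\<in>UNIV. (pd (\<phi> k) j x - pd \<psi> j x)\<^sup>2))"
  define D' where "D' = integ \<Omega> (\<lambda>x. \<Sum>j\<in>UNIV. (A x $ j - pd \<psi> j x)\<^sup>2)"
  have mp: "memL M 2 (pd (\<phi> k) j)" "memL M 2 (pd \<psi> j)" for k j
    using \<psi> approx_by_test[OF ap] by (auto intro: memL_test_fun test_fun_pd)
  have mA: "memL M 2 (\<lambda>x. A x $ j)" for j
    using ap by (auto simp: approx_by_def intro: is_wgrad_memL)
  have int: "integrable M (\<lambda>x. (f x - g x)\<^sup>2)" if "memL M 2 f" "memL M 2 g" for f g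
    using memL_diff[OF that] by (simp add: memL_def)
  have D_tendsto: "D \<longlonglongrightarrow> D'"
  proof -
    have "(\<lambda>k. \<integral>x. (pd (\<phi> k) j x - pd \<psi> j x) * (pd (\<phi> k) j x - pd \<psi> j x) \<partial>M)
        \<longlonglongrightarrow> (\<integral>x. (A x $ j - pd \<psi> j x) * (A x $ j - pd \<psi> j x) \<partial>M)" for j
      using approx_by_pd_tendsto[OF ap, of j]
      by (intro memL_2_tendsto memL_diff mp mA) auto
    then show ?thesis
      unfolding D_def D'_def integ_def
      by (simp add: int mp mA Bochner_Integration.integral_sum power2_eq_square[symmetric] tendsto_sum)
  qed
  obtain r where r: "strict_mono r" "AE x in M. (\<lambda>k. \<phi> (r k) x) \<longlonglongrightarrow> w x"
    using approx_by_AE_subseq[OF ap] by blast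
  have step: "(\<integral>\<^sup>+x. ennreal ((\<phi> k x - \<psi> x)^6) \<partial>M) \<le> ennreal (sob * D k ^ 3)" for k
  proof -
    have t: "test_fun \<Omega> (\<lambda>x. 1 * \<phi> k x + (-1) * \<psi> x)"
      by (intro test_fun_lincomb \<psi> approx_by_test[OF ap])
    have "pd (\<lambda>x. 1 * \<phi> k x + (-1) * \<psi> x) j x = pd (\<phi> k) j x - pd \<psi> j x" for j x
      by (subst pd_lincomb) (auto intro!: smooth_fun_differentiable test_fun_smooth[OF \<psi>] test_fun_smooth[OF approx_by_test[OF ap]])
    with test_fun_Sobolev[OF t] have "integ \<Omega> (\<lambda>x. (\<phi> k x - \<psi> x)^6) \<le> sob * D k ^ 3"
      by (simp add: D_def)
    moreover have "memL M 6 (\<lambda>x. \<phi> k x - \<psi> x)"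
      by (intro memL_diff memL_test_fun \<psi> approx_by_test[OF ap])
    then have "integrable M (\<lambda>x. (\<phi> k x - \<psi> x)^6)"
      by (simp add: memL_def power_even_abs)
    then have "(\<integral>\<^sup>+x. ennreal ((\<phi> k x - \<psi> x)^6) \<partial>M) = ennreal (integ \<Omega> (\<lambda>x. (\<phi> k x - \<psi> x)^6))"
      unfolding integ_def by (intro nn_integral_eq_integral) auto
    ultimately show ?thesis by (simp add: ennreal_leI)
  qed
  have "(\<integral>\<^sup>+x. ennreal ((w x - \<psi> x)^6) \<partial>M)
      = (\<integral>\<^sup>+x. liminf (\<lambda>k. ennreal ((\<phi> (r k) x - \<psi> x)^6)) \<partial>M)"
  proof (rule nn_integral_cong_AE)
    from r(2) show "AE x in M. ennreal ((w x - \<psi> x)^6) = liminf (\<lambda>k. ennreal ((\<phi> (r k) x - \<psi> x)^6))"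
    proof (rule AE_mp, intro AE_I2 impI)
      fix x assume "(\<lambda>k. \<phi> (r k) x) \<longlonglongrightarrow> w x"
      then have "(\<lambda>k. ennreal ((\<phi> (r k) x - \<psi> x)^6)) \<longlonglongrightarrow> ennreal ((w x - \<psi> x)^6)"
        by (intro tendsto_intros tendsto_ennrealI)
      then show "ennreal ((w x - \<psi> x)^6) = liminf (\<lambda>k. ennreal ((\<phi> (r k) x - \<psi> x)^6))"
        by (rule lim_imp_Liminf[OF sequentially_bot, symmetric])
    qed
  qed
  also have "\<dots> \<le> liminf (\<lambda>k. \<integral>\<^sup>+x. ennreal ((\<phi> (r k) x - \<psi> x)^6) \<partial>M)"
    by (intro nn_integral_liminf) measurable
  also have "\<dots> \<le> liminf (\<lambda>k. ennreal (sob * D (r k) ^ 3))"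
    by (intro Liminf_mono always_eventually allI step)
  also have "\<dots> = ennreal (sob * D' ^ 3)"
  proof -
    have "(\<lambda>k. D (r k)) \<longlonglongrightarrow> D'"
      using LIMSEQ_subseq_LIMSEQ[OF D_tendsto r(1)] by (simp add: o_def)
    then have "(\<lambda>k. ennreal (sob * D (r k) ^ 3)) \<longlonglongrightarrow> ennreal (sob * D' ^ 3)"
      by (intro tendsto_intros tendsto_ennrealI)
    then show ?thesis by (rule lim_imp_Liminf[OF sequentially_bot])
  qed
  finally have le: "(\<integral>\<^sup>+x. ennreal ((w x - \<psi> x)^6) \<partial>M) \<le> ennreal (sob * D' ^ 3)" .
  then have "(\<integral>\<^sup>+x. ennreal ((w x - \<psi> x)^6) \<partial>M) < \<infinity>"
    by (rule order_le_less_trans) simp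
  then have I: "integrable M (\<lambda>x. (w x - \<psi> x)^6)"
    by (intro integrableI_nonneg) auto
  then show "memL M 6 (\<lambda>x. w x - \<psi> x)"
    by (simp add: memL_def power_even_abs)
  have "ennreal (integ \<Omega> (\<lambda>x. (w x - \<psi> x)^6)) \<le> ennreal (sob * D' ^ 3)"
    using le I unfolding integ_def by (subst nn_integral_eq_integral[symmetric]) auto
  moreover have "0 \<le> D'" unfolding D'_def integ_def by (intro integral_nonneg_AE) (auto intro!: sum_nonneg)
  ultimately show "integ \<Omega> (\<lambda>x. (w x - \<psi> x)^6) \<le> sob * D'^3"
    using sob_pos by (simp add: ennreal_le_iff)
qed

lemma approx_by_memL6: "approx_by \<phi> w A \<Longrightarrow> memL M 6 w"
  using approx_by_Sobolev(1)[OF _ test_fun_zero] by fastforce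

lemma approx_by_tendsto_6:
  assumes ap: "approx_by \<phi> w A"
  shows "(\<lambda>k. normL M 6 (\<lambda>x. \<phi> k x - w x)) \<longlonglongrightarrow> 0"
proof (rule normL_tendsto_0)
  have mA: "memL M 2 (\<lambda>x. A x $ j)" for j
    using ap by (auto simp: approx_by_def intro: is_wgrad_memL)
  have int: "integrable M (\<lambda>x. (A x $ j - pd (\<phi> k) j x)\<^sup>2)" for j k
    using memL_diff[OF mA memL_test_fun[OF test_fun_pd[OF approx_by_test[OF ap]]]] by (simp add: memL_def)
  have "(\<lambda>k. \<Sum>j\<in>UNIV. integ \<Omega> (\<lambda>x. (A x $ j - pd (\<phi> k) j x)\<^sup>2)) \<longlonglongrightarrow> (\<Sum>j\<in>(UNIV::'d set). 0)"
    using ap by (intro tendsto_sum) (simp add: approx_by_def)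
  then have "(\<lambda>k. integ \<Omega> (\<lambda>x. \<Sum>j\<in>UNIV. (A x $ j - pd (\<phi> k) j x)\<^sup>2)) \<longlonglongrightarrow> 0"
    by (simp add: integ_def Bochner_Integration.integral_sum int)
  then have "(\<lambda>k. sob * (integ \<Omega> (\<lambda>x. \<Sum>j\<in>UNIV. (A x $ j - pd (\<phi> k) j x)\<^sup>2))^3) \<longlonglongrightarrow> sob * 0^3"
    by (intro tendsto_intros)
  then have "(\<lambda>k. sob * (integ \<Omega> (\<lambda>x. \<Sum>j\<in>UNIV. (A x $ j - pd (\<phi> k) j x)\<^sup>2))^3) \<longlonglongrightarrow> 0" by simp
  then have "(\<lambda>k. integ \<Omega> (\<lambda>x. (w x - \<phi> k x)^6)) \<longlonglongrightarrow> 0"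
  proof (rule Lim_null_comparison[rotated], intro always_eventually allI)
    fix k
    have "0 \<le> integ \<Omega> (\<lambda>x. (w x - \<phi> k x)^6)" by (auto simp: integ_def intro!: integral_nonneg_AE)
    then show "norm (integ \<Omega> (\<lambda>x. (w x - \<phi> k x)^6))
        \<le> sob * (integ \<Omega> (\<lambda>x. \<Sum>j\<in>UNIV. (A x $ j - pd (\<phi> k) j x)\<^sup>2))^3"
      using approx_by_Sobolev(2)[OF ap approx_by_test[OF ap, of k]] by simp
  qed
  moreover have "\<bar>\<phi> k x - w x\<bar>^6 = (w x - \<phi> k x)^6" for k x
    by (metis abs_minus_commute even_numeral power_even_abs)
  ultimately show "(\<lambda>k. \<integral>x. \<bar>\<phi> k x - w x\<bar>^6 \<partial>M) \<longlonglongrightarrow> 0"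
    by (simp add: integ_def)
qed

lemma approx_by_tendsto_3:
  assumes ap: "approx_by \<phi> w A"
  shows "(\<lambda>k. normL M 3 (\<lambda>x. \<phi> k x - w x)) \<longlonglongrightarrow> 0"
  by (rule M.normL_3_tendsto_0[OF _ approx_by_tendsto_6[OF ap]])
     (intro memL_diff memL_test_fun approx_by_test[OF ap] approx_by_memL6[OF ap])

text \<open>\<open>A\<close> and \<open>G\<close> have equal integrals against every test function,
  in particular against the derivatives of the approximating ones. Those converge to
  \<open>A\<close>, so A - G is orthogonal to A, and Pythagoras gives the inequality.\<close>

lemma approx_by_grad_minimal:
  assumes ap: "approx_by \<phi> w A" and G: "is_wgrad \<Omega> w G"
  shows "integ \<Omega> (\<lambda>x. (A x $ j)\<^sup>2) \<le> integ \<Omega> (\<lambda>x. (G x $ j)\<^sup>2)"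
proof -
  have A: "is_wgrad \<Omega> w A" using ap by (simp add: approx_by_def)
  note m = is_wgrad_memL[OF A, of j] is_wgrad_memL[OF G, of j]
  have p: "memL M 2 (pd (\<phi> k) j)" for k
    by (intro memL_test_fun test_fun_pd approx_by_test[OF ap])
  have "(\<integral>x. (A x $ j - G x $ j) * pd (\<phi> k) j x \<partial>M) = 0" for k
  proof -
    have "test_fun \<Omega> (pd (\<phi> k) j)" by (intro test_fun_pd approx_by_test[OF ap])
    then have "integ \<Omega> (\<lambda>x. w x * pd (pd (\<phi> k) j) j x) = - integ \<Omega> (\<lambda>x. A x $ j * pd (\<phi> k) j x)"
        "integ \<Omega> (\<lambda>x. w x * pd (pd (\<phi> k) j) j x) = - integ \<Omega> (\<lambda>x. G x $ j * pd (\<phi> k) j x)"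
      using A G unfolding is_wgrad_def by blast+
    then have "(\<integral>x. A x $ j * pd (\<phi> k) j x \<partial>M) = (\<integral>x. G x $ j * pd (\<phi> k) j x \<partial>M)"
      by (simp add: integ_def)
    moreover have "(\<integral>x. (A x $ j - G x $ j) * pd (\<phi> k) j x \<partial>M)
        = (\<integral>x. A x $ j * pd (\<phi> k) j x \<partial>M) - (\<integral>x. G x $ j * pd (\<phi> k) j x \<partial>M)"
      unfolding left_diff_distrib by (intro Bochner_Integration.integral_diff memL_Cauchy_Schwarz(1) m p)
    ultimately show ?thesis by simp
  qed
  moreover have "(\<lambda>k. \<integral>x. (A x $ j - G x $ j) * pd (\<phi> k) j x \<partial>M) \<longlonglongrightarrow> (\<integral>x. (A x $ j - G x $ j) * (A x $ j) \<partial>M)"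
    using approx_by_pd_tendsto[OF ap, of j]
    by (intro memL_2_tendsto memL_diff m p) (simp_all add: normL_def)
  ultimately have "(\<integral>x. (A x $ j - G x $ j) * (A x $ j) \<partial>M) = 0"
    by (simp add: LIMSEQ_const_iff)
  moreover have "(\<integral>x. (G x $ j)\<^sup>2 \<partial>M) - (\<integral>x. (A x $ j)\<^sup>2 \<partial>M)
      = (\<integral>x. (A x $ j - G x $ j)\<^sup>2 - 2 * ((A x $ j - G x $ j) * (A x $ j)) \<partial>M)"
    using m by (subst Bochner_Integration.integral_diff[symmetric])
      (auto simp: memL_def power2_eq_square algebra_simps intro!: Bochner_Integration.integral_cong)
  moreover have "\<dots> = (\<integral>x. (A x $ j - G x $ j)\<^sup>2 \<partial>M) - 2 * (\<integral>x. (A x $ j - G x $ j) * (A x $ j) \<partial>M)"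
  proof (subst Bochner_Integration.integral_diff)
    show "integrable M (\<lambda>x. (A x $ j - G x $ j)\<^sup>2)" using memL_diff[OF m] by (simp add: memL_def)
    show "integrable M (\<lambda>x. 2 * ((A x $ j - G x $ j) * (A x $ j)))"
      using memL_Cauchy_Schwarz(1)[OF memL_diff[OF m] m(1)] by simp
  qed simp
  moreover have "0 \<le> (\<integral>x. (A x $ j - G x $ j)\<^sup>2 \<partial>M)" by (intro integral_nonneg_AE) auto
  ultimately show ?thesis unfolding integ_def by linarith
qed

lemma H10s_memL6: "H10s \<Omega> w \<Longrightarrow> memL M 6 w"
  using approx_by_memL6 by (auto simp: H10s_iff)

lemma H10s_memL3: "H10s \<Omega> w \<Longrightarrow> memL M 3 w"
  using M.memL_6_imp_3(1) H10s_memL6 by blast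

lemma H10s_memL2: "H10s \<Omega> w \<Longrightarrow> memL M 2 w"
  by (auto simp: H10s_def L2_iff_memL)

lemma is_wgrad_wgrad:
  assumes "H10s \<Omega> w"
  shows "is_wgrad \<Omega> w (wgrad \<Omega> w)"
proof -
  have "\<exists>G. is_wgrad \<Omega> w G" using assms unfolding H10s_def by blast
  then show ?thesis unfolding wgrad_def by (rule someI_ex)
qed

text \<open>\<open>G\<close> may be any weak gradient, hence the one picked by \<open>wgrad\<close>;
  the inequality proved for the approximable gradient carries over by minimality.\<close>

lemma H10s_Sobolev:
  assumes "H10s \<Omega> w" "is_wgrad \<Omega> w G"
  shows "integ \<Omega> (\<lambda>x. (w x)^6) \<le> sob * (\<Sum>j\<in>UNIV. integ \<Omega> (\<lambda>x. (G x $ j)\<^sup>2))^3"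
proof -
  obtain \<phi> A where ap: "approx_by \<phi> w A" using assms by (auto simp: H10s_iff)
  have mA: "memL M 2 (\<lambda>x. A x $ j)" for j
    using ap by (auto simp: approx_by_def intro: is_wgrad_memL)
  have nn: "0 \<le> integ \<Omega> (\<lambda>x. (A x $ j)\<^sup>2)" for j
    by (auto simp: integ_def intro!: integral_nonneg_AE)
  have "pd (\<lambda>x. 0) j x = 0" for j :: 'd and x by (simp add: pd_def)
  then have "integ \<Omega> (\<lambda>x. (w x)^6) \<le> sob * (integ \<Omega> (\<lambda>x. \<Sum>j\<in>UNIV. (A x $ j)\<^sup>2))^3"
    using approx_by_Sobolev(2)[OF ap test_fun_zero] by simp
  also have "integ \<Omega> (\<lambda>x. \<Sum>j\<in>UNIV. (A x $ j)\<^sup>2) = (\<Sum>j\<in>UNIV. integ \<Omega> (\<lambda>x. (A x $ j)\<^sup>2))"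
    using mA by (simp add: integ_def memL_def Bochner_Integration.integral_sum)
  also have "sob * \<dots>^3 \<le> sob * (\<Sum>j\<in>UNIV. integ \<Omega> (\<lambda>x. (G x $ j)\<^sup>2))^3"
    using sob_pos assms(2) nn
    by (intro mult_left_mono power_mono sum_mono approx_by_grad_minimal[OF ap] sum_nonneg) auto
  finally show ?thesis .
qed

section \<open>Integration by parts for products of three H^1_0 functions\<close>

text \<open>The product of the approximants of \<open>a\<close> and \<open>b\<close> is a test
  function for the weak gradient of \<open>c\<close>. Its derivative is expanded by the product
  rule, and in each resulting triple the factors converge in L^2, L^3 and L^6.\<close>

lemma wgrad_product_approx:
  assumes a: "approx_by \<phi> a A" and b: "approx_by \<psi> b B"
    and c: "H10s \<Omega> c" "is_wgrad \<Omega> c G"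
  shows "(\<integral>x. A x $ j * b x * c x \<partial>M) + (\<integral>x. B x $ j * a x * c x \<partial>M) = - (\<integral>x. G x $ j * a x * b x \<partial>M)"
proof -
  have A: "is_wgrad \<Omega> a A" and B: "is_wgrad \<Omega> b B" using a b by (simp_all add: approx_by_def)
  have Ha: "H10s \<Omega> a" and Hb: "H10s \<Omega> b" using a b by (auto simp: H10s_iff)
  note t = approx_by_test[OF a] approx_by_test[OF b]
  note m = is_wgrad_memL[OF A] is_wgrad_memL[OF B] is_wgrad_memL[OF c(2)] H10s_memL6 H10s_memL3
    memL_test_fun t test_fun_pd Ha Hb c(1)
  note lim = approx_by_pd_tendsto[OF a] approx_by_pd_tendsto[OF b] approx_by_tendsto_3[OF a]
    approx_by_tendsto_3[OF b] approx_by_tendsto_6[OF a] approx_by_tendsto_6[OF b]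
  have const2: "(\<lambda>k. normL M 2 (\<lambda>x. f x - f x)) \<longlonglongrightarrow> 0"
    and const6: "(\<lambda>k. normL M 6 (\<lambda>x. f x - f x)) \<longlonglongrightarrow> 0" for f
    by (simp_all add: normL_def)
  have eq: "(\<integral>x. pd (\<phi> k) j x * \<psi> k x * c x \<partial>M) + (\<integral>x. pd (\<psi> k) j x * \<phi> k x * c x \<partial>M)
      = - (\<integral>x. G x $ j * \<phi> k x * \<psi> k x \<partial>M)" for k
  proof -
    have pd: "pd (\<lambda>x. \<phi> k x * \<psi> k x) j x = pd (\<phi> k) j x * \<psi> k x + \<phi> k x * pd (\<psi> k) j x" for x
      by (intro pd_mult smooth_fun_differentiable test_fun_smooth[OF t(1)] test_fun_smooth[OF t(2)])
    have "(\<integral>x. c x * pd (\<lambda>x. \<phi> k x * \<psi> k x) j x \<partial>M) = - (\<integral>x. G x $ j * (\<phi> k x * \<psi> k x) \<partial>M)"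
      using c(2) test_fun_mult[OF t(1)[of k] t(2)[of k]] unfolding is_wgrad_def integ_def by blast
    then have "(\<integral>x. c x * (pd (\<phi> k) j x * \<psi> k x + \<phi> k x * pd (\<psi> k) j x) \<partial>M)
        = - (\<integral>x. G x $ j * (\<phi> k x * \<psi> k x) \<partial>M)"
      unfolding pd .
    moreover have "(\<integral>x. c x * (pd (\<phi> k) j x * \<psi> k x + \<phi> k x * pd (\<psi> k) j x) \<partial>M)
        = (\<integral>x. pd (\<phi> k) j x * \<psi> k x * c x + pd (\<psi> k) j x * \<phi> k x * c x \<partial>M)"
      by (intro Bochner_Integration.integral_cong) (auto simp: algebra_simps)
    moreover have "\<dots> = (\<integral>x. pd (\<phi> k) j x * \<psi> k x * c x \<partial>M) + (\<integral>x. pd (\<psi> k) j x * \<phi> k x * c x \<partial>M)"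
      by (intro Bochner_Integration.integral_add memL_Holder_236(1) m)
    ultimately show ?thesis by (simp add: mult.assoc)
  qed
  have "(\<lambda>k. (\<integral>x. pd (\<phi> k) j x * \<psi> k x * c x \<partial>M) + (\<integral>x. pd (\<psi> k) j x * \<phi> k x * c x \<partial>M))
      \<longlonglongrightarrow> (\<integral>x. A x $ j * b x * c x \<partial>M) + (\<integral>x. B x $ j * a x * c x \<partial>M)"
    by (intro tendsto_add memL_236_tendsto lim const6 m)
  moreover have "(\<lambda>k. - (\<integral>x. G x $ j * \<phi> k x * \<psi> k x \<partial>M)) \<longlonglongrightarrow> - (\<integral>x. G x $ j * a x * b x \<partial>M)"
    by (intro tendsto_minus memL_236_tendsto lim const2 m)
  ultimately show ?thesis
    unfolding eq by (rule LIMSEQ_unique)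
qed

text \<open>The left side of \<open>wgrad_product_approx\<close> does not mention the gradient of
  \<open>c\<close>, so the right side takes the same value for every choice of it.\<close>

lemma wgrad_product_indep:
  assumes "H10s \<Omega> a" "H10s \<Omega> b" "H10s \<Omega> c" "is_wgrad \<Omega> c G" "is_wgrad \<Omega> c G'"
  shows "(\<integral>x. G x $ j * a x * b x \<partial>M) = (\<integral>x. G' x $ j * a x * b x \<partial>M)"
proof -
  obtain \<phi> A \<psi> B where "approx_by \<phi> a A" "approx_by \<psi> b B"
    using assms by (auto simp: H10s_iff)
  from wgrad_product_approx[OF this assms(3,4), of j] wgrad_product_approx[OF this assms(3,5), of j]
  show ?thesis by simp
qed

text \<open>After integration by parts \<open>c\<close> enters undifferentiated, and there
  subtraction is pointwise. This replaces linearity of the chosen gradients.\<close>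

lemma wgrad_product_diff:
  assumes H: "H10s \<Omega> a" "H10s \<Omega> b" "H10s \<Omega> c" "H10s \<Omega> d" "H10s \<Omega> (\<lambda>x. c x - d x)"
    and G: "is_wgrad \<Omega> c G" "is_wgrad \<Omega> d G'" "is_wgrad \<Omega> (\<lambda>x. c x - d x) G''"
  shows "(\<integral>x. G'' x $ j * a x * b x \<partial>M) = (\<integral>x. G x $ j * a x * b x \<partial>M) - (\<integral>x. G' x $ j * a x * b x \<partial>M)"
proof -
  obtain \<phi> A \<psi> B where ap: "approx_by \<phi> a A" "approx_by \<psi> b B"
    using assms by (auto simp: H10s_iff)
  have A: "is_wgrad \<Omega> a A" and B: "is_wgrad \<Omega> b B" using ap by (simp_all add: approx_by_def)
  note i = memL_Holder_236(1) is_wgrad_memL[OF A] is_wgrad_memL[OF B] H10s_memL6 H10s_memL3 H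
  have "(\<integral>x. A x $ j * b x * (c x - d x) \<partial>M) = (\<integral>x. A x $ j * b x * c x \<partial>M) - (\<integral>x. A x $ j * b x * d x \<partial>M)"
    unfolding right_diff_distrib by (intro Bochner_Integration.integral_diff i)
  moreover have "(\<integral>x. B x $ j * a x * (c x - d x) \<partial>M) = (\<integral>x. B x $ j * a x * c x \<partial>M) - (\<integral>x. B x $ j * a x * d x \<partial>M)"
    unfolding right_diff_distrib by (intro Bochner_Integration.integral_diff i)
  ultimately show ?thesis
    using wgrad_product_approx[OF ap H(3) G(1), of j] wgrad_product_approx[OF ap H(4) G(2), of j]
      wgrad_product_approx[OF ap H(5) G(3), of j] by simp
qed

text \<open>\<open>wgrad_product_approx\<close> is tied to the approximable gradients of
  \<open>a\<close> and \<open>b\<close>; \<open>wgrad_product_indep\<close> exchanges them for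
  arbitrary ones.\<close>

lemma wgrad_product_rule:
  assumes H: "H10s \<Omega> a" "H10s \<Omega> b" "H10s \<Omega> c"
    and G: "is_wgrad \<Omega> a Ga" "is_wgrad \<Omega> b Gb" "is_wgrad \<Omega> c Gc"
  shows "(\<integral>x. Ga x $ j * b x * c x \<partial>M) + (\<integral>x. Gb x $ j * a x * c x \<partial>M) + (\<integral>x. Gc x $ j * a x * b x \<partial>M) = 0"
proof -
  obtain \<phi> A \<psi> B where ap: "approx_by \<phi> a A" "approx_by \<psi> b B"
    using assms by (auto simp: H10s_iff)
  have A: "is_wgrad \<Omega> a A" and B: "is_wgrad \<Omega> b B" using ap by (simp_all add: approx_by_def)
  show ?thesis
    using wgrad_product_approx[OF ap H(3) G(3), of j] wgrad_product_indep[OF H(2,3,1) G(1) A, of j]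
      wgrad_product_indep[OF H(1,3,2) G(2) B, of j] by simp
qed

end

subsection \<open>Vector fields\<close>

lemma memL_mono:
  assumes "memL M n g" "f \<in> borel_measurable M" "\<And>x. \<bar>f x\<bar> \<le> \<bar>g x\<bar>"
  shows "memL M n f"
proof -
  have [measurable]: "f \<in> borel_measurable M" by fact
  have "integrable M (\<lambda>x. \<bar>f x\<bar>^n)"
    by (rule Bochner_Integration.integrable_bound[of M "\<lambda>x. \<bar>g x\<bar>^n"])
       (use assms in \<open>auto simp: memL_def intro!: power_mono\<close>)
  with assms show ?thesis by (simp add: memL_def)
qed

lemma memL_abs: "memL M n f \<Longrightarrow> memL M n (\<lambda>x. \<bar>f x\<bar>)"
  by (auto simp: memL_def)

lemma memL_sum:
  assumes "finite S" "S \<noteq> {}" "\<And>i. i \<in> S \<Longrightarrow> memL M n (f i)"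
  shows "memL M n (\<lambda>x. \<Sum>i\<in>S. f i x)"
  using assms
proof (induction rule: finite_ne_induct)
  case (insert i S)
  then show ?case using memL_lincomb[of M n "f i" "\<lambda>x. \<Sum>i\<in>S. f i x" 1 1] by simp
qed simp

lemma memL_norm_vec:
  fixes v :: "'a \<Rightarrow> real^'d::finite"
  assumes "\<And>i. memL M n (\<lambda>x. v x $ i)"
  shows "memL M n (\<lambda>x. norm (v x))"
proof (rule memL_mono)
  show "memL M n (\<lambda>x. \<Sum>i\<in>UNIV. \<bar>v x $ i\<bar>)"
    by (intro memL_sum memL_abs assms) auto
  have [measurable]: "(\<lambda>x. v x $ i) \<in> borel_measurable M" for i
    using assms by (rule memL_measurable)
  have "(\<lambda>x. sqrt (\<Sum>i\<in>UNIV. (v x $ i)\<^sup>2)) \<in> borel_measurable M" by measurable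
  then show "(\<lambda>x. norm (v x)) \<in> borel_measurable M"
    by (simp add: norm_vec_def L2_set_def)
  show "\<bar>norm (v x)\<bar> \<le> \<bar>\<Sum>i\<in>UNIV. \<bar>v x $ i\<bar>\<bar>" for x
    using norm_le_l1_cart[of "v x"] by (simp add: abs_of_nonneg sum_nonneg)
qed

lemma lpn_eq_normL:
  assumes "0 < n"
  shows "lpn \<Omega> (real n) v = normL (lebesgue_on \<Omega>) n (\<lambda>x. norm (v x))"
proof -
  have root: "I powr (1 / real n) = root n I" if "0 \<le> I" for I
    using assms that by (cases "I = 0") (simp_all add: root_powr_inverse)
  have "norm (v x) powr real n = \<bar>norm (v x)\<bar>^n" for x
    using assms by (simp add: powr_realpow')
  then have "lpn \<Omega> (real n) v = (\<integral>x. \<bar>norm (v x)\<bar>^n \<partial>lebesgue_on \<Omega>) powr (1 / real n)"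
    by (simp add: lpn_def integ_def)
  moreover have "0 \<le> (\<integral>x. \<bar>norm (v x)\<bar>^n \<partial>lebesgue_on \<Omega>)"
    by (intro integral_nonneg_AE) auto
  ultimately show ?thesis
    unfolding normL_def using root by simp
qed

lemma nv_eq_normL: "nv \<Omega> v = normL (lebesgue_on \<Omega>) 2 (\<lambda>x. norm (v x))"
  unfolding nv_def ipv_def normL_def integ_def by (simp add: sqrt_def dot_square_norm)

lemma ns_eq_normL: "ns \<Omega> q = normL (lebesgue_on \<Omega>) 2 q"
  unfolding ns_def ips_def normL_def integ_def by (simp add: sqrt_def power2_eq_square)

lemma norm_matrix_square:
  fixes A :: "real^'n::finite^'m::finite"
  shows "(norm A)\<^sup>2 = (\<Sum>i\<in>UNIV. \<Sum>j\<in>UNIV. (A $ i $ j)\<^sup>2)"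
  by (simp add: norm_vec_def L2_set_def sum_nonneg)

lemma gnorm_eq_normL: "gnorm \<Omega> v = normL (lebesgue_on \<Omega>) 2 (\<lambda>x. norm (vgrad \<Omega> v x))"
  unfolding gnorm_def gip_def normL_def integ_def
  by (simp add: sqrt_def norm_matrix_square power2_eq_square[symmetric])

lemma abs_bilinear_le:
  fixes A :: "real^'n::finite^'m::finite"
  shows "\<bar>\<Sum>i\<in>UNIV. \<Sum>j\<in>UNIV. u $ j * A $ i $ j * w $ i\<bar> \<le> norm A * norm u * norm w"
proof -
  have "\<bar>\<Sum>i\<in>UNIV. \<Sum>j\<in>UNIV. u $ j * A $ i $ j * w $ i\<bar> = \<bar>\<Sum>i\<in>UNIV. w $ i * (A $ i \<bullet> u)\<bar>"
    by (simp add: inner_vec_def sum_distrib_left mult_ac)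
  also have "\<dots> \<le> (\<Sum>i\<in>UNIV. \<bar>w $ i\<bar> * (norm (A $ i) * norm u))"
    by (intro order_trans[OF sum_abs] sum_mono) (auto simp: abs_mult intro!: mult_left_mono Cauchy_Schwarz_ineq2)
  also have "\<dots> = norm u * (\<Sum>i\<in>UNIV. \<bar>norm (A $ i)\<bar> * \<bar>w $ i\<bar>)"
    by (simp add: sum_distrib_left mult_ac)
  also have "\<dots> \<le> norm u * (L2_set (\<lambda>i. norm (A $ i)) UNIV * L2_set (\<lambda>i. w $ i) UNIV)"
    by (intro mult_left_mono L2_set_mult_ineq) auto
  also have "\<dots> = norm A * norm u * norm w"
    by (simp add: norm_vec_def L2_set_def)
  finally show ?thesis .
qed

context bounded_domain
begin

lemma H10_component: "v \<in> H10 \<Omega> \<Longrightarrow> H10s \<Omega> (\<lambda>x. v x $ i)"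
  by (simp add: H10_def)

lemma H10_wgrad: "v \<in> H10 \<Omega> \<Longrightarrow> is_wgrad \<Omega> (\<lambda>x. v x $ i) (\<lambda>x. vgrad \<Omega> v x $ i)"
  using is_wgrad_wgrad[OF H10_component] by (simp add: vgrad_def)

lemma memL_vgrad: "v \<in> H10 \<Omega> \<Longrightarrow> memL M 2 (\<lambda>x. vgrad \<Omega> v x $ i $ j)"
  by (rule is_wgrad_memL[OF H10_wgrad])

lemma memL_norm_vgrad:
  assumes "v \<in> H10 \<Omega>"
  shows "memL M 2 (\<lambda>x. norm (vgrad \<Omega> v x))"
proof -
  have "memL M 2 (\<lambda>x. norm (\<chi> i. norm (vgrad \<Omega> v x $ i)))"
    by (rule memL_norm_vec) (simp add: memL_norm_vec memL_vgrad[OF assms])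
  then show ?thesis by (simp add: norm_vec_def)
qed

lemma memL_norm_H10:
  assumes "v \<in> H10 \<Omega>"
  shows "memL M 2 (\<lambda>x. norm (v x))" "memL M 3 (\<lambda>x. norm (v x))" "memL M 6 (\<lambda>x. norm (v x))"
  by (intro memL_norm_vec H10s_memL2 H10s_memL3 H10s_memL6 H10_component assms)+

lemma memL_vdiv: "v \<in> H10 \<Omega> \<Longrightarrow> memL M 2 (vdiv \<Omega> v)"
  unfolding vdiv_def by (intro memL_sum memL_vgrad) auto

text \<open>The sixth power of the Euclidean norm costs d^3 against the sum of the sixth powers of
  the components, and bounding the d components separately costs another factor d.\<close>

definition sobK :: real where
  "sobK = root 6 (real CARD('d) ^ 4 * sob)"

lemma sobK_pos: "0 < sobK"
  unfolding sobK_def using sob_pos by simp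

lemma gnorm_square_eq:
  assumes "v \<in> H10 \<Omega>"
  shows "(gnorm \<Omega> v)\<^sup>2 = (\<Sum>i\<in>UNIV. \<Sum>j\<in>UNIV. integ \<Omega> (\<lambda>x. (vgrad \<Omega> v x $ i $ j)\<^sup>2))"
  using memL_vgrad[OF assms]
  by (simp add: gnorm_eq_normL normL_power norm_matrix_square integ_def memL_def)

lemma H10_Sobolev:
  assumes v: "v \<in> H10 \<Omega>"
  shows "normL M 6 (\<lambda>x. norm (v x)) \<le> sobK * gnorm \<Omega> v"
proof (rule power_le_imp_le_base[where n=5])
  let ?d = "real CARD('d)"
  have int: "integrable M (\<lambda>x. (v x $ i)^6)" for i
    using H10s_memL6[OF H10_component[OF v]] by (simp add: memL_def power_even_abs)
  have "normL M 6 (\<lambda>x. norm (v x)) ^ 6 = (\<integral>x. norm (v x) ^ 6 \<partial>M)"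
    by (simp add: normL_power)
  also have "\<dots> \<le> (\<integral>x. ?d^3 * (\<Sum>i\<in>UNIV. (v x $ i)^6) \<partial>M)"
  proof (rule integral_mono)
    show "integrable M (\<lambda>x. norm (v x) ^ 6)"
      using memL_norm_H10(3)[OF v] by (simp add: memL_def)
    show "integrable M (\<lambda>x. ?d^3 * (\<Sum>i\<in>UNIV. (v x $ i)^6))"
      using int by simp
    fix x
    \<comment> \<open>The squared length is at most d times the largest squared component, whose
      cube is one of the summands on the right.\<close>
    define m where "m = Max (range (\<lambda>i. (v x $ i)\<^sup>2))"
    have "m \<in> range (\<lambda>i. (v x $ i)\<^sup>2)" unfolding m_def by (intro Max_in) auto
    then obtain k where k: "m = (v x $ k)\<^sup>2" by auto
    have "norm (v x) ^ 6 = ((norm (v x))\<^sup>2)^3" by simp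
    also have "(norm (v x))\<^sup>2 = (\<Sum>i\<in>UNIV. (v x $ i)\<^sup>2)"
      by (simp add: norm_vec_def L2_set_def sum_nonneg)
    also have "\<dots> ^ 3 \<le> (?d * m)^3"
      by (intro power_mono sum_bounded_above sum_nonneg) (auto simp: m_def)
    also have "\<dots> = ?d^3 * (v x $ k)^6" by (simp add: k power_mult_distrib)
    also have "\<dots> \<le> ?d^3 * (\<Sum>i\<in>UNIV. (v x $ i)^6)"
      by (intro mult_left_mono member_le_sum) auto
    finally show "norm (v x) ^ 6 \<le> ?d^3 * (\<Sum>i\<in>UNIV. (v x $ i)^6)" .
  qed
  also have "\<dots> = ?d^3 * (\<Sum>i\<in>UNIV. integ \<Omega> (\<lambda>x. (v x $ i)^6))"
    using int by (simp add: integ_def)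
  also have "\<dots> \<le> ?d^3 * (\<Sum>i\<in>(UNIV::'d set). sob * ((gnorm \<Omega> v)\<^sup>2)^3)"
  proof (intro mult_left_mono sum_mono)
    fix i
    have "integ \<Omega> (\<lambda>x. (v x $ i)^6) \<le> sob * (\<Sum>j\<in>UNIV. integ \<Omega> (\<lambda>x. (vgrad \<Omega> v x $ i $ j)\<^sup>2))^3"
      by (rule H10s_Sobolev[OF H10_component[OF v] H10_wgrad[OF v]])
    also have "\<dots> \<le> sob * ((gnorm \<Omega> v)\<^sup>2)^3"
      unfolding gnorm_square_eq[OF v] using sob_pos
      by (intro mult_left_mono power_mono member_le_sum[where f="\<lambda>i. \<Sum>j\<in>UNIV. integ \<Omega> (\<lambda>x. (vgrad \<Omega> v x $ i $ j)\<^sup>2)"])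
         (auto simp: integ_def intro!: sum_nonneg integral_nonneg_AE)
    finally show "integ \<Omega> (\<lambda>x. (v x $ i)^6) \<le> sob * ((gnorm \<Omega> v)\<^sup>2)^3" .
  qed simp
  also have "\<dots> = ?d^4 * sob * (gnorm \<Omega> v)^6"
    by (simp add: eval_nat_numeral flip: power_mult)
  also have "\<dots> = (sobK * gnorm \<Omega> v)^6"
    using sob_pos by (simp add: sobK_def power_mult_distrib)
  finally show "normL M 6 (\<lambda>x. norm (v x)) ^ Suc 5 \<le> (sobK * gnorm \<Omega> v) ^ Suc 5"
    by simp
  show "0 \<le> sobK * gnorm \<Omega> v"
    using sobK_pos by (simp add: gnorm_eq_normL normL_nonneg)
qed

text \<open>Hoelder for the product of |v|, 1 and |v|, followed by Sobolev. It serves to show that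
  the supremum in \<open>hm1\<close> is finite.\<close>

lemma H10_Poincare:
  assumes v: "v \<in> H10 \<Omega>"
  shows "nv \<Omega> v \<le> normL M 3 (\<lambda>x. 1) * sobK * gnorm \<Omega> v"
proof -
  let ?N = "normL M 2 (\<lambda>x. norm (v x))"
  have "?N\<^sup>2 = (\<integral>x. \<bar>norm (v x) * 1 * norm (v x)\<bar> \<partial>M)"
    by (simp add: normL_power flip: power2_eq_square)
  also have "\<dots> \<le> ?N * normL M 3 (\<lambda>x. 1) * normL M 6 (\<lambda>x. norm (v x))"
    by (intro memL_Holder_236(2) memL_norm_H10 v M.memL_const)
  finally have "?N * ?N \<le> ?N * (normL M 3 (\<lambda>x. 1) * normL M 6 (\<lambda>x. norm (v x)))"
    by (simp add: power2_eq_square mult_ac)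
  then have "?N \<le> normL M 3 (\<lambda>x. 1) * normL M 6 (\<lambda>x. norm (v x))"
    using normL_nonneg[of M 2 "\<lambda>x. norm (v x)"] by (cases "?N = 0") (auto simp: normL_nonneg)
  also have "\<dots> \<le> normL M 3 (\<lambda>x. 1) * (sobK * gnorm \<Omega> v)"
    by (intro mult_left_mono H10_Sobolev v normL_nonneg)
  finally show ?thesis by (simp add: nv_eq_normL mult.assoc)
qed

lemma ipv_le_nv:
  assumes "memL M 2 (\<lambda>x. norm (f x))" "memL M 2 (\<lambda>x. norm (v x))"
  shows "ipv \<Omega> f v \<le> nv \<Omega> f * nv \<Omega> v"
proof -
  have "ipv \<Omega> f v \<le> (\<integral>x. \<bar>norm (f x) * norm (v x)\<bar> \<partial>M)"
    unfolding ipv_def integ_def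
  proof (rule integral_mono')
    show "integrable M (\<lambda>x. \<bar>norm (f x) * norm (v x)\<bar>)"
      by (intro integrable_abs memL_Cauchy_Schwarz assms)
  qed (auto intro: norm_cauchy_schwarz)
  also have "\<dots> \<le> nv \<Omega> f * nv \<Omega> v"
    unfolding nv_eq_normL by (rule memL_Cauchy_Schwarz(2)[OF assms])
  finally show ?thesis .
qed

text \<open>\<open>hm1\<close> is a real \<open>Sup\<close>, which bounds its set from above only
  once that set is known to be bounded; Poincare's inequality provides this. It also settles the
  case of vanishing \<open>gnorm\<close>, which the quotients leave out.\<close>

lemma ipv_le_hm1:
  assumes f: "\<And>i. L2 \<Omega> (\<lambda>x. f x $ i)" and v: "v \<in> H10 \<Omega>"
  shows "ipv \<Omega> f v \<le> hm1 \<Omega> f * gnorm \<Omega> v"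
proof -
  define P where "P = normL M 3 (\<lambda>x. 1) * sobK"
  have mf: "memL M 2 (\<lambda>x. norm (f x))"
    using f by (intro memL_norm_vec) (simp add: L2_iff_memL)
  have le: "ipv \<Omega> f w \<le> nv \<Omega> f * P * gnorm \<Omega> w" if "w \<in> H10 \<Omega>" for w
  proof -
    have "ipv \<Omega> f w \<le> nv \<Omega> f * nv \<Omega> w"
      by (rule ipv_le_nv[OF mf memL_norm_H10(1)[OF that]])
    also have "\<dots> \<le> nv \<Omega> f * (P * gnorm \<Omega> w)"
      unfolding P_def by (intro mult_left_mono H10_Poincare that) (simp add: nv_eq_normL normL_nonneg)
    finally show ?thesis by (simp add: mult.assoc)
  qed
  have g0: "0 \<le> gnorm \<Omega> w" for w by (simp add: gnorm_eq_normL normL_nonneg)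
  show ?thesis
  proof (cases "gnorm \<Omega> v = 0")
    case True
    with le[OF v] show ?thesis by simp
  next
    case False
    have "ipv \<Omega> f v / gnorm \<Omega> v \<le> hm1 \<Omega> f"
      unfolding hm1_def
    proof (rule cSup_upper)
      show "ipv \<Omega> f v / gnorm \<Omega> v \<in> {ipv \<Omega> f v / gnorm \<Omega> v | v. v \<in> H10 \<Omega> \<and> gnorm \<Omega> v \<noteq> 0}"
        using v False by blast
      have "ipv \<Omega> f w / gnorm \<Omega> w \<le> nv \<Omega> f * P" if "w \<in> H10 \<Omega>" "gnorm \<Omega> w \<noteq> 0" for w
        using le[OF that(1)] that(2) g0[of w] by (simp add: divide_le_eq)
      then show "bdd_above {ipv \<Omega> f v / gnorm \<Omega> v | v. v \<in> H10 \<Omega> \<and> gnorm \<Omega> v \<noteq> 0}"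
        by (intro bdd_aboveI[of _ "nv \<Omega> f * P"]) auto
    qed
    then show ?thesis using False g0[of v] by (simp add: divide_le_eq)
  qed
qed

section \<open>The trilinear form and the convective term\<close>

lemma integrable_trilin:
  assumes "a \<in> H10 \<Omega>" "b \<in> H10 \<Omega>" "c \<in> H10 \<Omega>"
  shows "integrable M (\<lambda>x. a x $ k * vgrad \<Omega> b x $ i $ j * c x $ l)"
proof -
  have "integrable M (\<lambda>x. vgrad \<Omega> b x $ i $ j * a x $ k * c x $ l)"
    using assms by (intro memL_Holder_236(1) memL_vgrad H10s_memL3 H10s_memL6 H10_component)
  then show ?thesis by (simp add: mult_ac)
qed

lemma trilin_eq_sum:
  assumes "a \<in> H10 \<Omega>" "b \<in> H10 \<Omega>" "c \<in> H10 \<Omega>"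
  shows "trilin \<Omega> a b c = (\<Sum>i\<in>UNIV. \<Sum>j\<in>UNIV. \<integral>x. vgrad \<Omega> b x $ i $ j * a x $ j * c x $ i \<partial>M)"
  unfolding trilin_def integ_def using integrable_trilin[OF assms]
  by (simp add: mult_ac)

text \<open>The gradient takes the exponent 2. Which of the other two factors is measured in L^3 is
  a free choice; both choices occur, one for each time step condition.\<close>

lemma trilin_bound:
  assumes "a \<in> H10 \<Omega>" "b \<in> H10 \<Omega>" "c \<in> H10 \<Omega>"
  shows "\<bar>trilin \<Omega> a b c\<bar> \<le> gnorm \<Omega> b * normL M 3 (\<lambda>x. norm (a x)) * normL M 6 (\<lambda>x. norm (c x))"
    and "\<bar>trilin \<Omega> a b c\<bar> \<le> gnorm \<Omega> b * normL M 3 (\<lambda>x. norm (c x)) * normL M 6 (\<lambda>x. norm (a x))"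
proof -
  have le: "\<bar>trilin \<Omega> a b c\<bar> \<le> (\<integral>x. \<bar>norm (vgrad \<Omega> b x) * norm (a x) * norm (c x)\<bar> \<partial>M)"
    unfolding trilin_def integ_def
  proof (rule order_trans[OF integral_abs_bound integral_mono])
    show "integrable M (\<lambda>x. \<bar>\<Sum>i\<in>UNIV. \<Sum>j\<in>UNIV. a x $ j * vgrad \<Omega> b x $ i $ j * c x $ i\<bar>)"
      by (intro integrable_abs Bochner_Integration.integrable_sum integrable_trilin assms)
    show "integrable M (\<lambda>x. \<bar>norm (vgrad \<Omega> b x) * norm (a x) * norm (c x)\<bar>)"
      by (intro integrable_abs memL_Holder_236(1) memL_norm_vgrad memL_norm_H10 assms)
    show "\<bar>\<Sum>i\<in>UNIV. \<Sum>j\<in>UNIV. a x $ j * vgrad \<Omega> b x $ i $ j * c x $ i\<bar> \<le> \<bar>norm (vgrad \<Omega> b x) * norm (a x) * norm (c x)\<bar>" for x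
      using abs_bilinear_le[of "a x" "vgrad \<Omega> b x" "c x"] by (simp add: abs_mult)
  qed
  also have "\<dots> \<le> gnorm \<Omega> b * normL M 3 (\<lambda>x. norm (a x)) * normL M 6 (\<lambda>x. norm (c x))"
    unfolding gnorm_eq_normL by (intro memL_Holder_236(2) memL_norm_vgrad memL_norm_H10 assms)
  finally show "\<bar>trilin \<Omega> a b c\<bar> \<le> gnorm \<Omega> b * normL M 3 (\<lambda>x. norm (a x)) * normL M 6 (\<lambda>x. norm (c x))" .
  have "(\<integral>x. \<bar>norm (vgrad \<Omega> b x) * norm (a x) * norm (c x)\<bar> \<partial>M)
      = (\<integral>x. \<bar>norm (vgrad \<Omega> b x) * norm (c x) * norm (a x)\<bar> \<partial>M)"
    by (simp add: mult_ac)
  also have "\<dots> \<le> gnorm \<Omega> b * normL M 3 (\<lambda>x. norm (c x)) * normL M 6 (\<lambda>x. norm (a x))"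
    unfolding gnorm_eq_normL by (intro memL_Holder_236(2) memL_norm_vgrad memL_norm_H10 assms)
  finally show "\<bar>trilin \<Omega> a b c\<bar> \<le> gnorm \<Omega> b * normL M 3 (\<lambda>x. norm (c x)) * normL M 6 (\<lambda>x. norm (a x))"
    using le by linarith
qed

text \<open>\<open>wgrad_product_rule\<close> for the components \<open>j\<close> of
  \<open>e\<close> and \<open>i\<close> of \<open>w\<close> and \<open>u\<close>, in direction
  \<open>j\<close>, summed over both indices. \<open>e\<close> is not assumed divergence-free, and
  the remaining term is the source of the divergence in the second condition.\<close>

lemma trilin_integration_by_parts:
  assumes H: "e \<in> H10 \<Omega>" "w \<in> H10 \<Omega>" "u \<in> H10 \<Omega>"
  shows "trilin \<Omega> e w u + trilin \<Omega> e u w + integ \<Omega> (\<lambda>x. vdiv \<Omega> e x * (w x \<bullet> u x)) = 0"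
proof -
  have i: "integrable M (\<lambda>x. vgrad \<Omega> e x $ j $ j * w x $ i * u x $ i)" for i j
    using H by (intro memL_Holder_236(1) memL_vgrad H10s_memL3 H10s_memL6 H10_component)
  have "integ \<Omega> (\<lambda>x. vdiv \<Omega> e x * (w x \<bullet> u x))
      = (\<integral>x. (\<Sum>i\<in>UNIV. \<Sum>j\<in>UNIV. vgrad \<Omega> e x $ j $ j * w x $ i * u x $ i) \<partial>M)"
    unfolding integ_def vdiv_def
    by (simp add: inner_vec_def sum_distrib_left sum_distrib_right mult.assoc)
  also have "\<dots> = (\<Sum>i\<in>UNIV. \<Sum>j\<in>UNIV. \<integral>x. vgrad \<Omega> e x $ j $ j * w x $ i * u x $ i \<partial>M)"
    using i by simp
  finally have div: "integ \<Omega> (\<lambda>x. vdiv \<Omega> e x * (w x \<bullet> u x))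
      = (\<Sum>i\<in>UNIV. \<Sum>j\<in>UNIV. \<integral>x. vgrad \<Omega> e x $ j $ j * w x $ i * u x $ i \<partial>M)" .
  have "(\<integral>x. vgrad \<Omega> w x $ i $ j * e x $ j * u x $ i \<partial>M) + (\<integral>x. vgrad \<Omega> u x $ i $ j * e x $ j * w x $ i \<partial>M)
      + (\<integral>x. vgrad \<Omega> e x $ j $ j * w x $ i * u x $ i \<partial>M) = 0" for i j
    using wgrad_product_rule[OF H10_component[OF H(1), of j] H10_component[OF H(2), of i] H10_component[OF H(3), of i]
        H10_wgrad[OF H(1), of j] H10_wgrad[OF H(2), of i] H10_wgrad[OF H(3), of i], of j]
    by simp
  then show ?thesis
    using H by (simp add: trilin_eq_sum div flip: sum.distrib)
qed

text \<open>Here the difference sits under \<open>vgrad\<close>, so linearity comes from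
  \<open>wgrad_product_diff\<close> and holds only after integration.\<close>

lemma trilin_diff_middle:
  assumes H: "a \<in> H10 \<Omega>" "b \<in> H10 \<Omega>" "c \<in> H10 \<Omega>" "d \<in> H10 \<Omega>" "(\<lambda>x. b x - d x) \<in> H10 \<Omega>"
  shows "trilin \<Omega> a (\<lambda>x. b x - d x) c = trilin \<Omega> a b c - trilin \<Omega> a d c"
proof -
  have "(\<integral>x. vgrad \<Omega> (\<lambda>x. b x - d x) x $ i $ j * a x $ j * c x $ i \<partial>M)
      = (\<integral>x. vgrad \<Omega> b x $ i $ j * a x $ j * c x $ i \<partial>M) - (\<integral>x. vgrad \<Omega> d x $ i $ j * a x $ j * c x $ i \<partial>M)" for i j
    using wgrad_product_diff[OF H10_component[OF H(1), of j] H10_component[OF H(3), of i]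
        H10_component[OF H(2), of i] H10_component[OF H(4), of i] _ H10_wgrad[OF H(2)] H10_wgrad[OF H(4)], of _ j]
      H10_component[OF H(5), of i] H10_wgrad[OF H(5), of i] by simp
  then show ?thesis
    using H by (simp add: trilin_eq_sum sum_subtractf)
qed

lemma trilin_diff_right:
  assumes H: "a \<in> H10 \<Omega>" "b \<in> H10 \<Omega>" "c \<in> H10 \<Omega>" "d \<in> H10 \<Omega>"
  shows "trilin \<Omega> a b (\<lambda>x. c x - d x) = trilin \<Omega> a b c - trilin \<Omega> a b d"
  unfolding trilin_def integ_def
  using integrable_trilin[OF H(1,2,3)] integrable_trilin[OF H(1,2,4)]
  by (simp add: right_diff_distrib sum_subtractf)

text \<open>Since \<open>b\<^sup>*(e, e, e) = 0\<close>, the convective term only sees \<open>w = u - e\<close>.\<close>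

lemma bstar_extrapolation:
  assumes H: "e \<in> H10 \<Omega>" "u \<in> H10 \<Omega>" "w \<in> H10 \<Omega>" and e: "e = (\<lambda>x. u x - w x)"
  shows "bstar \<Omega> e e u = (trilin \<Omega> e u w - trilin \<Omega> e w u) / 2"
proof -
  have "trilin \<Omega> e e u = trilin \<Omega> e u u - trilin \<Omega> e w u"
    using trilin_diff_middle[of e u u w] H e by simp
  moreover have "trilin \<Omega> e u e = trilin \<Omega> e u u - trilin \<Omega> e u w"
    using trilin_diff_right[of e u u w] H e by simp
  ultimately show ?thesis by (simp add: bstar_def diff_divide_distrib)
qed

text \<open>\<open>e\<close> is measured in L^3 throughout. Where \<open>w\<close> is
  undifferentiated its L^6 norm is left to an inverse estimate; where its gradient occurs,
  \<open>u\<close> is placed in L^6 by Sobolev.\<close>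

lemma bstar_bound_3:
  assumes H: "e \<in> H10 \<Omega>" "u \<in> H10 \<Omega>" "w \<in> H10 \<Omega>" and e: "e = (\<lambda>x. u x - w x)"
  shows "\<bar>bstar \<Omega> e e u\<bar> \<le> lpn \<Omega> 3 e * gnorm \<Omega> u * (lpn \<Omega> 6 w + sobK * gnorm \<Omega> w) / 2"
proof -
  have l: "lpn \<Omega> 3 v = normL M 3 (\<lambda>x. norm (v x))" "lpn \<Omega> 6 v = normL M 6 (\<lambda>x. norm (v x))" for v
    using lpn_eq_normL[of 3] lpn_eq_normL[of 6] by simp_all
  have "\<bar>trilin \<Omega> e w u\<bar> \<le> gnorm \<Omega> w * lpn \<Omega> 3 e * normL M 6 (\<lambda>x. norm (u x))"
    unfolding l by (rule trilin_bound(1)[OF H(1,3,2)])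
  also have "\<dots> \<le> gnorm \<Omega> w * lpn \<Omega> 3 e * (sobK * gnorm \<Omega> u)"
    unfolding l by (intro mult_left_mono H10_Sobolev H mult_nonneg_nonneg) (simp_all add: gnorm_eq_normL normL_nonneg)
  finally have "\<bar>trilin \<Omega> e w u\<bar> \<le> gnorm \<Omega> w * lpn \<Omega> 3 e * (sobK * gnorm \<Omega> u)" .
  moreover have "\<bar>trilin \<Omega> e u w\<bar> \<le> gnorm \<Omega> u * lpn \<Omega> 3 e * lpn \<Omega> 6 w"
    unfolding l by (rule trilin_bound(1)[OF H(1,2,3)])
  ultimately have "\<bar>trilin \<Omega> e u w - trilin \<Omega> e w u\<bar> \<le> lpn \<Omega> 3 e * gnorm \<Omega> u * (lpn \<Omega> 6 w + sobK * gnorm \<Omega> w)"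
    by (simp add: algebra_simps)
  then show ?thesis unfolding bstar_extrapolation[OF assms] by simp
qed

text \<open>With the derivative off \<open>w\<close>, only the L^3 norm of \<open>w\<close> remains.
  Its inverse estimate costs h^(-1/2) instead of h^(-1), which is why the second condition has h
  where the first has h^2.\<close>

lemma bstar_bound_6:
  assumes H: "e \<in> H10 \<Omega>" "u \<in> H10 \<Omega>" "w \<in> H10 \<Omega>" and e: "e = (\<lambda>x. u x - w x)"
  shows "\<bar>bstar \<Omega> e e u\<bar> \<le> gnorm \<Omega> u * lpn \<Omega> 3 w * (lpn \<Omega> 6 e + sobK * ns \<Omega> (vdiv \<Omega> e))"
proof -
  have l: "lpn \<Omega> 3 v = normL M 3 (\<lambda>x. norm (v x))" "lpn \<Omega> 6 v = normL M 6 (\<lambda>x. norm (v x))" for v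
    using lpn_eq_normL[of 3] lpn_eq_normL[of 6] by simp_all
  let ?I = "integ \<Omega> (\<lambda>x. vdiv \<Omega> e x * (w x \<bullet> u x))"
  have m: "memL M 2 (vdiv \<Omega> e)" "memL M 3 (\<lambda>x. norm (w x))" "memL M 6 (\<lambda>x. norm (u x))"
    using H by (auto intro: memL_vdiv memL_norm_H10)
  have "\<bar>?I\<bar> \<le> (\<integral>x. \<bar>vdiv \<Omega> e x * (w x \<bullet> u x)\<bar> \<partial>M)"
    unfolding integ_def by (rule integral_abs_bound)
  also have "\<dots> \<le> (\<integral>x. \<bar>vdiv \<Omega> e x * norm (w x) * norm (u x)\<bar> \<partial>M)"
  proof (rule integral_mono')
    show "integrable M (\<lambda>x. \<bar>vdiv \<Omega> e x * norm (w x) * norm (u x)\<bar>)"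
      by (intro integrable_abs memL_Holder_236(1) m)
    show "\<bar>vdiv \<Omega> e x * (w x \<bullet> u x)\<bar> \<le> \<bar>vdiv \<Omega> e x * norm (w x) * norm (u x)\<bar>" for x
      using Cauchy_Schwarz_ineq2[of "w x" "u x"] by (simp add: abs_mult mult.assoc mult_left_mono)
  qed simp
  also have "\<dots> \<le> ns \<Omega> (vdiv \<Omega> e) * lpn \<Omega> 3 w * normL M 6 (\<lambda>x. norm (u x))"
    unfolding ns_eq_normL l by (intro memL_Holder_236(2) m)
  also have "\<dots> \<le> ns \<Omega> (vdiv \<Omega> e) * lpn \<Omega> 3 w * (sobK * gnorm \<Omega> u)"
    unfolding l by (intro mult_left_mono H10_Sobolev H mult_nonneg_nonneg) (simp_all add: ns_eq_normL normL_nonneg)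
  finally have I: "\<bar>?I\<bar> \<le> gnorm \<Omega> u * lpn \<Omega> 3 w * (sobK * ns \<Omega> (vdiv \<Omega> e))"
    by (simp add: mult_ac)
  have T: "\<bar>trilin \<Omega> e u w\<bar> \<le> gnorm \<Omega> u * lpn \<Omega> 3 w * lpn \<Omega> 6 e"
    unfolding l by (rule trilin_bound(2)[OF H(1,2,3)])
  have "trilin \<Omega> e w u = - trilin \<Omega> e u w - ?I"
    using trilin_integration_by_parts[OF H(1,3,2)] by simp
  then have "bstar \<Omega> e e u = trilin \<Omega> e u w + ?I / 2"
    unfolding bstar_extrapolation[OF assms] by (simp add: field_simps)
  then have "\<bar>bstar \<Omega> e e u\<bar> \<le> \<bar>trilin \<Omega> e u w\<bar> + \<bar>?I\<bar>" by linarith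
  also have "\<dots> \<le> gnorm \<Omega> u * lpn \<Omega> 3 w * lpn \<Omega> 6 e + gnorm \<Omega> u * lpn \<Omega> 3 w * (sobK * ns \<Omega> (vdiv \<Omega> e))"
    using T I by (rule add_mono)
  finally show ?thesis by (simp add: distrib_left)
qed

end

subsection \<open>Mesh size and inverse estimates\<close>

text \<open>Positivity comes from the inscribed balls of quasi-uniformity. The upper bound is what
  allows surplus powers of h to be replaced by a constant.\<close>

lemma mesh_size_bounds:
  fixes \<Omega> :: "(real^'d::finite) set"
  assumes T: "triangulation \<Omega> T" and q: "quasi_uniform \<sigma> T" and b: "bounded \<Omega>"
  shows "0 < mesh_size T" and "mesh_size T \<le> diameter (closure \<Omega>)"
proof -
  have fin: "finite (diameter ` T)" "diameter ` T \<noteq> {}"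
    using T by (auto simp: triangulation_def)
  have bc: "bounded (closure \<Omega>)" using b by (rule bounded_closure)
  have le: "diameter K \<le> diameter (closure \<Omega>)" if "K \<in> T" for K
    using T that bc by (intro diameter_subset) (auto simp: triangulation_def)
  then show "mesh_size T \<le> diameter (closure \<Omega>)"
    unfolding mesh_size_def using fin by (intro Max.boundedI) auto
  obtain K where K: "K \<in> T" using T by (auto simp: triangulation_def)
  then obtain z r where r: "r > 0" "ball z r \<subseteq> K" using q by (auto simp: quasi_uniform_def)
  have "K \<subseteq> closure \<Omega>" using T K by (auto simp: triangulation_def)
  then have "bounded K" using bc bounded_subset by blast
  have "0 < diameter (ball z r)" using r by simp
  also have "\<dots> \<le> diameter K" using r \<open>bounded K\<close> by (intro diameter_subset)
  also have "\<dots> \<le> mesh_size T" unfolding mesh_size_def using fin K by (intro Max_ge) auto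
  finally show "0 < mesh_size T" .
qed

text \<open>The surplus exponent e + s lies between 0 and 1, so the corresponding power of h is at
  most R.\<close>

lemma powr_le_mesh:
  fixes h R :: real
  assumes "0 < h" "h \<le> R" "1 \<le> R" "- s \<le> e" "e \<le> 1 - s"
  shows "h powr e \<le> R * h powr (- s)"
proof -
  have "h powr e = h powr (e + s) * h powr (- s)"
    by (simp flip: powr_add)
  also have "h powr (e + s) \<le> R powr (e + s)"
    using assms by (intro powr_mono2) auto
  also have "R powr (e + s) \<le> R powr 1"
    using assms by (intro powr_mono) auto
  finally show ?thesis using assms by (simp add: mult_right_mono)
qed

context bounded_domain
begin

text \<open>The summand 1 makes this bound for the mesh size at least 1, as
  \<open>powr_le_mesh\<close> demands.\<close>

definition radius :: real where "radius = 1 + diameter (closure \<Omega>)"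

lemma radius_ge_1: "1 \<le> radius"
  using bounded_closure[OF bounded_dom] by (simp add: radius_def diameter_ge_0)

text \<open>For d = 3 the scaling exponents of the L^6 and L^3 estimates are exactly -1 and -1/2.
  For d = 2 they are -2/3 and -1/3, and \<open>radius\<close> weakens them to the same form.
  \<open>max 1 Cinv\<close> guards against a nonpositive \<open>Cinv\<close>.\<close>

lemma inverse_estimates:
  assumes inv: "inverse_ineqs \<Omega> Xh h Cinv" and h: "0 < h" "h \<le> radius" and v: "v \<in> Xh"
  defines "C \<equiv> max 1 Cinv * radius"
  shows "gnorm \<Omega> v \<le> C / h * nv \<Omega> v"
    and "lpn \<Omega> 6 v \<le> C / h * nv \<Omega> v"
    and "lpn \<Omega> 3 v \<le> C / sqrt h * nv \<Omega> v"
proof -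
  let ?d = "real CARD('d)"
  have nv0: "0 \<le> nv \<Omega> v" by (simp add: nv_eq_normL normL_nonneg)
  have C: "Cinv \<le> max 1 Cinv" "max 1 Cinv \<le> C"
    using radius_ge_1 by (auto simp: C_def mult_le_cancel_left1)
  have nv2: "lpn \<Omega> 2 v = nv \<Omega> v"
    using lpn_eq_normL[of 2 \<Omega> v] by (simp add: nv_eq_normL)
  have "gnorm \<Omega> v \<le> Cinv / h * nv \<Omega> v"
    using inv v by (simp add: inverse_ineqs_def)
  also have "\<dots> \<le> C / h * nv \<Omega> v"
    using C h nv0 by (intro mult_right_mono divide_right_mono) auto
  finally show "gnorm \<Omega> v \<le> C / h * nv \<Omega> v" .
  have I: "lpn \<Omega> p v \<le> Cinv * h powr (?d / p - ?d / 2) * nv \<Omega> v" if "2 \<le> p" "p \<le> 6" for p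
    using inv v that by (auto simp: inverse_ineqs_def nv2[symmetric])
  have J: "lpn \<Omega> p v \<le> C * h powr (- s) * nv \<Omega> v"
    if "2 \<le> p" "p \<le> 6" "- s \<le> ?d / p - ?d / 2" "?d / p - ?d / 2 \<le> 1 - s" for p s
  proof -
    have "Cinv * h powr (?d / p - ?d / 2) \<le> max 1 Cinv * (radius * h powr (- s))"
      using that h radius_ge_1 by (intro mult_mono powr_le_mesh) auto
    then have "Cinv * h powr (?d / p - ?d / 2) * nv \<Omega> v \<le> C * h powr (- s) * nv \<Omega> v"
      using nv0 by (intro mult_right_mono) (auto simp: C_def)
    with I[OF that(1,2)] show ?thesis by linarith
  qed
  have "lpn \<Omega> 6 v \<le> C * h powr (- 1) * nv \<Omega> v"
    using dim by (intro J) auto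
  then show "lpn \<Omega> 6 v \<le> C / h * nv \<Omega> v"
    using h by (simp add: powr_minus_divide)
  have "lpn \<Omega> 3 v \<le> C * h powr (- (1/2)) * nv \<Omega> v"
    using dim by (intro J) auto
  then show "lpn \<Omega> 3 v \<le> C / sqrt h * nv \<Omega> v"
    using h by (simp add: powr_minus_divide powr_half_sqrt)
qed

text \<open>Brings both convective bounds into the common form of a factor times
  \<open>gnorm \<Omega> u * nv \<Omega> w\<close>, so that the two time step conditions can be
  treated alike.\<close>

lemma bstar_bounds_discrete:
  assumes inv: "inverse_ineqs \<Omega> Xh h Cinv" and h: "0 < h" "h \<le> radius" and X: "Xh \<subseteq> H10 \<Omega>"
    and m: "e \<in> Xh" "u \<in> Xh" "w \<in> Xh" and e: "e = (\<lambda>x. u x - w x)"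
  defines "C \<equiv> max 1 Cinv * radius * (1 + sobK)"
  shows "\<bar>bstar \<Omega> e e u\<bar> \<le> C * lpn \<Omega> 3 e / h * gnorm \<Omega> u * nv \<Omega> w"
    and "\<bar>bstar \<Omega> e e u\<bar> \<le> C * (lpn \<Omega> 6 e + ns \<Omega> (vdiv \<Omega> e)) / sqrt h * gnorm \<Omega> u * nv \<Omega> w"
proof -
  define B where "B = max 1 Cinv * radius"
  have B: "0 < B" "C = B * (1 + sobK)"
    using radius_ge_1 by (auto simp: B_def C_def)
  have H: "e \<in> H10 \<Omega>" "u \<in> H10 \<Omega>" "w \<in> H10 \<Omega>" using m X by auto
  note est = inverse_estimates[OF inv h m(3), folded B_def]
  have l: "0 \<le> lpn \<Omega> p v" for p v by (simp add: lpn_def)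
  have g: "0 \<le> gnorm \<Omega> v" "0 \<le> nv \<Omega> v" "0 \<le> ns \<Omega> q" for v q
    by (simp_all add: gnorm_eq_normL nv_eq_normL ns_eq_normL normL_nonneg)
  have "\<bar>bstar \<Omega> e e u\<bar> \<le> lpn \<Omega> 3 e * gnorm \<Omega> u * (lpn \<Omega> 6 w + sobK * gnorm \<Omega> w) / 2"
    by (rule bstar_bound_3[OF H e])
  also have "\<dots> \<le> lpn \<Omega> 3 e * gnorm \<Omega> u * (lpn \<Omega> 6 w + sobK * gnorm \<Omega> w)"
    using l g sobK_pos by (simp add: mult_nonneg_nonneg add_nonneg_nonneg)
  also have "\<dots> \<le> lpn \<Omega> 3 e * gnorm \<Omega> u * (B / h * nv \<Omega> w + sobK * (B / h * nv \<Omega> w))"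
    using l g sobK_pos est by (intro mult_left_mono add_mono mult_nonneg_nonneg) auto
  also have "\<dots> = C * lpn \<Omega> 3 e / h * gnorm \<Omega> u * nv \<Omega> w"
    using h by (simp add: B field_simps)
  finally show "\<bar>bstar \<Omega> e e u\<bar> \<le> C * lpn \<Omega> 3 e / h * gnorm \<Omega> u * nv \<Omega> w" .
  have "\<bar>bstar \<Omega> e e u\<bar> \<le> gnorm \<Omega> u * lpn \<Omega> 3 w * (lpn \<Omega> 6 e + sobK * ns \<Omega> (vdiv \<Omega> e))"
    by (rule bstar_bound_6[OF H e])
  also have "\<dots> \<le> gnorm \<Omega> u * (B / sqrt h * nv \<Omega> w) * ((1 + sobK) * (lpn \<Omega> 6 e + ns \<Omega> (vdiv \<Omega> e)))"
  proof (intro mult_mono est mult_nonneg_nonneg g l)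
    show "lpn \<Omega> 6 e + sobK * ns \<Omega> (vdiv \<Omega> e) \<le> (1 + sobK) * (lpn \<Omega> 6 e + ns \<Omega> (vdiv \<Omega> e))"
      using sobK_pos l[of 6 e] g(3)[of "vdiv \<Omega> e"] by (simp add: algebra_simps)
  qed (use l g sobK_pos B h in \<open>auto intro!: add_nonneg_nonneg mult_nonneg_nonneg\<close>)
  also have "\<dots> = C * (lpn \<Omega> 6 e + ns \<Omega> (vdiv \<Omega> e)) / sqrt h * gnorm \<Omega> u * nv \<Omega> w"
    using h by (simp add: B mult_ac)
  finally show "\<bar>bstar \<Omega> e e u\<bar> \<le> C * (lpn \<Omega> 6 e + ns \<Omega> (vdiv \<Omega> e)) / sqrt h * gnorm \<Omega> u * nv \<Omega> w" .
qed

end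

subsection \<open>The energy estimate\<close>

text \<open>The parallelogram law: half of the numerical dissipation telescopes; the other half
  controls both \<open>a - \<omega> b\<close>, which absorbs the convective term, and \<open>a + \<omega> b\<close>, which is
  kept in the estimate.\<close>

lemma energy_identity_le:
  fixes u' u v :: "'a::real_inner" and \<omega> :: real
  shows "(norm u')\<^sup>2 / 2 + (norm (u' - u))\<^sup>2 / 4
      + 1 / (8 * (1 + \<omega>\<^sup>2)) * (norm (u' - u + \<omega> *\<^sub>R (u - v)))\<^sup>2
      + 1 / (8 * (1 + \<omega>\<^sup>2)) * (norm (u' - u - \<omega> *\<^sub>R (u - v)))\<^sup>2
    \<le> (u' - u) \<bullet> u' + (norm u)\<^sup>2 / 2 + (norm (u - v))\<^sup>2 / 4"
proof -
  define a b where "a = u' - u" and "b = u - v"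
  define q where "q = 1 / (8 * (1 + \<omega>\<^sup>2))"
  have "a \<bullet> u' = (norm u')\<^sup>2 / 2 - (norm u)\<^sup>2 / 2 + (norm a)\<^sup>2 / 2"
    by (simp add: a_def power2_norm_eq_inner inner_diff_left inner_diff_right inner_commute field_simps)
  \<comment> \<open>Of the right side, the quarter of the square of \<open>a\<close> is half of the
    new dissipation; the quarter of the square of \<open>b\<close> is the amount stored by the
    previous time step.\<close>
  moreover have "q * (norm (a + \<omega> *\<^sub>R b))\<^sup>2 + q * (norm (a - \<omega> *\<^sub>R b))\<^sup>2 \<le> ((norm a)\<^sup>2 + (norm b)\<^sup>2) / 4"
  proof -
    have "(norm (a + \<omega> *\<^sub>R b))\<^sup>2 + (norm (a - \<omega> *\<^sub>R b))\<^sup>2 = 2 * (norm a)\<^sup>2 + 2 * \<omega>\<^sup>2 * (norm b)\<^sup>2"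
      unfolding power2_norm_eq_inner
      by (simp add: inner_left_distrib inner_right_distrib inner_diff_left inner_diff_right inner_commute power2_eq_square algebra_simps)
    then have "q * (norm (a + \<omega> *\<^sub>R b))\<^sup>2 + q * (norm (a - \<omega> *\<^sub>R b))\<^sup>2 = q * (2 * (norm a)\<^sup>2 + 2 * \<omega>\<^sup>2 * (norm b)\<^sup>2)"
      by (simp flip: distrib_left)
    also have "\<dots> \<le> ((norm a)\<^sup>2 + (norm b)\<^sup>2) / 4"
    proof -
      have "0 < 1 + \<omega>\<^sup>2" by (simp add: add_pos_nonneg)
      moreover have "(norm a)\<^sup>2 + \<omega>\<^sup>2 * (norm b)\<^sup>2 \<le> (1 + \<omega>\<^sup>2) * ((norm a)\<^sup>2 + (norm b)\<^sup>2)"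
        by (simp add: algebra_simps)
      ultimately show ?thesis by (simp add: q_def field_simps)
    qed
    finally show ?thesis .
  qed
  \<comment> \<open>With the squared norms replaced by free reals, linear arithmetic
    remains.\<close>
  moreover have "U / 2 + A / 4 + Y + Z \<le> x + V / 2 + B / 4"
    if "x = U / 2 - V / 2 + A / 2" "Y + Z \<le> (A + B) / 4" for A B U V x Y Z :: real
    using that by (simp add: field_simps)
  ultimately show ?thesis
    unfolding a_def[symmetric] b_def[symmetric] q_def[symmetric] by blast
qed

text \<open>The budget for the viscous term: Young's inequality spends one quarter on the force and
  one on the convective term, a third quarter is kept in the estimate, and the last is dropped.
  \<open>q\<close> is the share of the dissipation that pays for the square of
  \<open>w\<close>.\<close>

lemma absorb_le:
  fixes \<nu> \<tau> g w k F q b :: real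
  assumes "0 < \<nu>" "0 \<le> \<tau>" and b: "\<bar>b\<bar> \<le> k * g * w" and k: "\<tau> * k\<^sup>2 / \<nu> \<le> q"
  shows "\<tau> * (F * g) - \<tau> * b + \<nu> / 4 * (\<tau> * g\<^sup>2) \<le> \<tau> * \<nu> * g\<^sup>2 + \<tau> / \<nu> * F\<^sup>2 + q * w\<^sup>2"
proof -
  have Y: "x * g \<le> x\<^sup>2 / \<nu> + \<nu> / 4 * g\<^sup>2" for x
  proof -
    have "0 \<le> (x / \<nu> - g / 2)\<^sup>2 * \<nu>" using assms by simp
    also have "\<dots> = x\<^sup>2 / \<nu> + \<nu> / 4 * g\<^sup>2 - x * g"
      using assms by (simp add: power2_eq_square field_simps)
    finally show ?thesis by simp
  qed
  have "\<tau> * (F * g) \<le> \<tau> * (F\<^sup>2 / \<nu> + \<nu> / 4 * g\<^sup>2)"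
    using assms by (intro mult_left_mono Y)
  moreover have "\<tau> * (- b) \<le> \<tau> * ((k * w)\<^sup>2 / \<nu> + \<nu> / 4 * g\<^sup>2)"
    using b Y[of "k * w"] assms(2) by (intro mult_left_mono) (auto simp: mult_ac)
  moreover have "\<tau> * k\<^sup>2 / \<nu> * w\<^sup>2 \<le> q * w\<^sup>2"
    using k by (intro mult_right_mono) auto
  moreover have "0 \<le> \<tau> * \<nu> * g\<^sup>2" using assms by simp
  ultimately show ?thesis by (simp add: power_mult_distrib algebra_simps)
qed

lemma sum_telescope_le:
  fixes s x y :: "nat \<Rightarrow> real"
  assumes "\<And>n. 1 \<le> n \<Longrightarrow> n \<le> m \<Longrightarrow> s (Suc n) + x n \<le> s n + y n"
  shows "s (Suc m) + (\<Sum>n = 1..m. x n) \<le> (\<Sum>n = 1..m. y n) + s 1"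
  using assms
proof (induction m)
  case (Suc m)
  then have "s (Suc m) + (\<Sum>n = 1..m. x n) \<le> (\<Sum>n = 1..m. y n) + s 1" by simp
  with Suc.prems[of "Suc m"] show ?case by simp
qed simp

lemma (in bounded_domain) energy_inequality_integrated:
  assumes H: "u' \<in> H10 \<Omega>" "u \<in> H10 \<Omega>" "v \<in> H10 \<Omega>"
  shows "(nv \<Omega> u')\<^sup>2 / 2 + (nv \<Omega> (\<lambda>x. u' x - u x))\<^sup>2 / 4
      + 1 / (8 * (1 + \<omega>\<^sup>2)) * (nv \<Omega> (\<lambda>x. u' x - u x + \<omega> *\<^sub>R (u x - v x)))\<^sup>2
      + 1 / (8 * (1 + \<omega>\<^sup>2)) * (nv \<Omega> (\<lambda>x. u' x - u x - \<omega> *\<^sub>R (u x - v x)))\<^sup>2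
    \<le> ipv \<Omega> (\<lambda>x. u' x - u x) u' + (nv \<Omega> u)\<^sup>2 / 2 + (nv \<Omega> (\<lambda>x. u x - v x))\<^sup>2 / 4"
proof -
  define q where "q = 1 / (8 * (1 + \<omega>\<^sup>2))"
  have c: "memL M 2 (\<lambda>x. z x $ i)" if "z \<in> H10 \<Omega>" for z i
    using H10_component[OF that] by (rule H10s_memL2)
  have d: "memL M 2 (\<lambda>x. (u' x - u x) $ i)" "memL M 2 (\<lambda>x. (u x - v x) $ i)" for i
    using memL_diff[OF c[OF H(1)] c[OF H(2)]] memL_diff[OF c[OF H(2)] c[OF H(3)]] by simp_all
  have d': "memL M 2 (\<lambda>x. (u' x - u x + \<omega> *\<^sub>R (u x - v x)) $ i)"
    "memL M 2 (\<lambda>x. (u' x - u x - \<omega> *\<^sub>R (u x - v x)) $ i)" for i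
    using memL_lincomb[OF d(1)[of i] d(2)[of i], of 1 \<omega>] memL_lincomb[OF d(1)[of i] d(2)[of i], of 1 "- \<omega>"]
    by simp_all
  have int: "integrable M (\<lambda>x. (norm (z x))\<^sup>2)" if "\<And>i. memL M 2 (\<lambda>x. z x $ i)" for z :: "real^'d \<Rightarrow> real^'d"
    using memL_norm_vec[of M 2 z] that by (simp add: memL_def)
  note i = int[of u', OF c[OF H(1)]] int[of u, OF c[OF H(2)]] int[OF d(1)] int[OF d(2)] int[OF d'(1)] int[OF d'(2)]
  have ip: "integrable M (\<lambda>x. (u' x - u x) \<bullet> u' x)"
    unfolding inner_vec_def inner_real_def
    by (intro Bochner_Integration.integrable_sum memL_Cauchy_Schwarz(1) d c H)
  have nv: "(nv \<Omega> z)\<^sup>2 = (\<integral>x. (norm (z x))\<^sup>2 \<partial>M)" for z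
    by (simp add: nv_eq_normL normL_power)
  have "(nv \<Omega> u')\<^sup>2 / 2 + (nv \<Omega> (\<lambda>x. u' x - u x))\<^sup>2 / 4
      + q * (nv \<Omega> (\<lambda>x. u' x - u x + \<omega> *\<^sub>R (u x - v x)))\<^sup>2
      + q * (nv \<Omega> (\<lambda>x. u' x - u x - \<omega> *\<^sub>R (u x - v x)))\<^sup>2
    = (\<integral>x. (norm (u' x))\<^sup>2 / 2 + (norm (u' x - u x))\<^sup>2 / 4
      + q * (norm (u' x - u x + \<omega> *\<^sub>R (u x - v x)))\<^sup>2
      + q * (norm (u' x - u x - \<omega> *\<^sub>R (u x - v x)))\<^sup>2 \<partial>M)"
    unfolding nv using i by simp
  also have "\<dots> \<le> (\<integral>x. (u' x - u x) \<bullet> u' x + (norm (u x))\<^sup>2 / 2 + (norm (u x - v x))\<^sup>2 / 4 \<partial>M)"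
    unfolding q_def
    by (intro integral_mono energy_identity_le Bochner_Integration.integrable_add
        integrable_mult_right integrable_divide i ip)
  also have "\<dots> = ipv \<Omega> (\<lambda>x. u' x - u x) u' + (nv \<Omega> u)\<^sup>2 / 2 + (nv \<Omega> (\<lambda>x. u x - v x))\<^sup>2 / 4"
    unfolding nv ipv_def integ_def using i ip by simp
  finally show ?thesis unfolding q_def .
qed

lemma vsubspace_lincomb:
  "vsubspace S \<Longrightarrow> v \<in> S \<Longrightarrow> w \<in> S \<Longrightarrow> (\<lambda>x. a *\<^sub>R v x + w x) \<in> S"
  by (simp add: vsubspace_def)

lemma vsubspace_scaleR:
  assumes "vsubspace S" "v \<in> S"
  shows "(\<lambda>x. a *\<^sub>R v x) \<in> S"
  using vsubspace_lincomb[OF assms, of "\<lambda>x. 0" a] assms(1) by (simp add: vsubspace_def)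

lemma vsubspace_lincomb2:
  assumes "vsubspace S" "v \<in> S" "w \<in> S"
  shows "(\<lambda>x. a *\<^sub>R v x + b *\<^sub>R w x) \<in> S"
  using assms by (intro vsubspace_lincomb vsubspace_scaleR)

text \<open>One summand of the telescoping sum. The square of \<open>w\<close> is a gain in
  \<open>energy_inequality_integrated\<close> and a cost in \<open>absorb_le\<close>, with the same
  weight \<open>q\<close>, so it cancels.\<close>

lemma (in bounded_domain) energy_step:
  assumes inv: "inverse_ineqs \<Omega> Xh h Cinv" and h: "0 < h" "h \<le> radius"
    and X: "Xh \<subseteq> H10 \<Omega>" "vsubspace Xh" and \<nu>: "0 < \<nu>" and dt: "0 < dt t n"
    and u: "u (Suc n) \<in> Xh" "u n \<in> Xh" "u (n - 1) \<in> Xh"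
    and f: "\<And>i. L2 \<Omega> (\<lambda>x. f (Suc n) x $ i)"
    and mom: "\<And>v. v \<in> Xh \<Longrightarrow> ipv \<Omega> (\<lambda>x. (1 / dt t n) *\<^sub>R (u (Suc n) x - u n x)) v
                 + \<nu> * gip \<Omega> (u (Suc n)) v
                 + bstar \<Omega> (Ext t u n) (Ext t u n) v
                 - ips \<Omega> (p (Suc n)) (vdiv \<Omega> v)
                 = ipv \<Omega> (f (Suc n)) v"
    and div: "ips \<Omega> (vdiv \<Omega> (u (Suc n))) (p (Suc n)) = 0"
  defines "C \<equiv> max 1 Cinv * radius * (1 + sobK)"
  assumes cfl: "1 - 16 * C\<^sup>2 * dt t n * (1 + (om t n)\<^sup>2) / (\<nu> * h\<^sup>2) * (lpn \<Omega> 3 (Ext t u n))\<^sup>2 \<ge> 0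
      \<or> 1 - 16 * C\<^sup>2 * dt t n * (1 + (om t n)\<^sup>2) / (\<nu> * h)
            * ((lpn \<Omega> 6 (Ext t u n))\<^sup>2 + (ns \<Omega> (vdiv \<Omega> (Ext t u n)))\<^sup>2) \<ge> 0"
  shows "(nv \<Omega> (u (Suc n)))\<^sup>2 / 2 + (nv \<Omega> (\<lambda>x. u (Suc n) x - u n x))\<^sup>2 / 4
      + (\<nu> / 4 * (dt t n * (gnorm \<Omega> (u (Suc n)))\<^sup>2)
        + 1 / (8 * (1 + (om t n)\<^sup>2)) * (nv \<Omega> (\<lambda>x. u (Suc n) x - u n x + om t n *\<^sub>R (u n x - u (n - 1) x)))\<^sup>2)
    \<le> (nv \<Omega> (u n))\<^sup>2 / 2 + (nv \<Omega> (\<lambda>x. u n x - u (n - 1) x))\<^sup>2 / 4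
      + dt t n / \<nu> * (hm1 \<Omega> (f (Suc n)))\<^sup>2"
proof -
  define \<tau> \<omega> where "\<tau> = dt t n" and "\<omega> = om t n"
  define e where "e = Ext t u n"
  define w where "w = (\<lambda>x. u (Suc n) x - u n x - \<omega> *\<^sub>R (u n x - u (n - 1) x))"
  define q where "q = 1 / (8 * (1 + \<omega>\<^sup>2))"
  define b where "b = bstar \<Omega> e e (u (Suc n))"
  define g where "g = gnorm \<Omega> (u (Suc n))"
  have w1: "0 < 1 + \<omega>\<^sup>2" by (simp add: add_pos_nonneg)
  \<comment> \<open>The extrapolation, and with it \<open>w\<close>, must lie in the discrete space
    because the inverse estimates hold only there.\<close>
  have eX: "e \<in> Xh"
    using vsubspace_lincomb2[OF X(2) u(2,3), of "1 + \<omega>" "- \<omega>"] by (simp add: e_def Ext_def \<omega>_def)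
  have "(\<lambda>x. 1 *\<^sub>R u (Suc n) x + (- 1) *\<^sub>R e x) \<in> Xh"
    by (intro vsubspace_lincomb2 X u eX)
  moreover have w_eq: "w = (\<lambda>x. u (Suc n) x - e x)"
    by (simp add: w_def e_def Ext_def \<omega>_def fun_eq_iff algebra_simps)
  ultimately have wX: "w \<in> Xh" by simp
  have e_eq: "e = (\<lambda>x. u (Suc n) x - w x)" by (simp add: w_eq)
  note bounds = bstar_bounds_discrete[OF inv h X(1) eX u(1) wX e_eq, folded C_def b_def g_def]
  \<comment> \<open>Each time step condition enters only through such a factor \<open>k\<close>;
    from here on the two cases coincide.\<close>
  have "\<exists>k. \<bar>b\<bar> \<le> k * g * nv \<Omega> w \<and> \<tau> * k\<^sup>2 / \<nu> \<le> q"
    using cfl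
  proof
    assume c: "1 - 16 * C\<^sup>2 * dt t n * (1 + (om t n)\<^sup>2) / (\<nu> * h\<^sup>2) * (lpn \<Omega> 3 (Ext t u n))\<^sup>2 \<ge> 0"
    let ?k = "C * lpn \<Omega> 3 e / h"
    have "16 * (1 + \<omega>\<^sup>2) * (\<tau> * ?k\<^sup>2 / \<nu>) = 16 * C\<^sup>2 * \<tau> * (1 + \<omega>\<^sup>2) / (\<nu> * h\<^sup>2) * (lpn \<Omega> 3 e)\<^sup>2"
      by (simp add: power_mult_distrib power_divide algebra_simps)
    also have "\<dots> \<le> 1" using c by (simp add: e_def \<tau>_def \<omega>_def)
    finally have "\<tau> * ?k\<^sup>2 / \<nu> \<le> 1 / (16 * (1 + \<omega>\<^sup>2))"
      using w1 by (simp add: pos_le_divide_eq mult.commute)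
    \<comment> \<open>The first condition with constant 16 C^2 leaves a factor 2 to spare; the
      second spends it on the square of \<open>?a + ?d\<close>.\<close>
    also have "\<dots> \<le> q" unfolding q_def using w1 by (intro divide_left_mono) auto
    finally show ?thesis using bounds(1) by blast
  next
    assume c: "1 - 16 * C\<^sup>2 * dt t n * (1 + (om t n)\<^sup>2) / (\<nu> * h)
            * ((lpn \<Omega> 6 (Ext t u n))\<^sup>2 + (ns \<Omega> (vdiv \<Omega> (Ext t u n)))\<^sup>2) \<ge> 0"
    let ?a = "lpn \<Omega> 6 e" and ?d = "ns \<Omega> (vdiv \<Omega> e)"
    let ?k = "C * (?a + ?d) / sqrt h"
    have "(?a + ?d)\<^sup>2 \<le> 2 * (?a\<^sup>2 + ?d\<^sup>2)"
      using sum_squares_bound[of ?a ?d] by (simp add: power2_sum)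
    then have "8 * (1 + \<omega>\<^sup>2) * \<tau> * C\<^sup>2 / (\<nu> * h) * (?a + ?d)\<^sup>2 \<le> 8 * (1 + \<omega>\<^sup>2) * \<tau> * C\<^sup>2 / (\<nu> * h) * (2 * (?a\<^sup>2 + ?d\<^sup>2))"
      using w1 dt \<nu> h by (intro mult_left_mono) (auto simp: \<tau>_def)
    also have "\<dots> = 16 * C\<^sup>2 * \<tau> * (1 + \<omega>\<^sup>2) / (\<nu> * h) * (?a\<^sup>2 + ?d\<^sup>2)" by (simp add: algebra_simps)
    also have "\<dots> \<le> 1" using c by (simp add: e_def \<tau>_def \<omega>_def)
    also have "8 * (1 + \<omega>\<^sup>2) * \<tau> * C\<^sup>2 / (\<nu> * h) * (?a + ?d)\<^sup>2 = 8 * (1 + \<omega>\<^sup>2) * (\<tau> * ?k\<^sup>2 / \<nu>)"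
      using h by (simp add: power_mult_distrib power_divide mult_ac)
    finally have "\<tau> * ?k\<^sup>2 / \<nu> \<le> q"
      unfolding q_def using w1 by (simp add: pos_le_divide_eq mult.commute)
    then show ?thesis using bounds(2) by blast
  qed
  then obtain k where k: "\<bar>b\<bar> \<le> k * g * nv \<Omega> w" "\<tau> * k\<^sup>2 / \<nu> \<le> q" by blast
  have "ips \<Omega> (p (Suc n)) (vdiv \<Omega> (u (Suc n))) = 0"
    using div by (simp add: ips_def mult.commute)
  moreover have "ipv \<Omega> (\<lambda>x. (1 / dt t n) *\<^sub>R (u (Suc n) x - u n x)) (u (Suc n))
      = ipv \<Omega> (\<lambda>x. u (Suc n) x - u n x) (u (Suc n)) / \<tau>"
    by (simp add: ipv_def integ_def \<tau>_def)
  moreover have "gip \<Omega> (u (Suc n)) (u (Suc n)) = g\<^sup>2"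
  proof -
    have "0 \<le> gip \<Omega> (u (Suc n)) (u (Suc n))"
      unfolding gip_def integ_def by (intro integral_nonneg_AE AE_I2 sum_nonneg) simp
    then show ?thesis by (simp add: g_def gnorm_def)
  qed
  moreover have "ipv \<Omega> (f (Suc n)) (u (Suc n)) \<le> hm1 \<Omega> (f (Suc n)) * g"
    unfolding g_def using u(1) X(1) f by (intro ipv_le_hm1) auto
  ultimately have "ipv \<Omega> (\<lambda>x. u (Suc n) x - u n x) (u (Suc n)) / \<tau> + \<nu> * g\<^sup>2 + b \<le> hm1 \<Omega> (f (Suc n)) * g"
    using mom[OF u(1)] by (simp add: b_def e_def)
  then have "\<tau> * (ipv \<Omega> (\<lambda>x. u (Suc n) x - u n x) (u (Suc n)) / \<tau> + \<nu> * g\<^sup>2 + b) \<le> \<tau> * (hm1 \<Omega> (f (Suc n)) * g)"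
    using dt by (intro mult_left_mono) (auto simp: \<tau>_def)
  then have "ipv \<Omega> (\<lambda>x. u (Suc n) x - u n x) (u (Suc n)) + \<tau> * \<nu> * g\<^sup>2 + \<tau> * b \<le> \<tau> * (hm1 \<Omega> (f (Suc n)) * g)"
    using dt by (simp add: \<tau>_def distrib_left)
  moreover have "\<tau> * (hm1 \<Omega> (f (Suc n)) * g) - \<tau> * b + \<nu> / 4 * (\<tau> * g\<^sup>2)
      \<le> \<tau> * \<nu> * g\<^sup>2 + \<tau> / \<nu> * (hm1 \<Omega> (f (Suc n)))\<^sup>2 + q * (nv \<Omega> w)\<^sup>2"
    using k dt \<nu> by (intro absorb_le) (auto simp: \<tau>_def)
  moreover have "(nv \<Omega> (u (Suc n)))\<^sup>2 / 2 + (nv \<Omega> (\<lambda>x. u (Suc n) x - u n x))\<^sup>2 / 4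
      + q * (nv \<Omega> (\<lambda>x. u (Suc n) x - u n x + \<omega> *\<^sub>R (u n x - u (n - 1) x)))\<^sup>2 + q * (nv \<Omega> w)\<^sup>2
    \<le> ipv \<Omega> (\<lambda>x. u (Suc n) x - u n x) (u (Suc n)) + (nv \<Omega> (u n))\<^sup>2 / 2 + (nv \<Omega> (\<lambda>x. u n x - u (n - 1) x))\<^sup>2 / 4"
    unfolding q_def w_def using u X(1) by (intro energy_inequality_integrated) auto
  ultimately show ?thesis
    unfolding \<tau>_def[symmetric] \<omega>_def[symmetric] q_def[symmetric] g_def[symmetric] by linarith
qed

theorem mainTheorem4:
  fixes \<Omega> :: "(real^'d::finite) set" and \<sigma> Cinv :: real
  assumes dim: "CARD('d) = 2 \<or> CARD('d) = 3"
    and dom: "poly_domain \<Omega>"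
  shows "\<exists>Cstab > 0. \<forall>(T :: (real^'d) set set) Xh Qh \<beta> h N t \<nu> u p f.
     triangulation \<Omega> T \<and> quasi_uniform \<sigma> T \<and> h = mesh_size T
   \<and> fe_velocity \<Omega> T Xh \<and> fe_pressure \<Omega> T Qh \<and> inf_sup \<Omega> Xh Qh \<beta>
   \<and> inverse_ineqs \<Omega> Xh h Cinv
   \<and> N > 1 \<and> t 0 = 0 \<and> (\<forall>n<N. t n < t (Suc n)) \<and> \<nu> > 0
   \<and> u 0 \<in> Xh \<and> u 1 \<in> Xh
   \<and> (\<forall>n i. L2 \<Omega> (\<lambda>x. f n x $ i))
   \<and> vss_be_ab2 \<Omega> Xh Qh \<nu> t N u p f
   \<and> (\<forall>n. 1 \<le> n \<and> n \<le> N - 1 \<longrightarrow>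
        1 - Cstab * dt t n * (1 + (om t n)\<^sup>2) / (\<nu> * h\<^sup>2) * (lpn \<Omega> 3 (Ext t u n))\<^sup>2 \<ge> 0
      \<or> 1 - Cstab * dt t n * (1 + (om t n)\<^sup>2) / (\<nu> * h)
            * ((lpn \<Omega> 6 (Ext t u n))\<^sup>2 + (ns \<Omega> (vdiv \<Omega> (Ext t u n)))\<^sup>2) \<ge> 0)
   \<longrightarrow>
     (nv \<Omega> (u N))\<^sup>2 / 2 + (nv \<Omega> (\<lambda>x. u N x - u (N - 1) x))\<^sup>2 / 4
     + \<nu> / 4 * (\<Sum>n = 1..N - 1. dt t n * (gnorm \<Omega> (u (Suc n)))\<^sup>2)
     + (\<Sum>n = 1..N - 1. 1 / (8 * (1 + (om t n)\<^sup>2))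
          * (nv \<Omega> (\<lambda>x. u (Suc n) x - u n x + om t n *\<^sub>R (u n x - u (n - 1) x)))\<^sup>2)
   \<le> (\<Sum>n = 1..N - 1. dt t n / \<nu> * (hm1 \<Omega> (f (Suc n)))\<^sup>2)
     + (nv \<Omega> (u 1))\<^sup>2 / 2 + (nv \<Omega> (\<lambda>x. u 1 x - u 0 x))\<^sup>2 / 4"
proof -
  interpret bounded_domain \<Omega>
    using dim dom by unfold_locales (auto simp: poly_domain_def)
  \<comment> \<open>Built from the domain and \<open>Cinv\<close> alone, hence fixed before the
    mesh, the time grid, the viscosity and the solution.\<close>
  define C where "C = max 1 Cinv * radius * (1 + sobK)"
  have "0 < C" unfolding C_def using radius_ge_1 sobK_pos by (intro mult_pos_pos) auto
  show ?thesis
  proof (intro exI[of _ "16 * C\<^sup>2"] conjI allI impI; (elim conjE)?)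
    show "0 < 16 * C\<^sup>2" using \<open>0 < C\<close> by simp
    fix T :: "(real^'d) set set" and Xh Qh \<beta> h and N :: nat and t \<nu> u p f
    assume T: "triangulation \<Omega> T" "quasi_uniform \<sigma> T" "h = mesh_size T"
      and Xh: "fe_velocity \<Omega> T Xh" and inv: "inverse_ineqs \<Omega> Xh h Cinv"
      and N: "1 < N" and t: "\<forall>n<N. t n < t (Suc n)" and \<nu>: "0 < \<nu>"
      and u01: "u 0 \<in> Xh" "u 1 \<in> Xh" and f: "\<forall>n i. L2 \<Omega> (\<lambda>x. f n x $ i)"
      and vss: "vss_be_ab2 \<Omega> Xh Qh \<nu> t N u p f"
      and cfl: "\<forall>n. 1 \<le> n \<and> n \<le> N - 1 \<longrightarrow>
        1 - 16 * C\<^sup>2 * dt t n * (1 + (om t n)\<^sup>2) / (\<nu> * h\<^sup>2) * (lpn \<Omega> 3 (Ext t u n))\<^sup>2 \<ge> 0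
      \<or> 1 - 16 * C\<^sup>2 * dt t n * (1 + (om t n)\<^sup>2) / (\<nu> * h)
            * ((lpn \<Omega> 6 (Ext t u n))\<^sup>2 + (ns \<Omega> (vdiv \<Omega> (Ext t u n)))\<^sup>2) \<ge> 0"
    have h: "0 < h" "h \<le> radius"
      using mesh_size_bounds[OF T(1,2) bounded_dom] T(3) by (auto simp: radius_def)
    have X: "Xh \<subseteq> H10 \<Omega>" "vsubspace Xh" using Xh by (auto simp: fe_velocity_def)
    have uX: "u n \<in> Xh" if "n \<le> N" for n
    proof -
      consider "n = 0" | "n = 1" | m where "n = Suc m" "1 \<le> m" by (cases n) fastforce+
      then show ?thesis
        using u01 vss that by cases (auto simp: vss_be_ab2_def)
    qed
    let ?s = "\<lambda>n. (nv \<Omega> (u n))\<^sup>2 / 2 + (nv \<Omega> (\<lambda>x. u n x - u (n - 1) x))\<^sup>2 / 4"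
    let ?x = "\<lambda>n. \<nu> / 4 * (dt t n * (gnorm \<Omega> (u (Suc n)))\<^sup>2)
        + 1 / (8 * (1 + (om t n)\<^sup>2)) * (nv \<Omega> (\<lambda>x. u (Suc n) x - u n x + om t n *\<^sub>R (u n x - u (n - 1) x)))\<^sup>2"
    let ?y = "\<lambda>n. dt t n / \<nu> * (hm1 \<Omega> (f (Suc n)))\<^sup>2"
    have step: "?s (Suc n) + ?x n \<le> ?s n + ?y n" if n: "1 \<le> n" "n \<le> N - 1" for n
    proof -
      have "0 < dt t n" using t n N by (simp add: dt_def)
      moreover have "u (Suc n) \<in> Xh" "u n \<in> Xh" "u (n - 1) \<in> Xh" using n N by (auto intro!: uX)
      moreover have "ips \<Omega> (vdiv \<Omega> (u (Suc n))) (p (Suc n)) = 0"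
        using vss n by (auto simp: vss_be_ab2_def)
      moreover have "ipv \<Omega> (\<lambda>x. (1 / dt t n) *\<^sub>R (u (Suc n) x - u n x)) v + \<nu> * gip \<Omega> (u (Suc n)) v
          + bstar \<Omega> (Ext t u n) (Ext t u n) v - ips \<Omega> (p (Suc n)) (vdiv \<Omega> v) = ipv \<Omega> (f (Suc n)) v"
        if "v \<in> Xh" for v
        using vss n that unfolding vss_be_ab2_def by blast
      ultimately show ?thesis
        using energy_step[OF inv h X \<nu>, of t n u f p, folded C_def] cfl n f by simp
    qed
    \<comment> \<open>Since N > 1, \<open>Suc (N - 1)\<close> is \<open>N\<close>, and
      \<open>?s 1\<close> contains exactly the two initial terms with \<open>u 1\<close> and
      \<open>u 0\<close>.\<close>
    have "?s (Suc (N - 1)) + (\<Sum>n = 1..N - 1. ?x n) \<le> (\<Sum>n = 1..N - 1. ?y n) + ?s 1"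
      by (rule sum_telescope_le[where s="?s"]) (rule step)
    then show "(nv \<Omega> (u N))\<^sup>2 / 2 + (nv \<Omega> (\<lambda>x. u N x - u (N - 1) x))\<^sup>2 / 4
     + \<nu> / 4 * (\<Sum>n = 1..N - 1. dt t n * (gnorm \<Omega> (u (Suc n)))\<^sup>2)
     + (\<Sum>n = 1..N - 1. 1 / (8 * (1 + (om t n)\<^sup>2))
          * (nv \<Omega> (\<lambda>x. u (Suc n) x - u n x + om t n *\<^sub>R (u n x - u (n - 1) x)))\<^sup>2)
   \<le> (\<Sum>n = 1..N - 1. dt t n / \<nu> * (hm1 \<Omega> (f (Suc n)))\<^sup>2)
     + (nv \<Omega> (u 1))\<^sup>2 / 2 + (nv \<Omega> (\<lambda>x. u 1 x - u 0 x))\<^sup>2 / 4"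
      using N by (simp add: sum.distrib sum_distrib_left)
  qed
qed

end
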